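(* It is NP-hard to decide whether a given digraph with maximum degree $6$ is $2$-colorable.
   Context: Digraphs are loopless and have no parallel arcs, but digons are allowed. The degree of a vertex is its in-degree plus its out-degree. A digraph is $2$-colorable if its vertices can be colored with $2$ colors so that each color class induces an acyclic subdigraph. *)

theory Defs
  imports
    "Graph_Theory.Pair_Digraph"
    "Graph_Theory.Digraph_Component"
    "HOL-Computational_Algebra.Polynomial"
begin

section \<open>Multi-tape Turing machines\<close>

text \<open>
  States and tape symbols are initial segments of the naturals. State 0 is the initial state and
  state 1 the accepting state; symbol 0 is the blank, symbols 1 and 2 stand for the input bits
  \<^const>\<open>False\<close> and \<^const>\<open>True\<close>. Tapes are infinite in both directions.
  The transition table maps a state and the list of scanned symbols to the set of possible
  actions, an action being a new state together with a written symbol and a head move for each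
  tape; a machine halts when there is no possible action.
\<close>

datatype move = Left | Stay | Right

record tm =
  tm_tapes :: nat
  tm_syms :: nat
  tm_states :: nat
  tm_trans :: "nat \<Rightarrow> nat list \<Rightarrow> (nat \<times> (nat \<times> move) list) set"

definition tm_wf :: "tm \<Rightarrow> bool" where
  "tm_wf M \<longleftrightarrow> tm_tapes M \<ge> 1 \<and> tm_syms M \<ge> 3 \<and> tm_states M \<ge> 2 \<and>
    (\<forall>q ss. q < tm_states M \<and> length ss = tm_tapes M \<and> set ss \<subseteq> {..<tm_syms M} \<longrightarrow>
      (\<forall>(q', acts) \<in> tm_trans M q ss.
        q' < tm_states M \<and> length acts = tm_tapes M \<and> fst ` set acts \<subseteq> {..<tm_syms M}))"

definition tm_deterministic :: "tm \<Rightarrow> bool" where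
  "tm_deterministic M \<longleftrightarrow>
    (\<forall>q ss. \<forall>a \<in> tm_trans M q ss. \<forall>b \<in> tm_trans M q ss. a = b)"

text \<open>A tape is its contents together with the head position.\<close>

type_synonym tape = "(int \<Rightarrow> nat) \<times> int"
type_synonym config = "nat \<times> tape list"

fun read_tape :: "tape \<Rightarrow> nat" where
  "read_tape (w, i) = w i"

fun move_head :: "move \<Rightarrow> int \<Rightarrow> int" where
  "move_head Left i = i - 1"
| "move_head Stay i = i"
| "move_head Right i = i + 1"

fun act_tape :: "nat \<times> move \<Rightarrow> tape \<Rightarrow> tape" where
  "act_tape (s, d) (w, i) = (w(i := s), move_head d i)"

definition tm_step :: "tm \<Rightarrow> config \<Rightarrow> config \<Rightarrow> bool" where
  "tm_step M c c' \<longleftrightarrow>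
    (\<exists>(q', acts) \<in> tm_trans M (fst c) (map read_tape (snd c)).
      c' = (q', map2 act_tape acts (snd c)))"

definition tm_halted :: "tm \<Rightarrow> config \<Rightarrow> bool" where
  "tm_halted M c \<longleftrightarrow> (\<nexists>c'. tm_step M c c')"

definition contents :: "bool list \<Rightarrow> int \<Rightarrow> nat" where
  "contents x i =
    (if 0 \<le> i \<and> i < int (length x) then (if x ! nat i then 2 else 1) else 0)"

definition tm_init :: "tm \<Rightarrow> bool list \<Rightarrow> config" where
  "tm_init M x = (0, (contents x, 0) # replicate (tm_tapes M - 1) (contents [], 0))"

section \<open>NP and polynomial-time reductions\<close>

text \<open>
  Time bounds are polynomials with natural coefficients in the input length. Every computation
  path of a nondeterministic machine must respect the bound, and the input is accepted iff some
  path halts in the accepting state.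
\<close>

definition NP :: "bool list set set" where
  "NP = {L. \<exists>M (p :: nat poly). tm_wf M \<and>
    (\<forall>x c t. (tm_step M ^^ t) (tm_init M x) c \<longrightarrow> t \<le> poly p (length x)) \<and>
    (\<forall>x. x \<in> L \<longleftrightarrow> (\<exists>c. (tm_step M)\<^sup>*\<^sup>* (tm_init M x) c \<and> tm_halted M c \<and> fst c = 1))}"

text \<open>The last tape is the output tape.\<close>

definition poly_time_computable :: "(bool list \<Rightarrow> bool list) \<Rightarrow> bool" where
  "poly_time_computable f \<longleftrightarrow> (\<exists>M (p :: nat poly). tm_wf M \<and> tm_deterministic M \<and>
    (\<forall>x. \<exists>t c. t \<le> poly p (length x) \<and> (tm_step M ^^ t) (tm_init M x) c \<and> tm_halted M c \<and>
      fst (last (snd c)) = contents (f x)))"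

text \<open>
  A decision problem consists of a set \<open>I\<close> of instances, written as bit strings by means of an
  injective encoding \<open>enc\<close>, and a property \<open>P\<close> of instances that has to be decided. It is NP-hard
  if every language in NP is polynomial-time many-one reducible to it; reductions only
  produce encodings of elements of \<open>I\<close>.
\<close>

definition NP_hard :: "('a \<Rightarrow> bool list) \<Rightarrow> 'a set \<Rightarrow> ('a \<Rightarrow> bool) \<Rightarrow> bool" where
  "NP_hard enc I P \<longleftrightarrow>
    (\<forall>L \<in> NP. \<exists>f. poly_time_computable f \<and>
      (\<forall>x. \<exists>G \<in> I. f x = enc G \<and> (x \<in> L \<longleftrightarrow> P G)))"

section \<open>Digraphs\<close>

definition vertex_degree :: "('a, 'b) pre_digraph \<Rightarrow> 'a \<Rightarrow> nat" where
  "vertex_degree G v = in_degree G v + out_degree G v"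

text \<open>Inserting 0 only matters for the digraph without vertices.\<close>

definition max_degree :: "('a, 'b) pre_digraph \<Rightarrow> nat" where
  "max_degree G = Max (insert 0 (vertex_degree G ` verts G))"

definition acyclic_digraph :: "('a, 'b) pre_digraph \<Rightarrow> bool" where
  "acyclic_digraph G \<longleftrightarrow> (\<nexists>p. pre_digraph.cycle G p)"

definition colorable :: "nat \<Rightarrow> ('a, 'b) pre_digraph \<Rightarrow> bool" where
  "colorable k G \<longleftrightarrow> (\<exists>col :: 'a \<Rightarrow> nat. (\<forall>v \<in> verts G. col v < k) \<and>
    (\<forall>i < k. acyclic_digraph (G \<restriction> {v \<in> verts G. col v = i})))"

text \<open>
  As inputs of algorithms, digraphs have vertices \<open>0, \<dots>, n - 1\<close> and are
  given by the rows of their adjacency matrix. Arcs are pairs of vertices, so there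
  are no parallel arcs.
\<close>

definition input_digraphs :: "nat pair_pre_digraph set" where
  "input_digraphs = {G. pair_digraph G \<and> (\<exists>n. pverts G = {..<n})}"

definition adjacency_string :: "nat pair_pre_digraph \<Rightarrow> bool list" where
  "adjacency_string G = (let n = card (pverts G) in
    map (\<lambda>e. e \<in> parcs G) (List.product [0..<n] [0..<n]))"

lemma inj_on_adjacency_string: "inj_on adjacency_string input_digraphs"
proof (rule inj_onI)
  fix G H
  assume G: "G \<in> input_digraphs" and H: "H \<in> input_digraphs"
    and eq: "adjacency_string G = adjacency_string H"
  obtain n where n: "pverts G = {..<n}" and Gd: "pair_digraph G"
    using G by (auto simp: input_digraphs_def)
  obtain m where m: "pverts H = {..<m}" and Hd: "pair_digraph H"
    using H by (auto simp: input_digraphs_def)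
  have "n * n = m * m"
    using arg_cong[OF eq, of length] by (simp add: adjacency_string_def Let_def n m)
  then have nm: "n = m"
    by (metis power2_eq_square power2_eq_iff_nonneg zero_le)
  have "e \<in> parcs G \<longleftrightarrow> e \<in> parcs H" if "e \<in> {..<n} \<times> {..<n}" for e
    using eq that by (auto simp: adjacency_string_def Let_def n m nm)
  moreover have "parcs G \<subseteq> {..<n} \<times> {..<n}"
    using pair_wf_digraph.in_arcsD1[of G] pair_wf_digraph.in_arcsD2[of G] Gd n
    by (auto simp: pair_digraph_def pair_fin_digraph_def)
  moreover have "parcs H \<subseteq> {..<n} \<times> {..<n}"
    using pair_wf_digraph.in_arcsD1[of H] pair_wf_digraph.in_arcsD2[of H] Hd m nm
    by (auto simp: pair_digraph_def pair_fin_digraph_def)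
  ultimately have "parcs G = parcs H" by blast
  then show "G = H" using n m nm by simp
qed

end

theory Submission
  imports Defs "HOL-Library.Countable"
begin

text \<open>
  A run of a nondeterministic machine on an input of length \<open>n\<close> is laid out as a grid of cells, row
  \<open>t\<close> being the tapes at time \<open>t\<close>. The current transition is broadcast along its row and head moves
  are signalled across cell borders, so that correctness becomes a constraint between the four
  sides of each cell, whose contents are binary words. Rows are glued to one another, so the cells
  form a single sequence in which cell \<open>s\<close> is adjacent to \<open>s + 1\<close> and \<open>s + W\<close>.

  Every bit becomes a path of digons, along which the two colours alternate. A forbidden assignment
  \<open>a\<close> of the bits of a cell becomes a directed cycle that visits, for every bit, one vertex of its
  path, chosen by parity such that the cycle is monochromatic iff the bits agree with \<open>a\<close> or with
  the complement of \<open>a\<close>. Equality of the words on a common side joins the ends of two paths by a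
  digon. A vertex lies on at most two digons and one of these cycles, so its degree is at most 6; and
  a monochromatic cycle contains no digon arc, so it is one of the disjoint clause cycles.

  Apart from the clause cycles inside a cell, which are determined by its kind (border, first row
  with a given input symbol, ordinary, last row), the arcs between two cells depend only on their
  distance in the sequence. The reduction therefore writes the adjacency matrix by sliding a fixed ruler, marked at the distances \<open>0\<close>, \<open>1\<close>, \<open>-1\<close>, \<open>W\<close>, \<open>-W\<close>,
  over the sequence of cells.
\<close>

text \<open>The main obstacle is that the two colours can always be exchanged: no cycle forbids an
  assignment without also forbidding its complement. The words on the sides therefore carry a
  reference bit. Adjacent cells share it, and since all cells form one sequence, there is a single
  global choice between the true words and their complements.

  Disjointness of the clause cycles is paid for by the length of the paths, which is exponential in
  the number of bits of a cell. This is affordable because the word length depends on the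
  nondeterministic machine alone, so a cell has constant size and all arcs between two given cells
  can be tabulated inside the program of the reduction.

  Instances must have maximum degree exactly 6, so some clause has to be present in every digraph
  produced. It comes from an assignment whose reference bits disagree, which no cell admits.\<close>

section \<open>Acyclic colourings of pair digraphs\<close>

text \<open>Every head but the last is the tail of the next arc. The tails of a closed walk are
  therefore closed under following its arcs.\<close>

lemma cas_head_subset:
  assumes "pre_digraph.cas H u p v"
  shows "head H ` set p \<subseteq> insert v (tail H ` set p)" and "p \<noteq> [] \<Longrightarrow> u \<in> tail H ` set p"
proof -
  have "head H ` set p \<subseteq> insert v (tail H ` set p) \<and> (p \<noteq> [] \<longrightarrow> u \<in> tail H ` set p)"
    using assms
  proof (induction p arbitrary: u)
    case Nil
    then show ?case by simp
  next
    case (Cons e es)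
    have e: "tail H e = u" "pre_digraph.cas H (head H e) es v"
      using Cons.prems by (auto simp: pre_digraph.cas.simps)
    show ?case
      using Cons.IH[OF e(2)] e by (cases es) (auto simp: pre_digraph.cas.simps)
  qed
  then show "head H ` set p \<subseteq> insert v (tail H ` set p)" "p \<noteq> [] \<Longrightarrow> u \<in> tail H ` set p"
    by auto
qed

text \<open>Trades cycles for sets: the tails of a monochromatic cycle form a monochromatic set in
  which every vertex has an out-neighbour, and this local property is what
  \<open>colorable_if_consistent\<close> refutes.\<close>

lemma colorable_2I:
  fixes col :: "'a \<Rightarrow> bool"
  assumes no_closed: "\<And>X b. X \<subseteq> pverts G \<Longrightarrow> X \<noteq> {} \<Longrightarrow> (\<And>v. v \<in> X \<Longrightarrow> col v = b) \<Longrightarrow>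
    (\<And>v. v \<in> X \<Longrightarrow> \<exists>w \<in> X. (v, w) \<in> parcs G) \<Longrightarrow> False"
  shows "colorable 2 (with_proj G)"
  unfolding colorable_def
proof (intro exI conjI ballI allI impI)
  fix v
  show "(if col v then 1 else 0 :: nat) < 2" by simp
next
  fix i :: nat
  let ?H = "with_proj G \<restriction> {v \<in> verts (with_proj G). (if col v then 1 else 0) = i}"
  show "acyclic_digraph ?H"
    unfolding acyclic_digraph_def
  proof
    assume "\<exists>p. pre_digraph.cycle ?H p"
    then obtain p u where p: "pre_digraph.awalk ?H u p u" "p \<noteq> []"
      by (auto simp: pre_digraph.cycle_def)
    have cas: "pre_digraph.cas ?H u p u" and arcs: "set p \<subseteq> arcs ?H"
      using p by (auto simp: pre_digraph.awalk_def)
    let ?X = "fst ` set p"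
    have sub: "snd ` set p \<subseteq> ?X"
      using cas_head_subset[OF cas] p(2) by auto
    show False
    proof (rule no_closed[of ?X "i = 1"])
      show "?X \<subseteq> pverts G" "?X \<noteq> {}" using arcs p(2) by auto
      show "col v = (i = 1)" if "v \<in> ?X" for v
        using that arcs by (auto split: if_splits)
      show "\<exists>w \<in> ?X. (v, w) \<in> parcs G" if v: "v \<in> ?X" for v
      proof -
        from v obtain w where w: "(v, w) \<in> set p" by auto
        then have "w \<in> ?X" using sub by force
        then show ?thesis using arcs w by auto
      qed
    qed
  qed
qed

lemma cas_map_upt:
  assumes "tail H = fst" "head H = snd"
  shows "pre_digraph.cas H (g a) (map (\<lambda>i. (g i, g (Suc i))) [a..<a + n]) (g (a + n))"
proof (induction n arbitrary: a)
  case 0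
  then show ?case by (simp add: pre_digraph.cas.simps)
next
  case (Suc n)
  show ?case
    using Suc[of "Suc a"] assms by (simp add: upt_conv_Cons pre_digraph.cas.simps del: upt_Suc)
qed

lemma cycleI_function:
  assumes H: "tail H = fst" "head H = snd"
    and n: "n > 0" and inj: "inj_on f {..<n}" and v: "f 0 \<in> verts H"
    and arcs: "\<And>i. i < n \<Longrightarrow> (f i, f (Suc i mod n)) \<in> arcs H"
  shows "\<exists>p. pre_digraph.cycle H p"
proof -
  define g where "g i = f (i mod n)" for i
  let ?p = "map (\<lambda>i. (g i, g (Suc i))) [0..<n]"
  have cas: "pre_digraph.cas H (g 0) ?p (g 0)"
    using cas_map_upt[OF H, of g 0 n] by (simp add: g_def)
  have "set ?p \<subseteq> arcs H"
    using arcs by (auto simp: g_def)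
  \<comment> \<open>\<open>cycle\<close> asks for distinctness of all visited vertices but the
    first. These are \<open>g 1\<close>, ..., \<open>g n\<close>, where
    \<open>g n = g 0\<close>.\<close>
  moreover have "distinct (map g (map Suc [0..<n]))"
  proof -
    have "inj_on g {Suc 0..<Suc n}"
    proof (rule inj_onI)
      fix i j assume ij: "i \<in> {Suc 0..<Suc n}" "j \<in> {Suc 0..<Suc n}" "g i = g j"
      then have "i mod n = j mod n"
        using inj n by (auto simp: g_def inj_on_def)
      then show "i = j"
        using ij by (cases "i = n"; cases "j = n") auto
    qed
    then show ?thesis
      unfolding distinct_map by (simp add: map_Suc_upt del: upt_Suc)
  qed
  then have "distinct (map (head H) ?p)"
    by (simp add: H comp_def)
  moreover have "tl (pre_digraph.awalk_verts H (g 0) ?p) = map (head H) ?p"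
    using n by (subst pre_digraph.awalk_verts_conv'[OF cas]) simp
  moreover have "g 0 \<in> verts H" "?p \<noteq> []" using v n by (simp_all add: g_def)
  ultimately have "pre_digraph.cycle H ?p"
    unfolding pre_digraph.cycle_def pre_digraph.awalk_def using cas
    by (intro exI[of _ "g 0"] conjI) (simp_all only: not_False_eq_True)
  then show ?thesis by blast
qed

text \<open>Cycles are given by cyclic enumerations \<open>f\<close>, so that digons
  (\<open>n = 2\<close>) and clause cycles (\<open>n = 4 * m\<close>) are handled alike.\<close>

lemma colorable_2E:
  assumes "colorable 2 (with_proj G)"
    and wf: "\<And>v w. (v, w) \<in> parcs G \<Longrightarrow> v \<in> pverts G \<and> w \<in> pverts G"
  obtains col :: "'a \<Rightarrow> bool" where
    "\<And>n f. n > 0 \<Longrightarrow> inj_on f {..<n} \<Longrightarrow> (\<And>i. i < n \<Longrightarrow> (f i, f (Suc i mod n)) \<in> parcs G) \<Longrightarrow>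
      \<exists>i < n. col (f i) \<noteq> col (f 0)"
proof -
  obtain c :: "'a \<Rightarrow> nat" where c: "\<And>v. v \<in> pverts G \<Longrightarrow> c v < 2"
    "\<And>i. i < 2 \<Longrightarrow> acyclic_digraph (with_proj G \<restriction> {v \<in> pverts G. c v = i})"
    using assms(1) by (auto simp: colorable_def)
  show thesis
  proof (rule that[of "\<lambda>v. c v = 1"])
    fix n and f :: "nat \<Rightarrow> 'a"
    assume n: "n > 0" and inj: "inj_on f {..<n}"
      and arcs: "\<And>i. i < n \<Longrightarrow> (f i, f (Suc i mod n)) \<in> parcs G"
    show "\<exists>i < n. (c (f i) = 1) \<noteq> (c (f 0) = 1)"
    proof (rule ccontr)
      assume "\<not> ?thesis"
      then have eq: "(c (f i) = 1) = (c (f 0) = 1)" if "i < n" for i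
        using that by blast
      have V: "f i \<in> pverts G" if "i < n" for i
        using wf[OF arcs[OF that]] by auto
      have eq: "c (f i) = c (f 0)" if "i < n" for i
        using eq[OF that] c(1)[OF V[OF that]] c(1)[OF V[OF n]] by linarith
      let ?H = "with_proj G \<restriction> {v \<in> pverts G. c v = c (f 0)}"
      have arcs_H: "(f i, f (Suc i mod n)) \<in> arcs ?H" if i: "i < n" for i
        using arcs[OF i] V[OF i] V[of "Suc i mod n"] eq[OF i] eq[of "Suc i mod n"] n
        by (simp del: mod_less_divisor add: mod_less_divisor[OF n])
      have "\<exists>p. pre_digraph.cycle ?H p"
      proof (rule cycleI_function[OF _ _ n inj _ arcs_H])
        show "tail ?H = fst" "head ?H = snd" "f 0 \<in> verts ?H" using V[OF n] by simp_all
      qed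
      then show False
        using c V[OF n] by (auto simp: acyclic_digraph_def)
    qed
  qed
qed

section \<open>The digraph of a grid of cells\<close>

text \<open>
  Ruler marks: position 0 carries 1, the neighbours at distance 1 and \<open>W\<close> carry 2, 3, 4, 5
  (right, left, up, down).
\<close>

definition ruler :: "nat \<Rightarrow> int \<Rightarrow> nat" where
  "ruler W = (\<lambda>_. 0)(0 := 1, 1 := 2, - 1 := 3, int W := 4, - int W := 5)"

text \<open>Two vertices, one of each parity, for each of the \<open>2 ^ (4 * m)\<close> assignments
  to the bits of a cell. The length is even, so the two ends of a path have different
  colours.\<close>

definition path_len :: "nat \<Rightarrow> nat" where
  "path_len m = 2 * 2 ^ (4 * m)"

definition cell_size :: "nat \<Rightarrow> nat" where
  "cell_size m = 4 * m * path_len m"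

text \<open>
  A cell has \<open>4 m\<close> Boolean variables, \<open>m\<close> for each of its sides left, right, bottom, top.
  Vertex \<open>b * path_len m + j\<close> of a cell is the \<open>j\<close>-th vertex on the path of digons of variable
  \<open>b\<close>; along this path the colour alternates.
\<close>

definition link :: "nat \<Rightarrow> nat \<Rightarrow> nat \<Rightarrow> nat \<Rightarrow> bool" where
  "link m g k k' \<longleftrightarrow> k div path_len m div m = g \<and> k div path_len m = k' div path_len m + m \<and>
    k mod path_len m = path_len m - 1 \<and> k' mod path_len m = 0"

definition path_step :: "nat \<Rightarrow> nat \<Rightarrow> nat \<Rightarrow> bool" where
  "path_step m k k' \<longleftrightarrow> k div path_len m = k' div path_len m \<and>
    k' mod path_len m = Suc (k mod path_len m)"

text \<open>If the path of bit \<open>b\<close> starts with colour \<open>y b\<close>, then its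
  vertex \<open>2 * a + of_bool (bit a b)\<close> has colour \<open>y b \<noteq> bit a b\<close>.
  The cycle is monochromatic iff this value is the same for all \<open>b\<close>.\<close>

definition clause_step :: "nat \<Rightarrow> ((nat \<Rightarrow> bool) \<Rightarrow> bool) \<Rightarrow> nat \<Rightarrow> nat \<Rightarrow> bool" where
  "clause_step m ok k k' \<longleftrightarrow> (\<exists>a < 2 ^ (4 * m). \<not> ok (bit a) \<and>
    k' div path_len m = Suc (k div path_len m) mod (4 * m) \<and>
    k mod path_len m = 2 * a + of_bool (bit a (k div path_len m)) \<and>
    k' mod path_len m = 2 * a + of_bool (bit a (k' div path_len m)))"

definition cell_arc :: "nat \<Rightarrow> (nat \<Rightarrow> (nat \<Rightarrow> bool) \<Rightarrow> bool) \<Rightarrow> nat \<Rightarrow> nat \<Rightarrow> nat \<Rightarrow> nat \<Rightarrow> bool" where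
  "cell_arc m ok c r k k' \<longleftrightarrow>
    r = 1 \<and> (path_step m k k' \<or> path_step m k' k \<or> clause_step m (ok c) k k') \<or>
    r = 2 \<and> link m 1 k k' \<or> r = 3 \<and> link m 1 k' k \<or>
    r = 4 \<and> link m 3 k k' \<or> r = 5 \<and> link m 3 k' k"

definition grid_digraph ::
  "nat \<Rightarrow> (nat \<Rightarrow> (nat \<Rightarrow> bool) \<Rightarrow> bool) \<Rightarrow> nat \<Rightarrow> nat list \<Rightarrow> nat pair_pre_digraph" where
  "grid_digraph m ok W cs = (let K = cell_size m; n = length cs * K in
    \<lparr> pverts = {..<n},
      parcs = {(v, w). v < n \<and> w < n \<and>
        cell_arc m ok (cs ! (v div K)) (ruler W (int (w div K) - int (v div K))) (v mod K) (w mod K)} \<rparr>)"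

lemma card_le_1_if_unique:
  assumes "\<And>x y. x \<in> A \<Longrightarrow> y \<in> A \<Longrightarrow> x = y"
  shows "card A \<le> 1"
  using assms by (metis One_nat_def card_le_Suc0_iff_eq card.infinite zero_le)

text \<open>\<open>W \<ge> 2\<close> keeps the five marks of the ruler apart.
  \<open>ok_compl\<close> reflects the exchange of the colours, under which a clause cycle excludes
  an assignment together with its complement. \<open>not_ok_1\<close> puts a clause cycle into every
  cell, so that degree 6 is attained.\<close>

locale grid =
  fixes m :: nat and ok :: "nat \<Rightarrow> (nat \<Rightarrow> bool) \<Rightarrow> bool" and W :: nat and cs :: "nat list"
  assumes m: "m \<ge> 1" and W: "W \<ge> 2" and cs: "cs \<noteq> []"
    and ok_cong: "\<And>c y z. (\<And>b. b < 4 * m \<Longrightarrow> y b = z b) \<Longrightarrow> ok c y \<Longrightarrow> ok c z"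
    and ok_compl: "\<And>c y. ok c y \<Longrightarrow> ok c (\<lambda>b. \<not> y b)"
    and not_ok_1: "\<And>c. \<not> ok c (bit (1 :: nat))"
begin

abbreviation "B \<equiv> 4 * m"
abbreviation "L \<equiv> path_len m"
abbreviation "K \<equiv> cell_size m"
abbreviation "S \<equiv> length cs"
abbreviation "G \<equiv> grid_digraph m ok W cs"

definition cell :: "nat \<Rightarrow> nat" where "cell v = v div K"
definition var :: "nat \<Rightarrow> nat" where "var v = v mod K div L"
definition idx :: "nat \<Rightarrow> nat" where "idx v = v mod K mod L"
definition vx :: "nat \<Rightarrow> nat \<Rightarrow> nat \<Rightarrow> nat" where "vx s b j = s * K + (b * L + j)"

lemma L_pos: "0 < L" and odd_L_minus_1: "odd (L - 1)"
  by (simp_all add: path_len_def)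

lemma K_eq: "K = B * L" and K_pos: "0 < K"
  using m L_pos by (simp_all add: cell_size_def)

lemma L_ge: "L \<ge> 8"
proof -
  have "(2::nat) ^ 4 \<le> 2 ^ B" using m by (intro power_increasing) auto
  then show ?thesis by (simp add: path_len_def)
qed

lemma var_less: "var v < B"
proof -
  have "v mod K < B * L" using K_pos by (simp flip: K_eq)
  then show ?thesis by (simp add: var_def less_mult_imp_div_less)
qed

lemma idx_less: "idx v < L"
  using L_pos by (simp add: idx_def)

lemma cell_less_iff: "cell v < S \<longleftrightarrow> v < S * K"
  using K_pos by (simp add: cell_def div_less_iff_less_mult)

lemma local_less: "b < B \<Longrightarrow> j < L \<Longrightarrow> b * L + j < K"
proof -
  assume "b < B" "j < L"
  then have "b * L + j < Suc b * L" by simp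
  also have "\<dots> \<le> B * L" using \<open>b < B\<close> by (intro mult_le_mono1) simp
  finally show ?thesis by (simp add: K_eq)
qed

lemma coords_vx [simp]:
  assumes "b < B" "j < L"
  shows "cell (vx s b j) = s" "var (vx s b j) = b" "idx (vx s b j) = j"
  using local_less[OF assms] assms by (auto simp: cell_def var_def idx_def vx_def)

lemma vx_coords: "vx (cell v) (var v) (idx v) = v"
  by (simp add: cell_def var_def idx_def vx_def)

lemma vertex_eqI: "cell v = cell w \<Longrightarrow> var v = var w \<Longrightarrow> idx v = idx w \<Longrightarrow> v = w"
  by (metis vx_coords)

text \<open>Each digon is oriented once, which divides the digon neighbours of a vertex into at most
  one successor and at most one predecessor.\<close>

definition forward :: "nat \<Rightarrow> nat \<Rightarrow> bool" where
  "forward v w \<longleftrightarrow> cell w = cell v \<and> var w = var v \<and> idx w = Suc (idx v) \<or>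
    (cell w = cell v + 1 \<and> var v div m = 1 \<or> cell w = cell v + W \<and> var v div m = 3) \<and>
      var v = var w + m \<and> idx v = L - 1 \<and> idx w = 0"

definition clause_arc :: "nat \<Rightarrow> nat \<Rightarrow> bool" where
  "clause_arc v w \<longleftrightarrow> cell w = cell v \<and> (\<exists>a < 2 ^ B. \<not> ok (cs ! cell v) (bit a) \<and>
    var w = Suc (var v) mod B \<and> idx v = 2 * a + of_bool (bit a (var v)) \<and>
    idx w = 2 * a + of_bool (bit a (var w)))"

lemma ruler_diff:
  "ruler W (int t - int s) = 1 \<longleftrightarrow> t = s" "ruler W (int t - int s) = 2 \<longleftrightarrow> t = s + 1"
  "ruler W (int t - int s) = 3 \<longleftrightarrow> s = t + 1" "ruler W (int t - int s) = 4 \<longleftrightarrow> t = s + W"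
  "ruler W (int t - int s) = 5 \<longleftrightarrow> s = t + W"
  using W by (auto simp: ruler_def)

lemma pverts_G: "pverts G = {..<S * K}"
  by (simp add: grid_digraph_def Let_def)

lemma path_step_iff: "path_step m (v mod K) (w mod K) \<longleftrightarrow> var w = var v \<and> idx w = Suc (idx v)"
  by (auto simp: path_step_def var_def idx_def)

lemma link_iff: "link m g (v mod K) (w mod K) \<longleftrightarrow>
    var v div m = g \<and> var v = var w + m \<and> idx v = L - 1 \<and> idx w = 0"
  by (simp add: link_def var_def idx_def)

lemma clause_step_iff: "clause_step m ok' (v mod K) (w mod K) \<longleftrightarrow> (\<exists>a < 2 ^ B. \<not> ok' (bit a) \<and>
    var w = Suc (var v) mod B \<and> idx v = 2 * a + of_bool (bit a (var v)) \<and>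
    idx w = 2 * a + of_bool (bit a (var w)))"
  by (simp add: clause_step_def var_def idx_def)

lemma parcs_G: "(v, w) \<in> parcs G \<longleftrightarrow>
    v < S * K \<and> w < S * K \<and> (forward v w \<or> forward w v \<or> clause_arc v w)"
proof -
  have "(v, w) \<in> parcs G \<longleftrightarrow> v < S * K \<and> w < S * K \<and>
      cell_arc m ok (cs ! cell v) (ruler W (int (cell w) - int (cell v))) (v mod K) (w mod K)"
    by (simp add: grid_digraph_def Let_def cell_def)
  moreover have "cell_arc m ok (cs ! cell v) (ruler W (int (cell w) - int (cell v))) (v mod K) (w mod K)
      \<longleftrightarrow> forward v w \<or> forward w v \<or> clause_arc v w"
    unfolding cell_arc_def ruler_diff path_step_iff link_iff clause_step_iff forward_def clause_arc_def
      eq_commute[of "cell v" "cell w"] eq_commute[of "var v" "var w"]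
    by blast
  ultimately show ?thesis by simp
qed

text \<open>Indices stay below \<open>L\<close>, so a step along a path and a link to another cell
  exclude each other; the side \<open>var v div m\<close> decides which neighbouring cell a link
  leads to.\<close>

lemma forward_unique:
  "forward v w \<Longrightarrow> forward v w' \<Longrightarrow> w = w'"
  "forward v w \<Longrightarrow> forward v' w \<Longrightarrow> v = v'"
  using idx_less[of w] idx_less[of w'] m W
  by (auto simp: forward_def intro: vertex_eqI)

lemma of_bool_double_eq: "2 * a + of_bool p = 2 * a' + of_bool p' \<Longrightarrow> a = (a' :: nat)"
  by (auto simp: of_bool_def split: if_splits)

lemma Suc_mod_inj: "x < B \<Longrightarrow> y < B \<Longrightarrow> Suc x mod B = Suc y mod B \<Longrightarrow> x = y"
  by (cases "Suc x = B"; cases "Suc y = B") auto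

text \<open>Halving the index of a vertex recovers the assignment \<open>a\<close>, and the cyclic
  order of the variables gives the rest. Hence the clause cycles are disjoint.\<close>

lemma clause_arc_unique:
  shows "clause_arc v w \<Longrightarrow> clause_arc v w' \<Longrightarrow> w = w'"
    and "clause_arc v w \<Longrightarrow> clause_arc v' w \<Longrightarrow> v = v'"
proof -
  assume "clause_arc v w" "clause_arc v w'"
  then obtain a a' where "cell w = cell v" "cell w' = cell v"
    "var w = Suc (var v) mod B" "var w' = Suc (var v) mod B"
    "idx v = 2 * a + of_bool (bit a (var v))" "idx w = 2 * a + of_bool (bit a (var w))"
    "idx v = 2 * a' + of_bool (bit a' (var v))" "idx w' = 2 * a' + of_bool (bit a' (var w'))"
    unfolding clause_arc_def by blast
  moreover from this have "a = a'" using of_bool_double_eq by metis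
  ultimately show "w = w'" by (metis vertex_eqI)
next
  assume "clause_arc v w" "clause_arc v' w"
  then obtain a a' where "cell w = cell v" "cell w = cell v'"
    "var w = Suc (var v) mod B" "var w = Suc (var v') mod B"
    "idx v = 2 * a + of_bool (bit a (var v))" "idx w = 2 * a + of_bool (bit a (var w))"
    "idx v' = 2 * a' + of_bool (bit a' (var v'))" "idx w = 2 * a' + of_bool (bit a' (var w))"
    unfolding clause_arc_def by blast
  moreover from this have "a = a'" using of_bool_double_eq by metis
  moreover from calculation have "var v = var v'" using Suc_mod_inj var_less by metis
  ultimately show "v = v'" by (metis vertex_eqI)
qed

lemma not_forward_self: "\<not> forward v v"
  using m by (auto simp: forward_def)

lemma not_clause_self: "\<not> clause_arc v v"
  using m var_less[of v] by (auto simp: clause_arc_def mod_Suc)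

lemma pair_digraph_G: "pair_digraph G"
proof
  show "fst e \<in> pverts G" "snd e \<in> pverts G" if "e \<in> parcs G" for e
    using that by (cases e; simp add: parcs_G pverts_G)+
  show "finite (pverts G)" by (simp add: pverts_G)
  show "finite (parcs G)"
    by (rule finite_subset[of _ "{..<S * K} \<times> {..<S * K}"]) (auto simp: parcs_G)
  show "fst e \<noteq> snd e" if "e \<in> parcs G" for e
    using that not_forward_self not_clause_self by (cases e) (auto simp: parcs_G)
qed

lemma input_digraph_G: "G \<in> input_digraphs"
  using pair_digraph_G by (auto simp: input_digraphs_def pverts_G)

section \<open>Degrees in the grid digraph\<close>

lemma out_degree_eq: "out_degree (with_proj G) v = card {w. (v, w) \<in> parcs G}"
  unfolding out_degree_def out_arcs_def
  by (rule bij_betw_same_card[of snd]) (auto simp: bij_betw_def inj_on_def image_iff)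

lemma in_degree_eq: "in_degree (with_proj G) v = card {w. (w, v) \<in> parcs G}"
  unfolding in_degree_def in_arcs_def
  by (rule bij_betw_same_card[of fst]) (auto simp: bij_betw_def inj_on_def image_iff)

lemma card_three_le:
  assumes "\<And>x y. P x \<Longrightarrow> P y \<Longrightarrow> x = y" "\<And>x y. Q x \<Longrightarrow> Q y \<Longrightarrow> x = y" "\<And>x y. R x \<Longrightarrow> R y \<Longrightarrow> x = y"
  shows "card {w :: nat. w < n \<and> (P w \<or> Q w \<or> R w)} \<le> 3"
proof -
  have "{w. w < n \<and> (P w \<or> Q w \<or> R w)} \<subseteq> {w. w < n \<and> P w} \<union> {w. w < n \<and> Q w} \<union> {w. w < n \<and> R w}"
    by auto
  then have "card {w. w < n \<and> (P w \<or> Q w \<or> R w)} \<le>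
      card ({w. w < n \<and> P w} \<union> {w. w < n \<and> Q w} \<union> {w. w < n \<and> R w})"
    by (intro card_mono) auto
  also have "\<dots> \<le> card {w. w < n \<and> P w} + card {w. w < n \<and> Q w} + card {w. w < n \<and> R w}"
    by (meson add_le_mono card_Un_le le_refl order_trans)
  also have "\<dots> \<le> 1 + 1 + 1"
    by (intro add_le_mono card_le_1_if_unique) (use assms in auto)
  finally show ?thesis by simp
qed

lemma degree_le: "vertex_degree (with_proj G) v \<le> 6"
proof -
  have "card {w. (v, w) \<in> parcs G} \<le> card {w. w < S * K \<and> (forward v w \<or> forward w v \<or> clause_arc v w)}"
    by (rule card_mono) (auto simp: parcs_G)
  also have "\<dots> \<le> 3"
    by (rule card_three_le) (auto intro: forward_unique clause_arc_unique)
  finally have out: "out_degree (with_proj G) v \<le> 3" by (simp add: out_degree_eq)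
  have "card {w. (w, v) \<in> parcs G} \<le> card {w. w < S * K \<and> (forward w v \<or> forward v w \<or> clause_arc w v)}"
    by (rule card_mono) (auto simp: parcs_G)
  also have "\<dots> \<le> 3"
    by (rule card_three_le) (auto intro: forward_unique clause_arc_unique)
  finally have "in_degree (with_proj G) v \<le> 3" by (simp add: in_degree_eq)
  with out show ?thesis by (simp add: vertex_degree_def)
qed

lemma vx_less: "s < S \<Longrightarrow> b < B \<Longrightarrow> j < L \<Longrightarrow> vx s b j < S * K"
  using cell_less_iff[of "vx s b j"] by simp

text \<open>The assignment 1 sets only bit 0, so its clause cycle uses index 3 on path 0 and index 2
  on paths 1 and 2. Thus \<open>vx 0 1 2\<close> has digons to \<open>vx 0 1 1\<close> and
  \<open>vx 0 1 3\<close>, the predecessor \<open>vx 0 0 3\<close> and the successor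
  \<open>vx 0 2 2\<close>.\<close>

lemma degree_6: "vertex_degree (with_proj G) (vx 0 1 2) = 6"
proof -
  have S: "0 < S" using cs by simp
  have lt: "(1::nat) < B" "2 < B" "0 < B" "(1::nat) < L" "2 < L" "3 < L" "(1::nat) < 2 ^ B"
    using m L_ge one_less_power[of "2 :: nat" B] by auto
  have "vx 0 1 2 \<noteq> vx 0 2 2" "vx 0 1 1 \<noteq> vx 0 1 3" "vx 0 1 1 \<noteq> vx 0 2 2" "vx 0 1 3 \<noteq> vx 0 2 2"
      "vx 0 1 1 \<noteq> vx 0 0 3" "vx 0 1 3 \<noteq> vx 0 0 3"
    using lt coords_vx(2,3) by (metis one_neq_zero numeral_eq_iff num.distinct numeral_eq_one_iff semiring_norm(83,85,86,87,88,89))+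
  note ne = this
  have b: "bit (1::nat) 0" "\<not> bit (1::nat) 1" "\<not> bit (1::nat) 2"
    by (simp_all add: bit_1_iff del: One_nat_def)
  have "{vx 0 1 1, vx 0 1 3, vx 0 2 2} \<subseteq> {w. (vx 0 1 2, w) \<in> parcs G}"
    using lt S not_ok_1[of "cs ! 0"] b
    by (auto simp: parcs_G vx_less forward_def clause_arc_def intro!: exI[of _ 1])
  then have "card {vx 0 1 1, vx 0 1 3, vx 0 2 2} \<le> card {w. (vx 0 1 2, w) \<in> parcs G}"
    by (intro card_mono finite_subset[of "{w. (vx 0 1 2, w) \<in> parcs G}" "{..<S*K}"]) (auto simp: parcs_G)
  then have out: "out_degree (with_proj G) (vx 0 1 2) \<ge> 3"
    using ne by (simp add: out_degree_eq)
  have "{vx 0 1 1, vx 0 1 3, vx 0 0 3} \<subseteq> {w. (w, vx 0 1 2) \<in> parcs G}"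
    using lt S not_ok_1[of "cs ! 0"] b
    by (auto simp: parcs_G vx_less forward_def clause_arc_def intro!: exI[of _ 1])
  then have "card {vx 0 1 1, vx 0 1 3, vx 0 0 3} \<le> card {w. (w, vx 0 1 2) \<in> parcs G}"
    by (intro card_mono finite_subset[of "{w. (w, vx 0 1 2) \<in> parcs G}" "{..<S*K}"]) (auto simp: parcs_G)
  then have "in_degree (with_proj G) (vx 0 1 2) \<ge> 3"
    using ne by (simp add: in_degree_eq)
  with out degree_le[of "vx 0 1 2"] show ?thesis by (simp add: vertex_degree_def)
qed

lemma max_degree_G: "max_degree (with_proj G) = 6"
proof -
  have v: "vx 0 1 2 \<in> pverts G"
    using cs m L_ge by (auto simp: pverts_G intro!: vx_less)
  show ?thesis
    unfolding max_degree_def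
    by (rule Max_eqI) (use v degree_6 degree_le in \<open>auto simp: pverts_G image_iff intro!: bexI[OF _ v]\<close>)
qed

section \<open>Colourings and consistent assignments\<close>

definition consistent :: "(nat \<Rightarrow> nat \<Rightarrow> bool) \<Rightarrow> bool" where
  "consistent x \<longleftrightarrow> (\<forall>s < S. ok (cs ! s) (x s)) \<and>
    (\<forall>s i. s + 1 < S \<longrightarrow> i < m \<longrightarrow> x s (m + i) = x (s + 1) i) \<and>
    (\<forall>s i. s + W < S \<longrightarrow> i < m \<longrightarrow> x s (3 * m + i) = x (s + W) (2 * m + i))"

lemma colorable_if_consistent:
  assumes x: "consistent x"
  shows "colorable 2 (with_proj G)"
proof -
  \<comment> \<open>The bit of a variable is the colour of the first vertex on its path.\<close>
  define col where "col v = (x (cell v) (var v) \<noteq> odd (idx v))" for v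
  have fw: "col v \<noteq> col w" if vw: "forward v w" "w < S * K" for v w
  proof -
    from vw(1) consider
      "cell w = cell v" "var w = var v" "idx w = Suc (idx v)"
      | "cell w = cell v + 1" "var v div m = 1" "var v = var w + m" "idx v = L - 1" "idx w = 0"
      | "cell w = cell v + W" "var v div m = 3" "var v = var w + m" "idx v = L - 1" "idx w = 0"
      by (auto simp: forward_def)
    then show ?thesis
    proof cases
      case 1
      then show ?thesis by (auto simp: col_def)
    next
      case 2
      have "var w < m" using 2 m by (auto simp: div_eq_0_iff)
      then have "x (cell v) (var v) = x (cell w) (var w)"
        using x 2 vw(2) cell_less_iff[of w] unfolding consistent_def by (metis add.commute)
      \<comment> \<open>The last vertex of a path has the complement of its bit as colour; the digon
        to the next path turns this back into the bit.\<close>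
      then show ?thesis using 2 odd_L_minus_1 by (simp add: col_def)
    next
      case 3
      have "var w div m = 2" using 3 m by auto
      then have "var w = 2 * m + var w mod m" by (metis div_mult_mod_eq)
      then obtain i where "var w = 2 * m + i" "i < m" using m by (metis mod_less_divisor One_nat_def Suc_le_eq)
      then have "x (cell v) (var v) = x (cell w) (var w)"
        using x 3 vw(2) cell_less_iff[of w] unfolding consistent_def
        by (simp add: ac_simps)
      then show ?thesis using 3 odd_L_minus_1 by (simp add: col_def)
    qed
  qed
  show ?thesis
  proof (rule colorable_2I[of G col])
    fix X e
    assume X: "X \<subseteq> pverts G" "X \<noteq> {}" and mono: "\<And>v. v \<in> X \<Longrightarrow> col v = e"
      and closed: "\<And>v. v \<in> X \<Longrightarrow> \<exists>w \<in> X. (v, w) \<in> parcs G"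
    have step: "\<exists>w \<in> X. clause_arc v w" if v: "v \<in> X" for v
    proof -
      obtain w where w: "w \<in> X" "(v, w) \<in> parcs G" using closed[OF v] by blast
      then have "\<not> forward v w" "\<not> forward w v"
        using fw mono[OF v] mono[OF w(1)] by (auto simp: parcs_G)
      then show ?thesis using w by (auto simp: parcs_G)
    qed
    obtain v where v: "v \<in> X" using X by blast
    define s where "s = cell v"
    have s: "s < S" using X v cell_less_iff by (auto simp: s_def pverts_G)
    obtain a where a: "a < 2 ^ B" "\<not> ok (cs ! s) (bit a)"
      "idx v = 2 * a + of_bool (bit a (var v))"
      using step[OF v] by (auto simp: clause_arc_def s_def)
    \<comment> \<open>Clause arcs never leave the cell and never change \<open>a\<close>, so
      following them from \<open>v\<close> visits all variables of the cell in cyclic order.\<close>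
    have orbit: "\<exists>w \<in> X. cell w = s \<and> var w = (var v + i) mod B \<and>
        idx w = 2 * a + of_bool (bit a (var w))" for i
    proof (induction i)
      case 0
      then show ?case using v a var_less[of v] by (auto simp: s_def)
    next
      case (Suc i)
      then obtain w where w: "w \<in> X" "cell w = s" "var w = (var v + i) mod B"
        "idx w = 2 * a + of_bool (bit a (var w))" by blast
      from step[OF w(1)] obtain u a' where u: "u \<in> X" "cell u = cell w" "var u = Suc (var w) mod B"
        "idx w = 2 * a' + of_bool (bit a' (var w))" "idx u = 2 * a' + of_bool (bit a' (var u))"
        by (auto simp: clause_arc_def)
      have "a' = a" using w(4) u(4) of_bool_double_eq by metis
      then show ?case using u w by (intro bexI[of _ u]) (auto simp: mod_Suc_eq)
    qed
    have "x s b = (bit a b \<noteq> e)" if b: "b < B" for b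
    proof -
      \<comment> \<open>Going round by \<open>B - var v\<close> reaches variable 0, and
        \<open>b\<close> more steps reach \<open>b\<close>.\<close>
      obtain w where w: "w \<in> X" "cell w = s" "var w = (var v + (b + (B - var v))) mod B"
        "idx w = 2 * a + of_bool (bit a (var w))" using orbit by blast
      have "var w = b" using w(3) b var_less[of v] by simp
      then show ?thesis using mono[OF w(1)] w by (auto simp: col_def)
    qed
    \<comment> \<open>A clause cycle that is monochromatic of colour \<open>e\<close> means that the
      cell carries \<open>a\<close> or, if \<open>e\<close> is true, the complement of
      \<open>a\<close>.\<close>
    then have eq: "bit a b = (if e then \<not> x s b else x s b)" if "b < B" for b
      using that by auto
    have "ok (cs ! s) (x s)" using x s by (auto simp: consistent_def)
    then have "ok (cs ! s) (\<lambda>b. if e then \<not> x s b else x s b)"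
      using ok_compl by (cases e) auto
    then have "ok (cs ! s) (bit a)"
      by (rule ok_cong[rotated]) (simp add: eq)
    then show False using a by simp
  qed
qed

lemma consistent_if_colorable:
  assumes "colorable 2 (with_proj G)"
  obtains x where "consistent x"
proof -
  obtain col :: "nat \<Rightarrow> bool" where col:
    "\<And>n f. n > 0 \<Longrightarrow> inj_on f {..<n} \<Longrightarrow> (\<And>i. i < n \<Longrightarrow> (f i, f (Suc i mod n)) \<in> parcs G) \<Longrightarrow>
      \<exists>i < n. col (f i) \<noteq> col (f 0)"
    by (rule colorable_2E[OF assms]) (auto simp: parcs_G pverts_G)
  have fw: "col v \<noteq> col w" if "forward v w" "v < S * K" "w < S * K" for v w
  proof -
    have "\<exists>i < (2 :: nat). col (if i = 0 then v else w) \<noteq> col (if 0 = (0 :: nat) then v else w)"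
    proof (rule col[of 2 "\<lambda>i :: nat. if i = 0 then v else w"])
      show "inj_on (\<lambda>i::nat. if i = 0 then v else w) {..<2}"
        using that not_forward_self by (auto simp: inj_on_def)
      show "(if i = 0 then v else w, if Suc i mod 2 = 0 then v else w) \<in> parcs G" if "i < 2" for i
        using that \<open>forward v w\<close> \<open>v < S * K\<close> \<open>w < S * K\<close> by (auto simp: parcs_G mod_Suc)
    qed simp
    then show ?thesis by (auto split: if_splits)
  qed
  define x where "x s b = col (vx s b 0)" for s b
  have path: "col (vx s b j) = (x s b \<noteq> odd j)" if "s < S" "b < B" "j < L" for s b j
    using that(3)
  proof (induction j)
    case 0
    then show ?case by (simp add: x_def)
  next
    case (Suc j)
    then have "forward (vx s b j) (vx s b (Suc j))" using that by (auto simp: forward_def)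
    then have "col (vx s b j) \<noteq> col (vx s b (Suc j))"
      using fw that Suc.prems by (simp add: vx_less)
    then show ?case using Suc by auto
  qed
  have link: "x s b = x t (b - m)" if "s < S" "t < S" "b < B"
    "t = s + 1 \<and> b div m = 1 \<or> t = s + W \<and> b div m = 3" for s t b
  proof -
    have bm: "b \<ge> m" using that(4) by (metis div_less not_less zero_neq_one zero_neq_numeral)
    have "L - 1 < L" "0 < L" using L_pos by simp_all
    then have "forward (vx s b (L - 1)) (vx t (b - m) 0)"
      using that bm by (auto simp: forward_def)
    then have "col (vx s b (L - 1)) \<noteq> col (vx t (b - m) 0)"
      by (rule fw) (use that L_pos in \<open>auto intro!: vx_less\<close>)
    then show ?thesis using path[of s b "L - 1"] that odd_L_minus_1 L_pos by (simp add: x_def)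
  qed
  have "ok (cs ! s) (x s)" if s: "s < S" for s
  proof (rule ccontr)
    assume no: "\<not> ok (cs ! s) (x s)"
    \<comment> \<open>The violated assignment, read as a binary number. Being forbidden, it has a
      clause cycle in this cell, which \<open>f\<close> enumerates.\<close>
    define a :: nat where "a = horner_sum of_bool 2 (map (x s) [0..<B])"
    have bit_a: "bit a b = x s b" if "b < B" for b
      using that by (simp add: a_def bit_horner_sum_bit_iff)
    have a: "a < 2 ^ B"
      unfolding a_def using horner_sum_of_bool_2_less[of "map (x s) [0..<B]"] by simp
    have a_no: "\<not> ok (cs ! s) (bit a)"
      using no ok_cong[of "bit a" "x s"] bit_a by blast
    define f where "f b = vx s b (2 * a + of_bool (bit a b))" for b
    have lt: "2 * a + of_bool (bit a b) < L" for b
      using a by (cases "bit a b") (auto simp: path_len_def)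
    have "\<exists>i < B. col (f i) \<noteq> col (f 0)"
    proof (rule col)
      show "inj_on f {..<B}"
      proof (rule inj_onI)
        fix i j assume ij: "i \<in> {..<B}" "j \<in> {..<B}" "f i = f j"
        have "var (f b) = b" if "b < B" for b
          using that lt[of b] unfolding f_def by (rule coords_vx)
        then show "i = j" using ij by (metis lessThan_iff)
      qed
      show "(f i, f (Suc i mod B)) \<in> parcs G" if "i < B" for i
      proof -
        have "Suc i mod B < B" using m by simp
        then have "clause_arc (f i) (f (Suc i mod B))"
          unfolding clause_arc_def using that lt a a_no
          by (intro conjI exI[of _ a]) (auto simp: f_def simp del: mod_less_divisor)
        then show ?thesis
          using that s lt m \<open>Suc i mod B < B\<close> unfolding f_def by (auto simp: parcs_G vx_less)
      qed
    qed (use m in simp)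
    \<comment> \<open>The parity of the index cancels the bit on every path, so the cycle of the
      assignment that the colouring itself describes is monochromatic.\<close>
    moreover have "\<not> col (f b)" if "b < B" for b
      using path[OF s that lt[of b]] bit_a[OF that] by (simp only: f_def) simp
    ultimately show False using m by force
  qed
  moreover have "x s (m + i) = x (s + 1) i" if "s + 1 < S" "i < m" for s i
    using link[of s "s + 1" "m + i"] that by simp
  moreover have "x s (3 * m + i) = x (s + W) (2 * m + i)" if "s + W < S" "i < m" for s i
    using link[of s "s + W" "3 * m + i"] that by simp
  ultimately show thesis by (intro that[of x]) (auto simp: consistent_def)
qed

end

section \<open>Computations as tilings\<close>

type_synonym hmsg = "(nat \<times> nat list \<times> nat \<times> (nat \<times> move) list) \<times> (bool \<times> bool) list"
type_synonym vmsg = "nat \<times> (nat \<times> bool) list"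

text \<open>
  The horizontal message at the left border of a tape position announces the transition of the
  current step (state, scanned symbols, new state, actions) and, for every tape, whether the head
  crosses this border to the right and whether it crosses it to the left. The vertical message
  consists of the state and, for every tape, the symbol at that position and whether the head is
  there. Accepting configurations are prolonged by idle steps.
\<close>

definition ext_trans :: "tm \<Rightarrow> nat \<Rightarrow> nat list \<Rightarrow> (nat \<times> (nat \<times> move) list) set" where
  "ext_trans M q ss = tm_trans M q ss \<union>
    (if q = 1 \<and> tm_trans M q ss = {} then {(1, map (\<lambda>s. (s, Stay)) ss)} else {})"

text \<open>The first component of a border signal is a crossing to the right, the second a crossing
  to the left. A cell dictates the outgoing signals \<open>fst r\<close> and \<open>snd l\<close>
  and merely obeys the incoming ones, \<open>fst l\<close> and \<open>snd r\<close>, which its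
  neighbours dictate.\<close>

definition tape_ok :: "nat \<Rightarrow> nat \<times> move \<Rightarrow> bool \<times> bool \<Rightarrow> bool \<times> bool \<Rightarrow> nat \<times> bool \<Rightarrow> nat \<times> bool \<Rightarrow> bool" where
  "tape_ok s a l r d u \<longleftrightarrow>
    (if snd d then fst d = s \<and> fst u = fst a \<and> (fst r \<longleftrightarrow> snd a = Right) \<and> (snd l \<longleftrightarrow> snd a = Left)
     else fst u = fst d \<and> \<not> fst r \<and> \<not> snd l) \<and>
    (snd u \<longleftrightarrow> snd d \<and> snd a = Stay \<or> fst l \<or> snd r)"

definition normal_tile :: "tm \<Rightarrow> hmsg \<Rightarrow> hmsg \<Rightarrow> vmsg \<Rightarrow> vmsg \<Rightarrow> bool" where
  "normal_tile M l r d u \<longleftrightarrow> fst r = fst l \<and> (case fst l of (q, ss, q', acts) \<Rightarrow>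
    fst d = q \<and> fst u = q' \<and> (q', acts) \<in> ext_trans M q ss \<and>
    (\<forall>j < tm_tapes M. tape_ok (ss ! j) (acts ! j) (snd l ! j) (snd r ! j) (snd d ! j) (snd u ! j)))"

text \<open>Finiteness of the message sets is what makes a word length possible that depends on the
  machine alone.\<close>

definition hmsgs :: "tm \<Rightarrow> hmsg set" where
  "hmsgs M = ({..<tm_states M} \<times> {ss. set ss \<subseteq> {..<tm_syms M} \<and> length ss = tm_tapes M} \<times>
    {..<tm_states M} \<times> {acts. set acts \<subseteq> {..<tm_syms M} \<times> {Left, Stay, Right} \<and> length acts = tm_tapes M}) \<times>
    {cs. set cs \<subseteq> UNIV \<and> length cs = tm_tapes M}"

definition vmsgs :: "tm \<Rightarrow> vmsg set" where
  "vmsgs M = {..<tm_states M} \<times> {ds. set ds \<subseteq> {..<tm_syms M} \<times> UNIV \<and> length ds = tm_tapes M}"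

definition no_cross :: "tm \<Rightarrow> hmsg \<Rightarrow> bool" where
  "no_cross M h \<longleftrightarrow> (\<forall>j < tm_tapes M. snd h ! j = (False, False))"

text \<open>
  Class 1 is the border between consecutive rows, 2 an ordinary cell, 3 a cell of the last row;
  class \<open>4 + a\<close> (without head) or \<open>7 + a\<close> (with head) is a cell of the first row with symbol \<open>a\<close>
  on the input tape.
\<close>

definition tile :: "tm \<Rightarrow> nat \<Rightarrow> hmsg \<Rightarrow> hmsg \<Rightarrow> vmsg \<Rightarrow> vmsg \<Rightarrow> bool" where
  "tile M c l r d u \<longleftrightarrow> l \<in> hmsgs M \<and> r \<in> hmsgs M \<and> d \<in> vmsgs M \<and> u \<in> vmsgs M \<and>
    (if c = 1 then no_cross M l \<and> no_cross M r
     else normal_tile M l r d u \<and>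
      (c = 3 \<longrightarrow> fst (fst l) = 1 \<and> tm_trans M 1 (fst (snd (fst l))) = {}) \<and>
      (c \<ge> 4 \<longrightarrow> d = (0, ((c - 4) mod 3, c \<ge> 7) # replicate (tm_tapes M - 1) (0, c \<ge> 7))))"

lemma finite_hmsgs: "finite (hmsgs M)"
  unfolding hmsgs_def
  by (intro finite_cartesian_product finite_lists_length_eq) auto

lemma finite_vmsgs: "finite (vmsgs M)"
  unfolding vmsgs_def
  by (intro finite_cartesian_product finite_lists_length_eq) auto

text \<open>A border cell followed by the positions \<open>-N\<close>, ..., \<open>N\<close>: a head
  that starts at 0 and makes fewer than \<open>N\<close> moves stays inside. The border tile does
  not relate the transitions on its two sides, so each row can announce its own.\<close>

definition first_row :: "nat \<Rightarrow> bool list \<Rightarrow> nat list" where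
  "first_row N x = 1 # replicate N 4 @ (7 + contents x 0) # map (\<lambda>i. 4 + contents x (int (Suc i))) [0..<N]"

definition plain_row :: "nat \<Rightarrow> nat \<Rightarrow> nat list" where
  "plain_row N c = 1 # replicate (2 * N + 1) c"

text \<open>The rows are the times 0, ..., \<open>N + 1\<close>. An accepting run of fewer than
  \<open>N\<close> steps, prolonged by idling, has halted by the last of them.\<close>

definition cell_classes :: "nat \<Rightarrow> bool list \<Rightarrow> nat list" where
  "cell_classes N x = first_row N x @ concat (replicate N (plain_row N 2)) @ plain_row N 3"

lemma length_first_row: "length (first_row N x) = 2 * N + 2"
  and length_plain_row: "length (plain_row N c) = 2 * N + 2"
  by (simp_all add: first_row_def plain_row_def)

lemma nth_concat_same_length:
  assumes "\<forall>r \<in> set rs. length r = W" "t < length rs" "i < W"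
  shows "concat rs ! (t * W + i) = rs ! t ! i"
  using assms
proof (induction rs arbitrary: t)
  case (Cons r rs)
  show ?case
  proof (cases t)
    case 0
    then show ?thesis using Cons.prems by (simp add: nth_append)
  next
    case (Suc t')
    have "\<not> W + (t' * W + i) < W" by simp
    then show ?thesis
      using Cons.prems Cons.IH[of t'] Suc by (simp add: nth_append add.assoc)
  qed
qed simp

lemma cell_classes_concat:
  "cell_classes N x = concat (first_row N x # replicate N (plain_row N 2) @ [plain_row N 3])"
  by (simp add: cell_classes_def)

lemma length_cell_classes: "length (cell_classes N x) = (N + 2) * (2 * N + 2)"
  by (simp add: cell_classes_def length_first_row length_plain_row length_concat
      sum_list_replicate algebra_simps)

lemma nth_cell_classes:
  assumes "t < N + 2" "i < 2 * N + 2"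
  shows "cell_classes N x ! (t * (2 * N + 2) + i) =
    (if t = 0 then first_row N x else if t = N + 1 then plain_row N 3 else plain_row N 2) ! i"
proof -
  have "cell_classes N x ! (t * (2 * N + 2) + i) =
      (first_row N x # replicate N (plain_row N 2) @ [plain_row N 3]) ! t ! i"
    unfolding cell_classes_concat
    by (rule nth_concat_same_length) (use assms in \<open>auto simp: length_first_row length_plain_row\<close>)
  also have "(first_row N x # replicate N (plain_row N 2) @ [plain_row N 3]) ! t =
      (if t = 0 then first_row N x else if t = N + 1 then plain_row N 3 else plain_row N 2)"
    using assms by (auto simp: nth_Cons nth_append split: nat.split)
  finally show ?thesis .
qed

lemma first_row_nth:
  assumes "- int N \<le> p" "p \<le> int N"
  shows "first_row N x ! nat (p + int N + 1) = (if p = 0 then 7 else 4) + contents x p"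
proof -
  consider "p < 0" | "p = 0" | "p > 0" by linarith
  then show ?thesis
  proof cases
    case 1
    then obtain j where j: "nat (p + int N + 1) = Suc j" "j < N"
      using assms by (intro that[of "nat (p + int N)"]) auto
    then show ?thesis using 1 by (simp add: first_row_def nth_append contents_def)
  next
    case 2
    then have "nat (p + int N + 1) = Suc N" by simp
    then show ?thesis using 2 by (simp add: first_row_def nth_append)
  next
    case 3
    define j where "j = nat (p - 1)"
    have j: "nat (p + int N + 1) = Suc (Suc (N + j))" "j < N" "int (Suc j) = p"
      using 3 assms by (auto simp: j_def)
    have "first_row N x ! nat (p + int N + 1) = 4 + contents x (int (Suc j))"
      using j(2) by (simp add: j(1) first_row_def nth_append)
    then show ?thesis using 3 by (simp only: j(3)) simp
  qed
qed

lemma plain_row_nth: "1 \<le> i \<Longrightarrow> i < 2 * N + 2 \<Longrightarrow> plain_row N c ! i = c"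
  by (simp add: plain_row_def nth_Cons' del: replicate_Suc replicate.simps)

text \<open>\<open>E s\<close> and \<open>V s\<close> are the left and the bottom side of cell
  \<open>s\<close>. Agreement on common sides is built in, because the right and the top side are
  the entries \<open>E (s + 1)\<close> and \<open>V (s + (2 * N + 2))\<close> of the
  neighbours.\<close>

definition is_tiling :: "tm \<Rightarrow> nat \<Rightarrow> bool list \<Rightarrow> (nat \<Rightarrow> hmsg) \<Rightarrow> (nat \<Rightarrow> vmsg) \<Rightarrow> bool" where
  "is_tiling M N x E V \<longleftrightarrow> (\<forall>s < (N + 2) * (2 * N + 2).
    tile M (cell_classes N x ! s) (E s) (E (s + 1)) (V s) (V (s + (2 * N + 2))))"

section \<open>From tilings to accepting runs\<close>

definition cell_msg :: "config \<Rightarrow> int \<Rightarrow> vmsg" where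
  "cell_msg c p = (fst c, map (\<lambda>(w, h). (w p, h = p)) (snd c))"

abbreviation scanned :: "config \<Rightarrow> nat list" where
  "scanned c \<equiv> map read_tape (snd c)"

lemma cell_msg_nth:
  "j < length (snd c) \<Longrightarrow> snd (cell_msg c p) ! j = (fst (snd c ! j) p, snd (snd c ! j) = p)"
  by (simp add: cell_msg_def split_def)

lemma read_tape_eq: "read_tape t = fst t (snd t)"
  by (cases t) simp

lemma act_tape_eq: "act_tape a t = ((fst t)(snd t := fst a), move_head (snd a) (snd t))"
  by (cases t; cases a) simp

text \<open>The announced transition is constant along the row, and every head lies in the row. The
  tile at a head compares the announced symbol with the one on the tape, so the guess of the scanned
  symbols is correct.\<close>

lemma row_sound:
  assumes len: "length (snd c) = tm_tapes M"
    and msgs: "\<And>p. a \<le> p \<Longrightarrow> p \<le> b \<Longrightarrow> e p \<in> hmsgs M"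
    and tiles: "\<And>p. a \<le> p \<Longrightarrow> p \<le> b \<Longrightarrow> normal_tile M (e p) (e (p + 1)) (cell_msg c p) (u p)"
    and heads: "\<And>t. t \<in> set (snd c) \<Longrightarrow> a \<le> snd t \<and> snd t \<le> b"
    and ab: "a \<le> b"
  obtains q' acts where
    "(q', acts) \<in> ext_trans M (fst c) (scanned c)" "length acts = tm_tapes M"
    "\<And>p. a \<le> p \<Longrightarrow> p \<le> b + 1 \<Longrightarrow> fst (e p) = (fst c, scanned c, q', acts)"
proof -
  obtain q ss q' acts where A: "fst (e a) = (q, ss, q', acts)" by (metis prod_cases4)
  have const: "fst (e p) = (q, ss, q', acts)" if "a \<le> p" "p \<le> b + 1" for p
    using that
  proof (induction p rule: int_ge_induct)
    case (step p)
    then show ?case using tiles[of p] by (simp add: normal_tile_def)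
  qed (simp add: A)
  have t: "fst (cell_msg c p) = q" "(q', acts) \<in> ext_trans M q ss"
    "j < tm_tapes M \<Longrightarrow> tape_ok (ss ! j) (acts ! j) (snd (e p) ! j) (snd (e (p + 1)) ! j)
      (snd (cell_msg c p) ! j) (snd (u p) ! j)"
    if "a \<le> p" "p \<le> b" for p j
    using tiles[OF that] const[of p] that by (auto simp: normal_tile_def)
  have q: "q = fst c" using t(1)[of a] ab by (simp add: cell_msg_def)
  have lens: "length ss = tm_tapes M" "length acts = tm_tapes M"
    using msgs[of a] ab A by (auto simp: hmsgs_def mem_Times_iff)
  have "ss = scanned c"
  proof (rule nth_equalityI)
    fix j assume "j < length ss"
    then have j: "j < tm_tapes M" using lens by simp
    have h: "a \<le> snd (snd c ! j)" "snd (snd c ! j) \<le> b"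
      using heads nth_mem j len by (metis)+
    show "ss ! j = scanned c ! j"
      using t(3)[OF h j] j len by (simp add: tape_ok_def cell_msg_nth read_tape_eq)
  qed (simp add: lens len)
  then show thesis
    using that[of q' acts] t(2)[of a] ab const lens q by simp
qed

text \<open>Every incoming signal is either dictated by a neighbour within the row or comes from a
  border, which is silent. So the signals are exactly the head moves and determine the row
  above.\<close>

lemma row_step:
  assumes len: "length (snd c) = tm_tapes M" and acts: "length acts = tm_tapes M"
    and tiles: "\<And>p. a \<le> p \<Longrightarrow> p \<le> b \<Longrightarrow> normal_tile M (e p) (e (p + 1)) (cell_msg c p) (u p)"
    and msgs: "\<And>p. a \<le> p \<Longrightarrow> p \<le> b \<Longrightarrow> u p \<in> vmsgs M"
    and heads: "\<And>t. t \<in> set (snd c) \<Longrightarrow> a \<le> snd t \<and> snd t \<le> b"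
    and const: "\<And>p. a \<le> p \<Longrightarrow> p \<le> b + 1 \<Longrightarrow> fst (e p) = (q, ss, q', acts)"
    and borders: "no_cross M (e a)" "no_cross M (e (b + 1))"
    and c': "c' = (q', map2 act_tape acts (snd c))"
  shows "\<And>p. a \<le> p \<Longrightarrow> p \<le> b \<Longrightarrow> u p = cell_msg c' p"
    and "\<And>t. t \<in> set (snd c') \<Longrightarrow> a \<le> snd t \<and> snd t \<le> b"
proof -
  define w h where "w j = fst (snd c ! j)" and "h j = snd (snd c ! j)" for j
  have ok: "tape_ok (ss ! j) (acts ! j) (snd (e p) ! j) (snd (e (p + 1)) ! j)
      (w j p, h j = p) (snd (u p) ! j)"
    and q': "fst (u p) = q'"
    if "a \<le> p" "p \<le> b" "j < tm_tapes M" for p j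
    using tiles[OF that(1,2)] const[of p] that len
    by (auto simp: normal_tile_def cell_msg_nth w_def h_def)
  have hb: "a \<le> h j" "h j \<le> b" if "j < tm_tapes M" for j
    using heads[of "snd c ! j"] that len by (auto simp: h_def)
  have right: "fst (snd (e (p + 1)) ! j) \<longleftrightarrow> h j = p \<and> snd (acts ! j) = Right"
    and left: "snd (snd (e p) ! j) \<longleftrightarrow> h j = p \<and> snd (acts ! j) = Left"
    if "a \<le> p" "p \<le> b" "j < tm_tapes M" for p j
    using ok[OF that] by (auto simp: tape_ok_def split: if_splits)
  have right': "fst (snd (e p) ! j) \<longleftrightarrow> h j = p - 1 \<and> snd (acts ! j) = Right"
    if "a \<le> p" "p \<le> b" "j < tm_tapes M" for p j
  proof (cases "p = a")
    case True
    then show ?thesis using borders(1) hb[OF that(3)] that(3) by (auto simp: no_cross_def)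
  next
    case False
    then show ?thesis using right[of "p - 1" j] that by auto
  qed
  have left': "snd (snd (e (p + 1)) ! j) \<longleftrightarrow> h j = p + 1 \<and> snd (acts ! j) = Left"
    if "a \<le> p" "p \<le> b" "j < tm_tapes M" for p j
  proof (cases "p = b")
    case True
    then show ?thesis using borders(2) hb[OF that(3)] that(3) by (auto simp: no_cross_def)
  next
    case False
    then show ?thesis using left[of "p + 1" j] that by auto
  qed
  have c'_nth: "snd c' ! j = ((w j)(h j := fst (acts ! j)), move_head (snd (acts ! j)) (h j))"
    if "j < tm_tapes M" for j
    using that len acts by (simp add: c' act_tape_eq w_def h_def)
  have len': "length (snd c') = tm_tapes M" using len acts by (simp add: c')
  show "u p = cell_msg c' p" if p: "a \<le> p" "p \<le> b" for p
  proof (rule prod_eqI)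
    show "snd (u p) = snd (cell_msg c' p)"
    proof (rule nth_equalityI)
      show "length (snd (u p)) = length (snd (cell_msg c' p))"
        using msgs[OF p] len' by (auto simp: vmsgs_def cell_msg_def)
      fix j assume "j < length (snd (u p))"
      then have j: "j < tm_tapes M" using msgs[OF p] by (auto simp: vmsgs_def)
      have "snd (u p) ! j = (if h j = p then fst (acts ! j) else w j p,
          h j = p \<and> snd (acts ! j) = Stay \<or> h j = p - 1 \<and> snd (acts ! j) = Right \<or>
          h j = p + 1 \<and> snd (acts ! j) = Left)"
        using ok[OF p j] right'[OF p j] left'[OF p j]
        by (intro prod_eqI) (auto simp: tape_ok_def split: if_splits)
      then show "snd (u p) ! j = snd (cell_msg c' p) ! j"
        using j len' by (cases "snd (acts ! j)") (auto simp: cell_msg_nth c'_nth)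
    qed
    show "fst (u p) = fst (cell_msg c' p)"
      using tiles[OF p] const[of p] p by (simp add: normal_tile_def cell_msg_def c')
  qed
  show "a \<le> snd t \<and> snd t \<le> b" if t: "t \<in> set (snd c')" for t
  proof -
    obtain j where j: "j < tm_tapes M" "t = snd c' ! j"
      using t len' unfolding in_set_conv_nth by auto
    \<comment> \<open>A head leaving the row would have to signal across a silent border.\<close>
    have "\<not> (h j = b \<and> snd (acts ! j) = Right)"
      using right[of b j] borders(2) hb[OF j(1)] j(1) by (auto simp: no_cross_def)
    moreover have "\<not> (h j = a \<and> snd (acts ! j) = Left)"
      using left[of a j] borders(1) hb[OF j(1)] j(1) by (auto simp: no_cross_def)
    ultimately show ?thesis
      using hb[OF j(1)] j by (cases "snd (acts ! j)") (auto simp: c'_nth)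
  qed
qed

lemma act_idle: "map2 act_tape (map (\<lambda>s. (s, Stay)) (map read_tape ts)) ts = ts"
  by (rule nth_equalityI) (auto simp: act_tape_eq read_tape_eq)

text \<open>An idle step rewrites the scanned symbols and stays in the accepting state, so it fixes
  the configuration; hence the reflexive closure.\<close>

lemma ext_step:
  assumes "(q', acts) \<in> ext_trans M (fst c) (scanned c)"
  shows "(tm_step M)\<^sup>*\<^sup>* c (q', map2 act_tape acts (snd c))"
proof (cases "(q', acts) \<in> tm_trans M (fst c) (scanned c)")
  case True
  then have "tm_step M c (q', map2 act_tape acts (snd c))" by (auto simp: tm_step_def)
  then show ?thesis by blast
next
  case False
  then have "q' = fst c" "acts = map (\<lambda>s. (s, Stay)) (scanned c)"
    using assms by (auto simp: ext_trans_def split: if_splits)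
  then have "(q', map2 act_tape acts (snd c)) = c"
    by (metis act_idle prod.collapse)
  then show ?thesis by simp
qed

lemma cell_msg_init:
  "cell_msg (tm_init M x) p =
    (0, (contents x p, p = 0) # replicate (tm_tapes M - 1) (0, p = 0))"
  by (auto simp: cell_msg_def tm_init_def contents_def)

theorem tiling_sound:
  assumes wf: "tm_wf M" and tiling: "is_tiling M N x E V"
  shows "\<exists>c. (tm_step M)\<^sup>*\<^sup>* (tm_init M x) c \<and> tm_halted M c \<and> fst c = 1"
proof -
  let ?W = "2 * N + 2"
  \<comment> \<open>The offset 1 skips the border cell that opens the row.\<close>
  define pos where "pos t p = t * ?W + nat (p + int N + 1)" for t p
  have pos_Suc: "pos t (p + 1) = pos t p + 1" if "- int N - 1 \<le> p" for t p
    using that by (simp add: pos_def nat_add_distrib[symmetric] Suc_nat_eq_nat_zadd1 add.commute)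
  have nat_pos: "1 \<le> nat (p + int N + 1)" "nat (p + int N + 1) < ?W"
    if "- int N \<le> p" "p \<le> int N" for p
    using that by auto
  have pos_less: "pos t p < (N + 2) * ?W" if "- int N \<le> p" "p \<le> int N" "t < N + 2" for t p
  proof -
    have "pos t p < Suc t * ?W" using nat_pos[OF that(1,2)] by (simp add: pos_def)
    also have "\<dots> \<le> (N + 2) * ?W" using that(3) by (intro mult_le_mono1) simp
    finally show ?thesis .
  qed
  have tile_pos: "tile M (cell_classes N x ! pos t p) (E (pos t p)) (E (pos t (p + 1)))
      (V (pos t p)) (V (pos (Suc t) p))"
    if "- int N \<le> p" "p \<le> int N" "t < N + 2" for t p
  proof -
    have 1: "pos t p + ?W = pos (Suc t) p" and 2: "pos t p + 1 = pos t (p + 1)"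
      using pos_Suc[of p t] that by (simp_all add: pos_def)
    have "tile M (cell_classes N x ! pos t p) (E (pos t p)) (E (pos t p + 1))
        (V (pos t p)) (V (pos t p + ?W))"
      using tiling pos_less[OF that] unfolding is_tiling_def by blast
    then show ?thesis unfolding 1 2 .
  qed
  have class_pos: "cell_classes N x ! pos t p =
      (if t = 0 then (if p = 0 then 7 else 4) + contents x p else if t = N + 1 then 3 else 2)"
    if "- int N \<le> p" "p \<le> int N" "t < N + 2" for t p
    using nth_cell_classes[of t N "nat (p + int N + 1)" x] first_row_nth[OF that(1,2), of x]
      plain_row_nth[of "nat (p + int N + 1)" N] nat_pos[OF that(1,2)] that(3)
    by (simp add: pos_def)
  have normal: "normal_tile M (E (pos t p)) (E (pos t (p + 1))) (V (pos t p)) (V (pos (Suc t) p))"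
    and msgs: "E (pos t p) \<in> hmsgs M" "V (pos (Suc t) p) \<in> vmsgs M"
    if "- int N \<le> p" "p \<le> int N" "t < N + 2" for t p
    using tile_pos[OF that] class_pos[OF that] by (auto simp: tile_def split: if_splits)
  have border: "no_cross M (E (t * ?W)) \<and> no_cross M (E (t * ?W + 1))" if "t < N + 2" for t
  proof -
    have "t * ?W < (N + 2) * ?W" using that by (intro mult_less_mono1) auto
    then have "tile M (cell_classes N x ! (t * ?W)) (E (t * ?W)) (E (t * ?W + 1))
        (V (t * ?W)) (V (t * ?W + ?W))"
      using tiling by (simp add: is_tiling_def)
    moreover have "cell_classes N x ! (t * ?W) = 1"
      using nth_cell_classes[of t N 0 x] that by (simp add: first_row_def plain_row_def)
    ultimately show ?thesis by (simp add: tile_def)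
  qed
  define inv where "inv t c \<longleftrightarrow> (tm_step M)\<^sup>*\<^sup>* (tm_init M x) c \<and> length (snd c) = tm_tapes M \<and>
    (\<forall>tp \<in> set (snd c). - int N \<le> snd tp \<and> snd tp \<le> int N) \<and>
    (\<forall>p. - int N \<le> p \<longrightarrow> p \<le> int N \<longrightarrow> V (pos t p) = cell_msg c p)" for t c
  have row: "\<exists>q' acts. (q', acts) \<in> ext_trans M (fst c) (scanned c) \<and> length acts = tm_tapes M \<and>
      (\<forall>p. - int N \<le> p \<longrightarrow> p \<le> int N + 1 \<longrightarrow> fst (E (pos t p)) = (fst c, scanned c, q', acts))"
    if t: "t < N + 2" and inv: "inv t c" for t c
  proof -
    have "normal_tile M (E (pos t p)) (E (pos t (p + 1))) (cell_msg c p) (V (pos (Suc t) p))"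
      if "- int N \<le> p" "p \<le> int N" for p
      using normal[OF that t] inv that unfolding inv_def by metis
    then show ?thesis
      by (rule row_sound[of c M "- int N" "int N" "\<lambda>p. E (pos t p)" "\<lambda>p. V (pos (Suc t) p)", rotated 2])
        (use inv t msgs in \<open>auto simp: inv_def\<close>)
  qed
  have inv_ex: "\<exists>c. inv t c" if "t < N + 2" for t
    using that
  proof (induction t)
    case 0
    have k: "tm_tapes M \<ge> 1" using wf by (simp add: tm_wf_def)
    have "V (pos 0 p) = cell_msg (tm_init M x) p" if p: "- int N \<le> p" "p \<le> int N" for p
    proof -
      have c: "contents x p < 3" by (simp add: contents_def)
      have "tile M ((if p = 0 then 7 else 4) + contents x p) (E (pos 0 p)) (E (pos 0 (p + 1)))
          (V (pos 0 p)) (V (pos (Suc 0) p))"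
        using tile_pos[OF p, of 0] class_pos[OF p, of 0] by simp
      then show ?thesis
        unfolding cell_msg_init using c by (cases "p = 0") (auto simp: tile_def)
    qed
    then have "inv 0 (tm_init M x)"
      using k by (auto simp: inv_def tm_init_def)
    then show ?case by blast
  next
    case (Suc t)
    then obtain c where c: "inv t c" by auto
    obtain q' acts where act: "(q', acts) \<in> ext_trans M (fst c) (scanned c)"
      "length acts = tm_tapes M"
      "\<And>p. - int N \<le> p \<Longrightarrow> p \<le> int N + 1 \<Longrightarrow> fst (E (pos t p)) = (fst c, scanned c, q', acts)"
      using row[OF _ c] Suc.prems by auto
    define c' where "c' = (q', map2 act_tape acts (snd c))"
    \<comment> \<open>The left end of the row is the right side of its border cell. The right end is
      the left side of the border cell of the next row.\<close>
    have "pos t (- int N) = t * ?W + 1" by (simp add: pos_def)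
    then have b1: "no_cross M (E (pos t (- int N)))"
      using border[of t] Suc.prems by simp
    have "nat (int N + 1 + int N + 1) = ?W" by simp
    then have "pos t (int N + 1) = Suc t * ?W" by (simp add: pos_def)
    then have b2: "no_cross M (E (pos t (int N + 1)))"
      using border[of "Suc t"] Suc.prems by simp
    note c_inv = c[unfolded inv_def]
    have tiles: "normal_tile M (E (pos t p)) (E (pos t (p + 1))) (cell_msg c p) (V (pos (Suc t) p))"
      if "- int N \<le> p" "p \<le> int N" for p
      using normal[OF that, of t] c_inv that Suc.prems by auto
    have "V (pos (Suc t) p) = cell_msg c' p" if "- int N \<le> p" "p \<le> int N" for p
      by (rule row_step(1)[of c M acts "- int N" "int N" "\<lambda>p. E (pos t p)" "\<lambda>p. V (pos (Suc t) p)",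
            OF _ act(2) tiles _ _ act(3) b1 b2 c'_def that])
        (use c_inv msgs Suc.prems in auto)
    moreover have "- int N \<le> snd tp \<and> snd tp \<le> int N" if "tp \<in> set (snd c')" for tp
      by (rule row_step(2)[of c M acts "- int N" "int N" "\<lambda>p. E (pos t p)" "\<lambda>p. V (pos (Suc t) p)",
            OF _ act(2) tiles _ _ act(3) b1 b2 c'_def that])
        (use c_inv msgs Suc.prems in auto)
    moreover have "(tm_step M)\<^sup>*\<^sup>* (tm_init M x) c'"
      using c_inv ext_step[OF act(1)] by (auto simp: c'_def)
    ultimately have "inv (Suc t) c'"
      using c_inv act(2) by (auto simp: inv_def c'_def)
    then show ?case by blast
  qed
  \<comment> \<open>No border cell follows the last row, so it is only read and no step is taken
    from it: \<open>row\<close> gives its scanned symbols, and class 3 checks that the machine has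
    halted and accepts.\<close>
  obtain c where c: "inv (N + 1) c" using inv_ex[of "N + 1"] by auto
  obtain q' acts where act: "fst (E (pos (N + 1) 0)) = (fst c, scanned c, q', acts)"
    using row[OF _ c] by auto
  have "fst c = 1 \<and> tm_trans M 1 (scanned c) = {}"
    using tile_pos[of 0 "N + 1"] class_pos[of 0 "N + 1"] act by (simp add: tile_def)
  then have "tm_halted M c" "fst c = 1"
    by (auto simp: tm_halted_def tm_step_def)
  then show ?thesis using c unfolding inv_def by blast
qed

section \<open>From accepting runs to tilings\<close>

definition valid_config :: "tm \<Rightarrow> config \<Rightarrow> bool" where
  "valid_config M c \<longleftrightarrow> fst c < tm_states M \<and> length (snd c) = tm_tapes M \<and>
    (\<forall>t \<in> set (snd c). \<forall>i. fst t i < tm_syms M)"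

lemma valid_init: "tm_wf M \<Longrightarrow> valid_config M (tm_init M x)"
  by (auto simp: valid_config_def tm_init_def tm_wf_def contents_def set_replicate_conv_if)

lemma scanned_valid: "valid_config M c \<Longrightarrow> set (scanned c) \<subseteq> {..<tm_syms M} \<and> length (scanned c) = tm_tapes M"
  by (auto simp: valid_config_def read_tape_eq)

lemma ext_trans_valid:
  assumes wf: "tm_wf M" and c: "valid_config M c" and act: "(q', acts) \<in> ext_trans M (fst c) (scanned c)"
  shows "q' < tm_states M" "length acts = tm_tapes M" "fst ` set acts \<subseteq> {..<tm_syms M}"
    "valid_config M (q', map2 act_tape acts (snd c))"
proof -
  have *: "q' < tm_states M \<and> length acts = tm_tapes M \<and> fst ` set acts \<subseteq> {..<tm_syms M}"
  proof (cases "(q', acts) \<in> tm_trans M (fst c) (scanned c)")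
    case True
    moreover have "fst c < tm_states M" using c by (simp add: valid_config_def)
    ultimately show ?thesis
      using wf scanned_valid[OF c] unfolding tm_wf_def by blast
  next
    case False
    then have "q' = fst c" "acts = map (\<lambda>s. (s, Stay)) (scanned c)"
      using act by (auto simp: ext_trans_def split: if_splits)
    then show ?thesis
      using scanned_valid[OF c] c by (auto simp: valid_config_def)
  qed
  have "fst t i < tm_syms M" if t: "t \<in> set (map2 act_tape acts (snd c))" for t i
  proof -
    from t obtain a t' where at: "(a, t') \<in> set (zip acts (snd c))" "t = act_tape a t'" by auto
    then have "a \<in> set acts" "t' \<in> set (snd c)" by (auto dest: set_zip_leftD set_zip_rightD)
    then show ?thesis using * c by (auto simp: at(2) act_tape_eq valid_config_def)
  qed
  then show "valid_config M (q', map2 act_tape acts (snd c))"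
    using * c by (simp add: valid_config_def)
  show "q' < tm_states M" "length acts = tm_tapes M" "fst ` set acts \<subseteq> {..<tm_syms M}"
    using * by auto
qed

theorem tiling_complete:
  assumes wf: "tm_wf M"
    and bound: "\<And>c t. (tm_step M ^^ t) (tm_init M x) c \<Longrightarrow> t < N"
    and acc: "(tm_step M)\<^sup>*\<^sup>* (tm_init M x) c" "tm_halted M c" "fst c = 1"
  shows "\<exists>E V. is_tiling M N x E V"
proof -
  obtain n where n: "(tm_step M ^^ n) (tm_init M x) c"
    using acc(1) by (auto simp: rtranclp_power)
  then obtain f where f: "f 0 = tm_init M x" "f n = c" "\<And>i. i < n \<Longrightarrow> tm_step M (f i) (f (Suc i))"
    by (auto simp: relpowp_fun_conv)
  have nN: "n < N" using bound n by blast
  \<comment> \<open>From time \<open>n\<close> on the run stands still, which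
    \<open>ext_trans\<close> permits in a halted accepting configuration.\<close>
  define run where "run t = f (min t n)" for t
  have "\<exists>q' acts. (q', acts) \<in> ext_trans M (fst (run t)) (scanned (run t)) \<and>
      run (Suc t) = (q', map2 act_tape acts (snd (run t)))" for t
  proof (cases "t < n")
    case True
    then show ?thesis
      using f(3)[OF True] by (auto simp: run_def tm_step_def ext_trans_def min_def)
  next
    case False
    then have r: "run t = c" "run (Suc t) = c" by (auto simp: run_def f(2) min_def)
    have "tm_trans M (fst c) (scanned c) = {}"
      using acc(2) by (auto simp: tm_halted_def tm_step_def)
    then have "(1, map (\<lambda>s. (s, Stay)) (scanned c)) \<in> ext_trans M (fst c) (scanned c)"
      using acc(3) by (simp add: ext_trans_def)
    moreover have "c = (1, map2 act_tape (map (\<lambda>s. (s, Stay)) (scanned c)) (snd c))"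
      unfolding act_idle using acc(3) by (metis prod.collapse)
    ultimately show ?thesis unfolding r by blast
  qed
  then obtain q' acts where act: "\<And>t. (q' t, acts t) \<in> ext_trans M (fst (run t)) (scanned (run t))"
    "\<And>t. run (Suc t) = (q' t, map2 act_tape (acts t) (snd (run t)))" by metis
  have valid: "valid_config M (run t)" for t
  proof (induction t)
    case 0
    then show ?case using valid_init[OF wf] by (simp add: run_def f)
  next
    case (Suc t)
    then show ?case using ext_trans_valid(4)[OF wf Suc act(1)] by (simp add: act(2))
  qed
  note act_valid = ext_trans_valid[OF wf valid act(1)]
  have len: "length (snd (run t)) = tm_tapes M" for t
    using valid by (simp add: valid_config_def)
  have head_le_t: "\<bar>snd tp\<bar> \<le> int t" if "t \<le> n" "tp \<in> set (snd (run t))" for t tp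
    using that
  proof (induction t arbitrary: tp)
    case 0
    then show ?case by (auto simp: run_def f tm_init_def)
  next
    case (Suc t)
    then obtain a tp' where at: "(a, tp') \<in> set (zip (acts t) (snd (run t)))" "tp = act_tape a tp'"
      by (auto simp: act(2))
    then have "\<bar>snd tp'\<bar> \<le> int t"
      using Suc.IH[of tp'] Suc.prems(1) set_zip_rightD[OF at(1)] by simp
    then show ?case by (cases "snd a") (auto simp: at(2) act_tape_eq)
  qed
  have head_le: "\<bar>snd tp\<bar> \<le> int n" if "tp \<in> set (snd (run t))" for t tp
  proof -
    have "run t = run (min t n)" by (simp add: run_def)
    then show ?thesis using head_le_t[of "min t n" tp] that by simp
  qed
  \<comment> \<open>As the bound is strict, even a further move keeps the head between
    \<open>-N\<close> and \<open>N\<close>, so nothing crosses the ends of a row.\<close>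
  have heads: "\<bar>snd (snd (run t) ! j)\<bar> < int N" if "j < tm_tapes M" for t j
    using head_le[of "snd (run t) ! j" t] that len[of t] nN by simp
  let ?W = "2 * N + 2"
  define H :: "nat \<Rightarrow> int \<Rightarrow> hmsg" where
    "H t p = ((fst (run t), scanned (run t), q' t, acts t),
      map (\<lambda>j. (snd (snd (run t) ! j) = p - 1 \<and> snd (acts t ! j) = Right,
        snd (snd (run t) ! j) = p \<and> snd (acts t ! j) = Left)) [0..<tm_tapes M])" for t p
  \<comment> \<open>At a border cell this is the message of position \<open>-N - 1\<close>; there
    only membership in \<open>vmsgs M\<close> is asked for.\<close>
  define V where "V s = cell_msg (run (s div ?W)) (int (s mod ?W) - int N - 1)" for s
  \<comment> \<open>The left side of a border cell is the right end of the previous row. In row 0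
    the truncated subtraction yields the right end of row 0 itself, which is silent as
    required.\<close>
  define E where "E s = (if s mod ?W = 0 then H (s div ?W - 1) (int N + 1)
    else H (s div ?W) (int (s mod ?W) - int N - 1))" for s
  have fst_H: "fst (H t p) = (fst (run t), scanned (run t), q' t, acts t)" for t p
    by (simp add: H_def)
  have H_msg: "H t p \<in> hmsgs M" for t p
  proof -
    have "set (acts t) \<subseteq> {..<tm_syms M} \<times> {Left, Stay, Right}"
    proof
      fix e assume "e \<in> set (acts t)"
      then have "fst e < tm_syms M" using act_valid(3)[of t] by auto
      moreover have "snd e \<in> {Left, Stay, Right}" by (cases "snd e") auto
      ultimately show "e \<in> {..<tm_syms M} \<times> {Left, Stay, Right}" by (cases e) auto
    qed
    then show ?thesis
      using act_valid(1,2)[of t] valid[of t] scanned_valid[OF valid[of t]]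
      by (auto simp: H_def hmsgs_def valid_config_def)
  qed
  have V_msg: "cell_msg (run t) p \<in> vmsgs M" for t p
    using valid[of t] by (auto simp: cell_msg_def vmsgs_def valid_config_def)
  have normal: "normal_tile M (H t p) (H t (p + 1)) (cell_msg (run t) p) (cell_msg (run (Suc t)) p)"
    for t p
  proof -
    have "tape_ok (scanned (run t) ! j) (acts t ! j) (snd (H t p) ! j) (snd (H t (p + 1)) ! j)
        (snd (cell_msg (run t) p) ! j) (snd (cell_msg (run (Suc t)) p) ! j)"
      if j: "j < tm_tapes M" for j
    proof -
      have nth: "snd (run (Suc t)) ! j = act_tape (acts t ! j) (snd (run t) ! j)"
        using j len act_valid(2)[of t] by (simp add: act(2))
      show ?thesis
        using j len[of t] len[of "Suc t"]
        by (cases "snd (acts t ! j)")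
          (auto simp: tape_ok_def H_def cell_msg_nth nth act_tape_eq read_tape_eq)
    qed
    moreover have "fst (run (Suc t)) = q' t" by (simp add: act(2))
    ultimately show ?thesis
      using act(1)[of t] by (simp add: normal_tile_def H_def cell_msg_def)
  qed
  have no_cross: "no_cross M (H t (- int N))" "no_cross M (H t (int N + 1))" for t
    using heads[of _ t] by (force simp: no_cross_def H_def)+
  have "is_tiling M N x E V"
    unfolding is_tiling_def
  proof (intro allI impI)
    fix s assume s: "s < (N + 2) * ?W"
    define t i where "t = s div ?W" and "i = s mod ?W"
    define p where "p = int i - int N - 1"
    have st: "s = t * ?W + i" unfolding t_def i_def by (rule div_mult_mod_eq[symmetric])
    have i: "i < ?W" by (simp add: i_def)
    have t: "t < N + 2" using s unfolding t_def by (rule less_mult_imp_div_less)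
    have V1: "V s = cell_msg (run t) p" by (simp add: V_def t_def i_def p_def)
    have "(s + ?W) div ?W = s div ?W + 1" by (rule div_add_self2) simp
    moreover have "(s + ?W) mod ?W = s mod ?W" by (rule mod_add_self2)
    ultimately have "(s + ?W) div ?W = Suc t" "(s + ?W) mod ?W = i"
      unfolding t_def i_def by simp_all
    then have V2: "V (s + ?W) = cell_msg (run (Suc t)) p"
      by (simp only: V_def p_def)
    have E2: "E (s + 1) = H t (p + 1)"
    proof (cases "i + 1 = ?W")
      case True
      then have "s + 1 = Suc t * ?W" using st by simp
      then have "(s + 1) div ?W = Suc t" "(s + 1) mod ?W = 0"
        by (simp_all only: nonzero_mult_div_cancel_right mod_mult_self2_is_0)
      moreover have "p + 1 = int N + 1" using True by (simp add: p_def)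
      ultimately show ?thesis unfolding E_def by simp
    next
      case False
      then have "i + 1 < ?W" using i by simp
      moreover have "s + 1 = (i + 1) + t * ?W" using st by simp
      ultimately have "(s + 1) div ?W = t" "(s + 1) mod ?W = i + 1"
        by (simp_all only: div_mult_self1 mod_mult_self1 div_less mod_less)
      then show ?thesis unfolding E_def by (simp add: p_def)
    qed
    show "tile M (cell_classes N x ! s) (E s) (E (s + 1)) (V s) (V (s + ?W))"
    proof (cases "i = 0")
      case True
      have "cell_classes N x ! s = 1"
        using nth_cell_classes[OF t i, of x] st True by (simp add: first_row_def plain_row_def)
      moreover have "E s = H (t - 1) (int N + 1)" using True by (simp add: E_def t_def i_def)
      moreover have "p + 1 = - int N" using True by (simp add: p_def)
      ultimately show ?thesis
        unfolding E2 V1 V2 tile_def using H_msg V_msg no_cross by simp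
    next
      case False
      then have E1: "E s = H t p" by (simp add: E_def t_def i_def p_def)
      have p: "- int N \<le> p" "p \<le> int N" "nat (p + int N + 1) = i"
        using False i by (auto simp: p_def)
      have class_s: "cell_classes N x ! s =
          (if t = 0 then (if p = 0 then 7 else 4) + contents x p else if t = N + 1 then 3 else 2)"
        using nth_cell_classes[OF t i, of x] first_row_nth[OF p(1,2), of x]
          plain_row_nth[of i N] False i st p(3) by simp
      have c3: "contents x p < 3" by (simp add: contents_def)
      have fin: "fst (run (N + 1)) = 1" "tm_trans M 1 (scanned (run (N + 1))) = {}"
      proof -
        have "run (N + 1) = c" using nN by (simp add: run_def f(2) min_def)
        then show "fst (run (N + 1)) = 1" "tm_trans M 1 (scanned (run (N + 1))) = {}"
          using acc by (auto simp: tm_halted_def tm_step_def)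
      qed
      have "cell_msg (run 0) p = (0, (contents x p, p = 0) # replicate (tm_tapes M - 1) (0, p = 0))"
        using cell_msg_init by (simp add: run_def f)
      then show ?thesis
        unfolding E1 E2 V1 V2 class_s tile_def
        using H_msg V_msg normal fin c3 by (auto simp: fst_H)
    qed
  qed
  then show ?thesis by blast
qed

section \<open>A structured language for tape machines\<close>

datatype instr = IWrite nat nat | IMove nat move | IBranch nat nat nat | IJump nat

definition keep :: "nat list \<Rightarrow> (nat \<times> move) list" where
  "keep ss = map (\<lambda>s. (s, Stay)) ss"

fun instr_action :: "nat \<Rightarrow> nat list \<Rightarrow> instr \<Rightarrow> nat \<times> (nat \<times> move) list" where
  "instr_action q ss (IWrite j s) = (Suc q, (keep ss)[j := (s, Stay)])"
| "instr_action q ss (IMove j d) = (Suc q, (keep ss)[j := (ss ! j, d)])"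
| "instr_action q ss (IBranch j s n) = (if ss ! j = s then Suc q else n, keep ss)"
| "instr_action q ss (IJump n) = (n, keep ss)"

fun instr_sym :: "instr \<Rightarrow> nat" where
  "instr_sym (IWrite j s) = s"
| "instr_sym _ = 0"

fun instr_target :: "instr \<Rightarrow> nat" where
  "instr_target (IBranch j s n) = n"
| "instr_target (IJump n) = n"
| "instr_target _ = 0"

text \<open>The sums are convenient upper bounds for the symbols and states that occur.\<close>

definition machine :: "nat \<Rightarrow> instr list \<Rightarrow> tm" where
  "machine k P = \<lparr> tm_tapes = k, tm_syms = 3 + sum_list (map instr_sym P),
    tm_states = 2 + length P + sum_list (map instr_target P),
    tm_trans = (\<lambda>q ss. if q < length P then {instr_action q ss (P ! q)} else {}) \<rparr>"

lemma sum_list_ge_nth: "q < length P \<Longrightarrow> f (P ! q) \<le> sum_list (map f P :: nat list)"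
  by (rule member_le_sum_list) auto

lemma machine_wf:
  assumes "k \<ge> 1"
  shows "tm_wf (machine k P)"
proof -
  let ?M = "machine k P"
  have act: "q' < tm_states ?M \<and> length acts = k \<and> fst ` set acts \<subseteq> {..<tm_syms ?M}"
    if ss: "length ss = k" "set ss \<subseteq> {..<tm_syms ?M}" and q: "q < length P"
      and act: "instr_action q ss (P ! q) = (q', acts)" for q ss q' acts
  proof -
    have t: "instr_target (P ! q) \<le> sum_list (map instr_target P)"
      and s: "instr_sym (P ! q) \<le> sum_list (map instr_sym P)"
      using q by (auto intro!: sum_list_ge_nth)
    have k: "fst ` set (keep ss) \<subseteq> {..<tm_syms ?M}"
      using ss by (auto simp: keep_def)
    have up: "fst ` set ((keep ss)[j := (a, d)]) \<subseteq> {..<tm_syms ?M}"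
      if "j < k \<Longrightarrow> a < tm_syms ?M" for j a d
    proof (cases "j < k")
      case True
      then have "fst ` set ((keep ss)[j := (a, d)]) \<subseteq> insert a (fst ` set (keep ss))"
        using set_update_subset_insert[of "keep ss" j "(a, d)"] by auto
      then show ?thesis using k that True by auto
    next
      case False
      then have "(keep ss)[j := (a, d)] = keep ss"
        using ss by (simp add: keep_def list_update_beyond)
      then show ?thesis using k by simp
    qed
    have nth: "ss ! j < tm_syms ?M" if "j < k" for j
      using ss that nth_mem by blast
    have len: "length (keep ss) = k" using ss by (simp add: keep_def)
    show ?thesis
    proof (cases "P ! q")
      case (IWrite j a)
      then show ?thesis using act q t s len up[of j a] by (auto simp: machine_def)
    next
      case (IMove j d)
      then show ?thesis using act q t s len up[of j "ss ! j", OF nth] by (auto simp: machine_def)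
    next
      case (IBranch j a n)
      then show ?thesis using act q t s len k by (auto simp: machine_def split: if_splits)
    next
      case (IJump n)
      then show ?thesis using act q t s len k by (auto simp: machine_def)
    qed
  qed
  show ?thesis
    unfolding tm_wf_def
  proof (intro conjI allI impI)
    show "tm_tapes ?M \<ge> 1" "tm_syms ?M \<ge> 3" "tm_states ?M \<ge> 2"
      using assms by (simp_all add: machine_def)
    fix q ss
    assume q: "q < tm_states ?M \<and> length ss = tm_tapes ?M \<and> set ss \<subseteq> {..<tm_syms ?M}"
    show "\<forall>(q', acts) \<in> tm_trans ?M q ss. q' < tm_states ?M \<and> length acts = tm_tapes ?M \<and>
        fst ` set acts \<subseteq> {..<tm_syms ?M}"
    proof (cases "q < length P")
      case True
      obtain q' acts where qa: "instr_action q ss (P ! q) = (q', acts)" by force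
      have k: "tm_tapes ?M = k" and t: "tm_trans ?M q ss = {(q', acts)}"
        using True qa by (simp_all add: machine_def)
      show ?thesis
        using act[OF _ _ True qa] q unfolding t k by simp
    next
      case False
      then show ?thesis by (simp add: machine_def)
    qed
  qed
qed

lemma machine_deterministic: "tm_deterministic (machine k P)"
  by (auto simp: tm_deterministic_def machine_def)

type_synonym store = "nat \<Rightarrow> tape"

text \<open>A store has a tape for every number, so programs can be verified before the number of
  tapes is fixed.\<close>

definition cfg :: "nat \<Rightarrow> nat \<Rightarrow> store \<Rightarrow> config" where
  "cfg k q \<sigma> = (q, map \<sigma> [0..<k])"

definition write_tape :: "nat \<Rightarrow> tape \<Rightarrow> tape" where
  "write_tape s = act_tape (s, Stay)"

definition move_tape :: "move \<Rightarrow> tape \<Rightarrow> tape" where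
  "move_tape d t = act_tape (read_tape t, d) t"

lemma write_tape_simp [simp]: "write_tape s (w, i) = (w(i := s), i)"
  by (simp add: write_tape_def)

lemma move_tape_simp [simp]: "move_tape d (w, i) = (w, move_head d i)"
  by (simp add: move_tape_def)

lemma act_tape_keep [simp]: "act_tape (read_tape t, Stay) t = t"
  by (cases t) simp

lemma act_keep: "map2 act_tape (keep (map read_tape ts)) ts = ts"
  by (rule nth_equalityI) (auto simp: keep_def)

lemma act_keep_update:
  "map2 act_tape ((keep (map read_tape ts))[j := a]) ts =
    ts[j := act_tape a (ts ! j)]"
proof (rule nth_equalityI)
  fix i assume "i < length (map2 act_tape ((keep (map read_tape ts))[j := a]) ts)"
  then have i: "i < length ts" by (simp add: keep_def)
  have "map2 act_tape (keep (map read_tape ts)) ts ! i = ts ! i" by (simp add: act_keep)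
  then show "map2 act_tape ((keep (map read_tape ts))[j := a]) ts ! i =
      ts[j := act_tape a (ts ! j)] ! i"
    using i by (cases "i = j") (auto simp: keep_def)
qed (simp add: keep_def)

lemma map_upt_update: "(map \<sigma> [0..<k])[j := t] = map (\<sigma>(j := t)) [0..<k]"
  by (rule nth_equalityI) (auto simp: nth_list_update)

lemma machine_step:
  assumes "q < length P" "instr_action q (map read_tape (map \<sigma> [0..<k])) (P ! q) = (q', acts)"
    "map2 act_tape acts (map \<sigma> [0..<k]) = map \<sigma>' [0..<k]"
  shows "tm_step (machine k P) (cfg k q \<sigma>) (cfg k q' \<sigma>')"
  using assms by (auto simp: tm_step_def machine_def cfg_def)

lemma machine_step_write:
  assumes "q < length P" "P ! q = IWrite j s" "j < k"
  shows "tm_step (machine k P) (cfg k q \<sigma>) (cfg k (Suc q) (\<sigma>(j := write_tape s (\<sigma> j))))"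
  using assms
  by (intro machine_step[OF assms(1)])
    (auto simp only: instr_action.simps act_keep_update write_tape_def map_upt_update
      length_map length_upt nth_map_upt, simp add: fun_upd_def cong: map_cong)

lemma machine_step_move:
  assumes "q < length P" "P ! q = IMove j d" "j < k"
  shows "tm_step (machine k P) (cfg k q \<sigma>) (cfg k (Suc q) (\<sigma>(j := move_tape d (\<sigma> j))))"
  using assms
  by (intro machine_step[OF assms(1)])
    (auto simp only: instr_action.simps act_keep_update move_tape_def map_upt_update
      length_map length_upt nth_map_upt, simp add: fun_upd_def cong: map_cong)

lemma machine_step_branch:
  assumes "q < length P" "P ! q = IBranch j s n" "j < k"
  shows "tm_step (machine k P) (cfg k q \<sigma>) (cfg k (if read_tape (\<sigma> j) = s then Suc q else n) \<sigma>)"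
  by (rule machine_step[OF assms(1) _ act_keep]) (use assms in simp)

lemma machine_step_jump:
  assumes "q < length P" "P ! q = IJump n"
  shows "tm_step (machine k P) (cfg k q \<sigma>) (cfg k n \<sigma>)"
  by (rule machine_step[OF assms(1) _ act_keep]) (use assms in simp)

section \<open>While programs and their compilation\<close>

datatype com =
    Skip
  | Write nat nat
  | Move nat move
  | Seq com com (infixr \<open>;;\<close> 60)
  | IfSym nat nat com com
  | While nat com

text \<open>The counts are those of the compiled code: a branch taken pays for the jump over the
  other one, and a round of a loop for the test and the jump back.\<close>

inductive exec :: "com \<Rightarrow> store \<Rightarrow> nat \<Rightarrow> store \<Rightarrow> bool" where
  Skip: "exec Skip \<sigma> 0 \<sigma>"
| Write: "exec (Write j s) \<sigma> 1 (\<sigma>(j := write_tape s (\<sigma> j)))"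
| Move: "exec (Move j d) \<sigma> 1 (\<sigma>(j := move_tape d (\<sigma> j)))"
| Seq: "exec c \<sigma> t \<sigma>' \<Longrightarrow> exec d \<sigma>' t' \<sigma>'' \<Longrightarrow> exec (c ;; d) \<sigma> (t + t') \<sigma>''"
| IfT: "read_tape (\<sigma> j) = s \<Longrightarrow> exec c \<sigma> t \<sigma>' \<Longrightarrow> exec (IfSym j s c d) \<sigma> (t + 2) \<sigma>'"
| IfF: "read_tape (\<sigma> j) \<noteq> s \<Longrightarrow> exec d \<sigma> t \<sigma>' \<Longrightarrow> exec (IfSym j s c d) \<sigma> (t + 1) \<sigma>'"
| WhileF: "read_tape (\<sigma> j) = 0 \<Longrightarrow> exec (While j c) \<sigma> 2 \<sigma>"
| WhileT: "read_tape (\<sigma> j) \<noteq> 0 \<Longrightarrow> exec c \<sigma> t \<sigma>' \<Longrightarrow> exec (While j c) \<sigma>' t' \<sigma>'' \<Longrightarrow>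
    exec (While j c) \<sigma> (t + t' + 2) \<sigma>''"

fun code_len :: "com \<Rightarrow> nat" where
  "code_len Skip = 0"
| "code_len (Write j s) = 1"
| "code_len (Move j d) = 1"
| "code_len (c ;; d) = code_len c + code_len d"
| "code_len (IfSym j s c d) = code_len c + code_len d + 2"
| "code_len (While j c) = code_len c + 3"

text \<open>\<open>IBranch\<close> falls through when the symbol matches. A loop tests for the
  blank, so the instruction after its test is the jump to the exit.\<close>

fun compile :: "com \<Rightarrow> nat \<Rightarrow> instr list" where
  "compile Skip pc = []"
| "compile (Write j s) pc = [IWrite j s]"
| "compile (Move j d) pc = [IMove j d]"
| "compile (c ;; d) pc = compile c pc @ compile d (pc + code_len c)"
| "compile (IfSym j s c d) pc =
    [IBranch j s (pc + code_len c + 2)] @ compile c (pc + 1) @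
    [IJump (pc + code_len c + code_len d + 2)] @ compile d (pc + code_len c + 2)"
| "compile (While j c) pc =
    [IBranch j 0 (pc + 2)] @ [IJump (pc + code_len c + 3)] @ compile c (pc + 2) @ [IJump pc]"

fun uses_tapes :: "nat \<Rightarrow> com \<Rightarrow> bool" where
  "uses_tapes k Skip \<longleftrightarrow> True"
| "uses_tapes k (Write j s) \<longleftrightarrow> j < k"
| "uses_tapes k (Move j d) \<longleftrightarrow> j < k"
| "uses_tapes k (c ;; d) \<longleftrightarrow> uses_tapes k c \<and> uses_tapes k d"
| "uses_tapes k (IfSym j s c d) \<longleftrightarrow> j < k \<and> uses_tapes k c \<and> uses_tapes k d"
| "uses_tapes k (While j c) \<longleftrightarrow> j < k \<and> uses_tapes k c"

lemma length_compile [simp]: "length (compile c pc) = code_len c"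
  by (induction c arbitrary: pc) auto

definition code_at :: "instr list \<Rightarrow> nat \<Rightarrow> instr list \<Rightarrow> bool" where
  "code_at P pc is \<longleftrightarrow> (\<exists>as bs. P = as @ is @ bs \<and> length as = pc)"

lemma code_at_append:
  "code_at P pc (is @ js) \<longleftrightarrow> code_at P pc is \<and> code_at P (pc + length is) js"
proof
  assume "code_at P pc (is @ js)"
  then obtain as bs where *: "P = as @ is @ js @ bs" "length as = pc"
    by (auto simp: code_at_def)
  then have "P = (as @ is) @ js @ bs" "length (as @ is) = pc + length is" by auto
  then show "code_at P pc is \<and> code_at P (pc + length is) js"
    unfolding code_at_def using * by blast
next
  assume "code_at P pc is \<and> code_at P (pc + length is) js"
  then obtain as bs as' bs' where *: "P = as @ is @ bs" "length as = pc" "P = as' @ js @ bs'"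
    "length as' = pc + length is"
    unfolding code_at_def by blast
  then have "(as @ is) @ bs = as' @ js @ bs'" "length (as @ is) = length as'" by auto
  then have "as @ is = as' \<and> bs = js @ bs'" using append_eq_append_conv by blast
  then show "code_at P pc (is @ js)"
    unfolding code_at_def using * by (intro exI[of _ as] exI[of _ bs']) simp
qed

lemma code_at_single: "code_at P pc [i] \<Longrightarrow> pc < length P \<and> P ! pc = i"
  by (auto simp: code_at_def)

lemma relpowp_Suc_left: "R x y \<Longrightarrow> (R ^^ n) y z \<Longrightarrow> (R ^^ Suc n) x z"
  using relpowp_Suc_I2[of R x y n z] by simp

lemma relpowp_add_I: "(R ^^ m) x y \<Longrightarrow> (R ^^ n) y z \<Longrightarrow> (R ^^ (m + n)) x z"
  by (auto simp: relpowp_add)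

lemma relpowp_1I: "R x y \<Longrightarrow> (R ^^ 1) x y" for R :: "'a \<Rightarrow> 'a \<Rightarrow> bool"
  by (metis relpowp_1)

lemma compile_correct:
  assumes "exec c \<sigma> t \<sigma>'" "code_at P pc (compile c pc)" "uses_tapes k c"
  shows "(tm_step (machine k P) ^^ t) (cfg k pc \<sigma>) (cfg k (pc + code_len c) \<sigma>')"
  using assms
proof (induction arbitrary: pc rule: exec.induct)
  case (Skip \<sigma>)
  then show ?case by simp
next
  case (Write j s \<sigma>)
  then show ?case
    using code_at_single[OF Write(1)[simplified]] machine_step_write[of pc P j s k \<sigma>] relpowp_1I
    by (metis Suc_eq_plus1 code_len.simps(2) uses_tapes.simps(2))
next
  case (Move j d \<sigma>)
  then show ?case
    using code_at_single[OF Move(1)[simplified]] machine_step_move[of pc P j d k \<sigma>] relpowp_1I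
    by (metis Suc_eq_plus1 code_len.simps(3) uses_tapes.simps(3))
next
  case (Seq c \<sigma> t \<sigma>' d t' \<sigma>'')
  then have "(tm_step (machine k P) ^^ t) (cfg k pc \<sigma>) (cfg k (pc + code_len c) \<sigma>')"
    "(tm_step (machine k P) ^^ t') (cfg k (pc + code_len c) \<sigma>')
      (cfg k (pc + code_len c + code_len d) \<sigma>'')"
    by (auto simp: code_at_append)
  then show ?case unfolding code_len.simps add.assoc[symmetric] by (rule relpowp_add_I)
next
  case (IfT \<sigma> j s c t \<sigma>' d)
  have c0: "code_at P pc [IBranch j s (pc + code_len c + 2)]"
    and c1: "code_at P (pc + 1) (compile c (pc + 1))"
    and c2: "code_at P (pc + 1 + code_len c) [IJump (pc + code_len c + code_len d + 2)]"
    using IfT.prems(1) unfolding compile.simps code_at_append by (simp_all add: ac_simps)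
  have "tm_step (machine k P) (cfg k pc \<sigma>) (cfg k (pc + 1) \<sigma>)"
    using machine_step_branch[of pc P j s _ k \<sigma>] code_at_single[OF c0] IfT by simp
  moreover have "(tm_step (machine k P) ^^ t) (cfg k (pc + 1) \<sigma>) (cfg k (pc + 1 + code_len c) \<sigma>')"
    using IfT.IH[OF c1] IfT.prems by simp
  moreover have "tm_step (machine k P) (cfg k (pc + 1 + code_len c) \<sigma>')
      (cfg k (pc + code_len c + code_len d + 2) \<sigma>')"
    using machine_step_jump code_at_single[OF c2] by blast
  ultimately have "(tm_step (machine k P) ^^ (Suc (t + 1))) (cfg k pc \<sigma>)
      (cfg k (pc + code_len c + code_len d + 2) \<sigma>')"
    by (intro relpowp_Suc_left relpowp_add_I relpowp_1I)
  then show ?case by (simp add: add.assoc)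
next
  case (IfF \<sigma> j s d t \<sigma>' c)
  have c0: "code_at P pc [IBranch j s (pc + code_len c + 2)]"
    and c2: "code_at P (pc + code_len c + 2) (compile d (pc + code_len c + 2))"
    using IfF.prems(1) unfolding compile.simps code_at_append by (simp_all add: ac_simps)
  have "tm_step (machine k P) (cfg k pc \<sigma>) (cfg k (pc + code_len c + 2) \<sigma>)"
    using machine_step_branch[of pc P j s _ k \<sigma>] code_at_single[OF c0] IfF by simp
  moreover have "(tm_step (machine k P) ^^ t) (cfg k (pc + code_len c + 2) \<sigma>)
      (cfg k (pc + code_len c + 2 + code_len d) \<sigma>')"
    using IfF.IH[OF c2] IfF.prems by simp
  ultimately have "(tm_step (machine k P) ^^ (Suc t)) (cfg k pc \<sigma>)
      (cfg k (pc + code_len c + 2 + code_len d) \<sigma>')"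
    by (rule relpowp_Suc_left)
  then show ?case by (simp add: ac_simps)
next
  case (WhileF \<sigma> j c)
  have c0: "code_at P pc [IBranch j 0 (pc + 2)]"
    and c1: "code_at P (Suc pc) [IJump (pc + code_len c + 3)]"
    using WhileF.prems(1) unfolding compile.simps code_at_append by (simp_all add: ac_simps)
  have "tm_step (machine k P) (cfg k pc \<sigma>) (cfg k (Suc pc) \<sigma>)"
    using machine_step_branch[of pc P j 0 _ k \<sigma>] code_at_single[OF c0] WhileF by simp
  moreover have "tm_step (machine k P) (cfg k (Suc pc) \<sigma>) (cfg k (pc + code_len c + 3) \<sigma>)"
    using machine_step_jump code_at_single[OF c1] by blast
  ultimately have "(tm_step (machine k P) ^^ (Suc 1)) (cfg k pc \<sigma>) (cfg k (pc + code_len c + 3) \<sigma>)"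
    by (intro relpowp_Suc_left relpowp_1I)
  then show ?case by (simp add: add.assoc numeral_2_eq_2)
next
  case (WhileT \<sigma> j c t \<sigma>' t' \<sigma>'')
  have c0: "code_at P pc [IBranch j 0 (pc + 2)]"
    and c1: "code_at P (pc + 2) (compile c (pc + 2))"
    and c2: "code_at P (pc + 2 + code_len c) [IJump pc]"
    using WhileT.prems(1) unfolding compile.simps code_at_append by (simp_all add: ac_simps)
  have "tm_step (machine k P) (cfg k pc \<sigma>) (cfg k (pc + 2) \<sigma>)"
    using machine_step_branch[of pc P j 0 _ k \<sigma>] code_at_single[OF c0] WhileT by simp
  moreover have "(tm_step (machine k P) ^^ t) (cfg k (pc + 2) \<sigma>) (cfg k (pc + 2 + code_len c) \<sigma>')"
    using WhileT.IH(1)[OF c1] WhileT.prems by simp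
  moreover have "tm_step (machine k P) (cfg k (pc + 2 + code_len c) \<sigma>') (cfg k pc \<sigma>')"
    using machine_step_jump code_at_single[OF c2] by blast
  moreover have "(tm_step (machine k P) ^^ t') (cfg k pc \<sigma>') (cfg k (pc + code_len (While j c)) \<sigma>'')"
    using WhileT.IH(2) WhileT.prems by simp
  ultimately have "(tm_step (machine k P) ^^ (Suc (t + Suc t'))) (cfg k pc \<sigma>)
      (cfg k (pc + code_len (While j c)) \<sigma>'')"
    by (intro relpowp_Suc_left relpowp_add_I)
  moreover have "Suc (t + Suc t') = t + t' + 2" by simp
  ultimately show ?case by metis
qed

text \<open>\<open>exec\<close> counts exactly; an upper bound can be rounded and lets both branches
  of a conditional share one estimate.\<close>

definition runs :: "com \<Rightarrow> store \<Rightarrow> nat \<Rightarrow> store \<Rightarrow> bool" where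
  "runs c \<sigma> b \<sigma>' \<longleftrightarrow> (\<exists>t \<le> b. exec c \<sigma> t \<sigma>')"

definition init_store :: "bool list \<Rightarrow> store" where
  "init_store x = (\<lambda>_. (contents [], 0))(0 := (contents x, 0))"

theorem poly_time_computableI:
  fixes p :: "nat poly"
  assumes k: "k \<ge> 1" and c: "uses_tapes k c"
    and runs: "\<And>x. \<exists>\<sigma>. runs c (init_store x) (poly p (length x)) \<sigma> \<and> fst (\<sigma> (k - 1)) = contents (f x)"
  shows "poly_time_computable f"
  unfolding poly_time_computable_def
proof (intro exI[of _ "machine k (compile c 0)"] exI[of _ p] conjI allI)
  let ?P = "compile c 0"
  let ?M = "machine k ?P"
  show "tm_wf ?M" "tm_deterministic ?M"
    using k by (auto simp: machine_wf machine_deterministic)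
  fix x
  obtain \<sigma> t where t: "t \<le> poly p (length x)" "exec c (init_store x) t \<sigma>"
    and out: "fst (\<sigma> (k - 1)) = contents (f x)"
    using runs[of x] by (auto simp: runs_def)
  have "code_at ?P 0 (compile c 0)" by (auto simp: code_at_def)
  then have "(tm_step ?M ^^ t) (cfg k 0 (init_store x)) (cfg k (length ?P) \<sigma>)"
    using compile_correct[OF t(2) _ c] by fastforce
  moreover have "cfg k 0 (init_store x) = tm_init ?M x"
  proof -
    obtain k' where k': "k = Suc k'" using k by (cases k) auto
    have "map (init_store x) [0..<k] = (contents x, 0) # replicate k' (contents [], 0)"
      by (rule nth_equalityI) (auto simp: k' init_store_def nth_Cons simp del: upt_Suc split: nat.split)
    then show ?thesis
      by (simp add: cfg_def tm_init_def machine_def k' del: upt_Suc)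
  qed
  \<comment> \<open>The compiled code ends in the state \<open>length ?P\<close>, for which there is
    no instruction.\<close>
  moreover have "tm_halted ?M (cfg k (length ?P) \<sigma>)"
    by (auto simp: tm_halted_def tm_step_def machine_def cfg_def)
  moreover have "last (map \<sigma> [0..<k]) = \<sigma> (k - 1)"
    using k by (simp add: last_map last_upt)
  ultimately show "\<exists>t c'. t \<le> poly p (length x) \<and> (tm_step ?M ^^ t) (tm_init ?M x) c' \<and>
      tm_halted ?M c' \<and> fst (last (snd c')) = contents (f x)"
    using t(1) out by (intro exI[of _ t] exI[of _ "cfg k (length ?P) \<sigma>"]) (auto simp: cfg_def)
qed

section \<open>Programs on list tapes\<close>

definition list_tape :: "nat list \<Rightarrow> int \<Rightarrow> nat" where
  "list_tape xs i = (if 0 \<le> i \<and> i < int (length xs) then xs ! nat i else 0)"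

abbreviation at_start :: "nat list \<Rightarrow> tape" where
  "at_start xs \<equiv> (list_tape xs, 0)"

abbreviation at_end :: "nat list \<Rightarrow> tape" where
  "at_end xs \<equiv> (list_tape xs, int (length xs))"

lemma list_tape_snoc: "(list_tape xs)(int (length xs) := s) = list_tape (xs @ [s])"
  by (rule ext) (auto simp: list_tape_def nth_append)

lemma list_tape_nth: "i < length xs \<Longrightarrow> list_tape xs (int i) = xs ! i"
  by (simp add: list_tape_def)

lemma contents_eq: "contents x = list_tape (map (\<lambda>b. if b then 2 else 1) x)"
  by (rule ext) (auto simp: contents_def list_tape_def)

lemma runs_weaken: "runs c \<sigma> b \<sigma>' \<Longrightarrow> b \<le> b' \<Longrightarrow> \<sigma>' = \<sigma>'' \<Longrightarrow> runs c \<sigma> b' \<sigma>''"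
  unfolding runs_def using order_trans by blast

lemma runs_Skip: "runs Skip \<sigma> 0 \<sigma>"
  by (auto simp: runs_def intro: exec.Skip)

lemma runs_Write: "runs (Write j s) \<sigma> 1 (\<sigma>(j := write_tape s (\<sigma> j)))"
  unfolding runs_def using exec.Write by blast

lemma runs_Move: "runs (Move j d) \<sigma> 1 (\<sigma>(j := move_tape d (\<sigma> j)))"
  unfolding runs_def using exec.Move by blast

lemma runs_Seq: "runs c \<sigma> a \<sigma>' \<Longrightarrow> runs d \<sigma>' b \<sigma>'' \<Longrightarrow> runs (c ;; d) \<sigma> (a + b) \<sigma>''"
  unfolding runs_def by (meson add_mono exec.Seq)

lemma runs_IfT: "read_tape (\<sigma> j) = s \<Longrightarrow> runs c \<sigma> b \<sigma>' \<Longrightarrow> runs (IfSym j s c d) \<sigma> (b + 2) \<sigma>'"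
  unfolding runs_def by (meson add_mono exec.IfT order_refl)

lemma runs_IfF: "read_tape (\<sigma> j) \<noteq> s \<Longrightarrow> runs d \<sigma> b \<sigma>' \<Longrightarrow> runs (IfSym j s c d) \<sigma> (b + 1) \<sigma>'"
  unfolding runs_def by (meson add_mono exec.IfF order_refl)

lemma runs_WhileF: "read_tape (\<sigma> j) = 0 \<Longrightarrow> runs (While j c) \<sigma> 2 \<sigma>"
  unfolding runs_def using exec.WhileF by blast

lemma runs_WhileT: "read_tape (\<sigma> j) \<noteq> 0 \<Longrightarrow> runs c \<sigma> a \<sigma>' \<Longrightarrow> runs (While j c) \<sigma>' b \<sigma>'' \<Longrightarrow>
    runs (While j c) \<sigma> (a + b + 2) \<sigma>''"
  unfolding runs_def by (meson add_mono exec.WhileT order_refl)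

text \<open>\<open>repeat\<close> and \<open>switch\<close> are unrolled in the program text, so
  their bodies may depend on the counter but the number of copies has to be independent of the
  input. Loops over the input use \<open>foreach\<close>.\<close>

primrec repeat :: "nat \<Rightarrow> (nat \<Rightarrow> com) \<Rightarrow> com" where
  "repeat 0 c = Skip"
| "repeat (Suc n) c = repeat n c ;; c n"

primrec switch :: "nat \<Rightarrow> nat \<Rightarrow> (nat \<Rightarrow> com) \<Rightarrow> com" where
  "switch j 0 f = Skip"
| "switch j (Suc n) f = IfSym j n (f n) (switch j n f)"

definition append_sym :: "nat \<Rightarrow> nat \<Rightarrow> com" where
  "append_sym j s = Write j s ;; Move j Right"

text \<open>The first move steps off the blank behind the list; the loop then stops at the blank at
  position -1. A blank inside the list would stop it early, which is why lists on tapes must not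
  contain 0.\<close>

definition rewind :: "nat \<Rightarrow> com" where
  "rewind j = Move j Left ;; While j (Move j Left) ;; Move j Right"

definition foreach :: "nat \<Rightarrow> com \<Rightarrow> com" where
  "foreach j c = While j (c ;; Move j Right) ;; rewind j"

lemma uses_tapes_repeat: "(\<And>i. i < n \<Longrightarrow> uses_tapes k (c i)) \<Longrightarrow> uses_tapes k (repeat n c)"
  by (induction n) auto

lemma uses_tapes_switch: "j < k \<Longrightarrow> (\<And>i. i < n \<Longrightarrow> uses_tapes k (f i)) \<Longrightarrow> uses_tapes k (switch j n f)"
  by (induction n) auto

lemma uses_tapes_macros [simp]:
  "uses_tapes k (append_sym j s) \<longleftrightarrow> j < k" "uses_tapes k (rewind j) \<longleftrightarrow> j < k"
  "uses_tapes k (foreach j c) \<longleftrightarrow> j < k \<and> uses_tapes k c"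
  by (auto simp: append_sym_def rewind_def foreach_def)

lemma runs_repeat:
  assumes "\<And>i. i < n \<Longrightarrow> runs (c i) (F i) b (F (Suc i))"
  shows "runs (repeat n c) (F 0) (n * b) (F n)"
  using assms
proof (induction n)
  case 0
  then show ?case by (simp add: runs_Skip)
next
  case (Suc n)
  then have "runs (repeat n c) (F 0) (n * b) (F n)" "runs (c n) (F n) b (F (Suc n))" by auto
  from runs_Seq[OF this] show ?case by (simp add: add.commute)
qed

lemma runs_switch:
  assumes "read_tape (\<sigma> j) < n" "runs (f (read_tape (\<sigma> j))) \<sigma> b \<sigma>'"
  shows "runs (switch j n f) \<sigma> (b + n + 1) \<sigma>'"
  using assms(1)
proof (induction n)
  case (Suc n)
  show ?case
  proof (cases "read_tape (\<sigma> j) = n")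
    case True
    then have f: "runs (f n) \<sigma> b \<sigma>'" using assms(2) by simp
    have "runs (switch j (Suc n) f) \<sigma> (b + 2) \<sigma>'"
      unfolding switch.simps by (rule runs_IfT[where \<sigma> = \<sigma>, OF True f])
    then show ?thesis by (rule runs_weaken) auto
  next
    case False
    then have "runs (switch j n f) \<sigma> (b + n + 1) \<sigma>'" using Suc by simp
    then have "runs (switch j (Suc n) f) \<sigma> (b + n + 1 + 1) \<sigma>'"
      unfolding switch.simps by (rule runs_IfF[where \<sigma> = \<sigma>, OF False])
    then show ?thesis by (rule runs_weaken) auto
  qed
qed simp

lemma runs_append_sym:
  assumes "\<sigma> j = at_end xs"
  shows "runs (append_sym j s) \<sigma> 2 (\<sigma>(j := at_end (xs @ [s])))"
proof -
  have "runs (append_sym j s) \<sigma> (1 + 1) (\<sigma>(j := move_tape Right (write_tape s (\<sigma> j))))"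
    unfolding append_sym_def
    by (rule runs_Seq[OF runs_Write], rule runs_weaken[OF runs_Move]) auto
  then show ?thesis by (rule runs_weaken) (auto simp: assms list_tape_snoc)
qed

lemma runs_scan_left:
  assumes "0 \<notin> set xs" "p \<le> length xs" "\<sigma> j = (list_tape xs, int p - 1)"
  shows "runs (While j (Move j Left)) \<sigma> (3 * p + 2) (\<sigma>(j := (list_tape xs, -1)))"
  using assms(2,3)
proof (induction p arbitrary: \<sigma>)
  case 0
  have "runs (While j (Move j Left)) \<sigma> 2 \<sigma>"
    by (rule runs_WhileF) (simp add: 0 list_tape_def)
  then show ?case by (rule runs_weaken) (auto simp: 0)
next
  case (Suc p)
  have "xs ! p \<noteq> 0" using assms(1) Suc.prems(1) nth_mem[of p xs] by (metis Suc_le_eq)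
  then have nz: "read_tape (\<sigma> j) \<noteq> 0" using Suc.prems by (simp add: list_tape_nth)
  let ?\<sigma> = "\<sigma>(j := (list_tape xs, int p - 1))"
  have "runs (Move j Left) \<sigma> 1 ?\<sigma>"
    by (rule runs_weaken[OF runs_Move]) (auto simp: Suc.prems)
  moreover have "runs (While j (Move j Left)) ?\<sigma> (3 * p + 2) (?\<sigma>(j := (list_tape xs, -1)))"
    by (rule Suc.IH) (use Suc.prems in auto)
  ultimately show ?case
    by (rule runs_weaken[OF runs_WhileT[where \<sigma> = \<sigma>, OF nz]]) auto
qed

lemma runs_rewind:
  assumes "0 \<notin> set xs" "p \<le> length xs" "\<sigma> j = (list_tape xs, int p)"
  shows "runs (rewind j) \<sigma> (3 * p + 4) (\<sigma>(j := at_start xs))"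
proof -
  let ?\<sigma> = "\<sigma>(j := (list_tape xs, int p - 1))"
  have "runs (Move j Left) \<sigma> 1 ?\<sigma>"
    by (rule runs_weaken[OF runs_Move]) (auto simp: assms)
  moreover have "runs (While j (Move j Left)) ?\<sigma> (3 * p + 2) (?\<sigma>(j := (list_tape xs, -1)))"
    by (rule runs_scan_left) (use assms in auto)
  moreover have "runs (Move j Right) (?\<sigma>(j := (list_tape xs, -1))) 1 (\<sigma>(j := at_start xs))"
    by (rule runs_weaken[OF runs_Move]) auto
  ultimately have "runs (rewind j) \<sigma> (1 + ((3 * p + 2) + 1)) (\<sigma>(j := at_start xs))"
    unfolding rewind_def by (metis runs_Seq)
  then show ?thesis by (rule runs_weaken) auto
qed

lemma runs_rewind_end:
  assumes "0 \<notin> set xs" "\<sigma> j = at_end xs"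
  shows "runs (rewind j) \<sigma> (3 * length xs + 4) (\<sigma>(j := at_start xs))"
  by (rule runs_rewind) (use assms in auto)

text \<open>\<open>F i\<close> is the store after \<open>i\<close> rounds with tape \<open>j\<close>
  rewound, so that invariants need not mention the moving head. Of the 6 extra steps per round, 3
  belong to the loop and 3 to the final rewinding.\<close>

lemma runs_foreach:
  assumes nz: "0 \<notin> set xs" and n: "length xs = n"
    and start: "\<And>i. i \<le> n \<Longrightarrow> F i j = at_start xs"
    and body: "\<And>i. i < n \<Longrightarrow> runs c ((F i)(j := (list_tape xs, int i))) b ((F (Suc i))(j := (list_tape xs, int i)))"
  shows "runs (foreach j c) (F 0) (n * (b + 6) + 6) (F n)"
proof -
  let ?P = "\<lambda>i. (F i)(j := (list_tape xs, int i))"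
  have loop: "runs (While j (c ;; Move j Right)) (?P (n - i)) (i * (b + 3) + 2) (?P n)" if "i \<le> n" for i
    using that
  proof (induction i)
    case 0
    show ?case
      by (rule runs_weaken[OF runs_WhileF]) (simp_all add: list_tape_def n)
  next
    case (Suc i)
    let ?k = "n - Suc i"
    have k: "?k < n" "Suc ?k = n - i" using Suc.prems by auto
    have "xs ! ?k \<noteq> 0" using nz k(1) n nth_mem[of ?k xs] by metis
    then have r: "read_tape (?P ?k j) \<noteq> 0"
      using list_tape_nth[of ?k xs] k n by (simp only: fun_upd_same read_tape.simps not_False_eq_True)
    have "runs (c ;; Move j Right) (?P ?k) (b + 1) (?P (n - i))"
      by (rule runs_Seq[OF body[OF k(1)]], rule runs_weaken[OF runs_Move])
        (use k in auto)
    moreover have "runs (While j (c ;; Move j Right)) (?P (n - i)) (i * (b + 3) + 2) (?P n)"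
      by (rule Suc.IH) (use Suc.prems in simp)
    ultimately show ?case
      by (rule runs_weaken[OF runs_WhileT[where \<sigma> = "?P ?k", OF r]]) auto
  qed
  have "(F 0)(j := (list_tape xs, int 0)) = F 0" using start[of 0] by (simp add: fun_upd_idem)
  then have 1: "runs (While j (c ;; Move j Right)) (F 0) (n * (b + 3) + 2) (?P n)"
    using loop[of n] by simp
  have "(?P n)(j := at_start xs) = F n" using start[of n] by (simp add: fun_upd_idem)
  then have 2: "runs (rewind j) (?P n) (3 * n + 4) (F n)"
    using runs_rewind[OF nz, of n "?P n" j] n by simp
  have "runs (foreach j c) (F 0) ((n * (b + 3) + 2) + (3 * n + 4)) (F n)"
    unfolding foreach_def by (rule runs_Seq[OF 1 2])
  then show ?thesis by (rule runs_weaken) (auto simp: algebra_simps)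
qed

abbreviation unary :: "nat \<Rightarrow> nat list" where
  "unary n \<equiv> replicate n 1"

lemma unary_snoc: "unary n @ [1] = unary (Suc n)"
  by (simp add: replicate_append_same)

section \<open>Powers in unary\<close>

text \<open>
  The reduction uses tape 0 for the input, 1 for the cell classes, 2 for their number in unary, 3
  for the ruler, 4 for the number of ordinary rows in unary, \<open>5 + i\<close> for the power
  \<open>(n + c) ^ i\<close> in unary, and the last tape for the output.
\<close>

definition multiply :: "nat \<Rightarrow> nat \<Rightarrow> nat \<Rightarrow> com" where
  "multiply c j j' = foreach j (foreach 0 (append_sym j' 1) ;; repeat c (\<lambda>_. append_sym j' 1)) ;; rewind j'"

lemma runs_multiply:
  assumes xs: "0 \<notin> set xs" "length xs = n" "\<sigma> 0 = at_start xs"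
    and j: "\<sigma> j = at_start (unary a)" "\<sigma> j' = at_end []" "j \<noteq> j'" "j \<noteq> 0" "j' \<noteq> 0"
  shows "runs (multiply c j j') \<sigma> (a * (n * 8 + 6 + c * 2 + 6) + 6 + (3 * (a * (n + c)) + 4))
    (\<sigma>(j' := at_start (unary (a * (n + c)))))"
proof -
  define F where "F i = \<sigma>(j' := at_end (unary (i * (n + c))))" for i
  have body: "runs (foreach 0 (append_sym j' 1) ;; repeat c (\<lambda>_. append_sym j' 1))
      ((F i)(j := (list_tape (unary a), int i))) ((n * 8 + 6) + c * 2)
      ((F (Suc i))(j := (list_tape (unary a), int i)))" if "i < a" for i
  proof -
    define H where "H k = \<sigma>(j' := at_end (unary (i * (n + c) + k)), j := (list_tape (unary a), int i))" for k
    have app: "runs (append_sym j' 1) \<tau> 2 (\<tau>(j' := at_end (unary (Suc k))))"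
      if "\<tau> j' = at_end (unary k)" for \<tau> k
      using runs_append_sym[where \<sigma> = \<tau> and j = j' and xs = "unary k" and s = 1, OF that]
      unfolding unary_snoc .
    have "runs (foreach 0 (append_sym j' 1)) (H 0) (n * (2 + 6) + 6) (H n)"
    proof (rule runs_foreach[OF xs(1,2)])
      show "H k 0 = at_start xs" for k using xs j by (simp add: H_def)
      show "runs (append_sym j' 1) ((H k)(0 := (list_tape xs, int k))) 2
          ((H (Suc k))(0 := (list_tape xs, int k)))" for k
        by (rule runs_weaken[OF app[of _ "i * (n + c) + k"]]) (use j in \<open>auto simp: H_def fun_eq_iff\<close>)
    qed
    moreover have "runs (repeat c (\<lambda>_. append_sym j' 1)) (H (n + 0)) (c * 2) (H (n + c))"
    proof (rule runs_repeat)
      fix k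
      show "runs (append_sym j' 1) (H (n + k)) 2 (H (n + Suc k))"
        by (rule runs_weaken[OF app[of _ "i * (n + c) + (n + k)"]]) (use j in \<open>auto simp: H_def fun_eq_iff\<close>)
    qed
    ultimately have "runs (foreach 0 (append_sym j' 1) ;; repeat c (\<lambda>_. append_sym j' 1)) (H 0)
        ((n * (2 + 6) + 6) + c * 2) (H (n + c))"
      unfolding add_0_right by (rule runs_Seq)
    moreover have "H 0 = (F i)(j := (list_tape (unary a), int i))"
      "H (n + c) = (F (Suc i))(j := (list_tape (unary a), int i))"
      by (simp_all add: H_def F_def ac_simps)
    ultimately show ?thesis by (simp only: numeral_plus_numeral add_num_simps)
  qed
  have "runs (foreach j (foreach 0 (append_sym j' 1) ;; repeat c (\<lambda>_. append_sym j' 1))) (F 0)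
      (a * (((n * 8 + 6) + c * 2) + 6) + 6) (F a)"
    by (rule runs_foreach[OF _ _ _ body]) (use j in \<open>auto simp: F_def\<close>)
  moreover have "F 0 = \<sigma>" using j by (auto simp: F_def)
  moreover have "runs (rewind j') (F a) (3 * length (unary (a * (n + c))) + 4)
      ((F a)(j' := at_start (unary (a * (n + c)))))"
    by (rule runs_rewind_end) (auto simp: F_def)
  ultimately have "runs (multiply c j j') \<sigma>
      ((a * (((n * 8 + 6) + c * 2) + 6) + 6) + (3 * length (unary (a * (n + c))) + 4))
      ((F a)(j' := at_start (unary (a * (n + c)))))"
    unfolding multiply_def by (metis runs_Seq)
  then show ?thesis by (rule runs_weaken) (auto simp: F_def)
qed

text \<open>Powers of \<open>n + c\<close> are the only bounds that have to be computed: by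
  \<open>poly_less_power\<close> one of them dominates any given polynomial.\<close>

primrec power_prog :: "nat \<Rightarrow> nat \<Rightarrow> com" where
  "power_prog c 0 = append_sym 5 1 ;; rewind 5"
| "power_prog c (Suc d) = power_prog c d ;; multiply c (5 + d) (6 + d)"

primrec power_time :: "nat \<Rightarrow> nat \<Rightarrow> nat \<Rightarrow> nat" where
  "power_time c 0 n = 9"
| "power_time c (Suc d) n = power_time c d n +
    ((n + c) ^ d * (n * 8 + 6 + c * 2 + 6) + 6 + (3 * ((n + c) ^ d * (n + c)) + 4))"

lemma runs_power_prog:
  assumes xs: "0 \<notin> set xs" "length xs = n"
  shows "\<exists>\<sigma>. runs (power_prog c d) ((\<lambda>_. at_start [])(0 := at_start xs)) (power_time c d n) \<sigma> \<and>
    \<sigma> (5 + d) = at_start (unary ((n + c) ^ d)) \<and> \<sigma> 0 = at_start xs \<and>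
    (\<forall>j. 0 < j \<and> j < 5 \<or> 5 + d < j \<longrightarrow> \<sigma> j = at_start [])"
proof (induction d)
  case 0
  let ?\<sigma> = "(\<lambda>_. at_start [])(0 := at_start xs)"
  have "runs (append_sym 5 1) ?\<sigma> 2 (?\<sigma>(5 := at_end ([] @ [1])))"
    by (rule runs_append_sym) simp
  moreover have "runs (rewind 5) (?\<sigma>(5 := at_end ([] @ [1]))) (3 * length [1 :: nat] + 4)
      (?\<sigma>(5 := at_end ([] @ [1]), 5 := at_start [1]))"
    by (rule runs_rewind_end) auto
  ultimately have "runs (power_prog c 0) ?\<sigma> (2 + (3 * length [1 :: nat] + 4))
      (?\<sigma>(5 := at_end ([] @ [1]), 5 := at_start [1]))"
    unfolding power_prog.simps by (rule runs_Seq)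
  moreover define \<tau> :: store where "\<tau> = ?\<sigma>(5 := at_end ([] @ [1]), 5 := at_start [1])"
  ultimately have "runs (power_prog c 0) ?\<sigma> (power_time c 0 n) \<tau>"
    by (auto intro: runs_weaken)
  moreover have "\<tau> (5 + 0) = at_start (unary ((n + c) ^ 0))" "\<tau> 0 = at_start xs"
    "\<forall>j. 0 < j \<and> j < 5 \<or> 5 + 0 < j \<longrightarrow> \<tau> j = at_start []"
    by (auto simp: \<tau>_def)
  ultimately show ?case by blast
next
  case (Suc d)
  then obtain \<sigma> where \<sigma>: "runs (power_prog c d) ((\<lambda>_. at_start [])(0 := at_start xs)) (power_time c d n) \<sigma>"
    "\<sigma> (5 + d) = at_start (unary ((n + c) ^ d))" "\<sigma> 0 = at_start xs"
    "\<And>j. 0 < j \<and> j < 5 \<or> 5 + d < j \<Longrightarrow> \<sigma> j = at_start []" by blast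
  have "runs (multiply c (5 + d) (6 + d)) \<sigma>
      ((n + c) ^ d * (n * 8 + 6 + c * 2 + 6) + 6 + (3 * ((n + c) ^ d * (n + c)) + 4))
      (\<sigma>(6 + d := at_start (unary ((n + c) ^ d * (n + c)))))"
    by (rule runs_multiply[OF xs \<sigma>(3,2)]) (simp_all add: \<sigma>(4))
  moreover define \<tau> :: store where "\<tau> = \<sigma>(6 + d := at_start (unary ((n + c) ^ d * (n + c))))"
  ultimately have "runs (power_prog c (Suc d)) ((\<lambda>_. at_start [])(0 := at_start xs))
      (power_time c (Suc d) n) \<tau>"
    unfolding power_prog.simps power_time.simps using runs_Seq[OF \<sigma>(1)] by blast
  moreover have "\<tau> (5 + Suc d) = at_start (unary ((n + c) ^ Suc d))" "\<tau> 0 = at_start xs"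
    "\<forall>j. 0 < j \<and> j < 5 \<or> 5 + Suc d < j \<longrightarrow> \<tau> j = at_start []"
    using \<sigma> by (auto simp: \<tau>_def mult.commute)
  ultimately show ?case by blast
qed

lemma uses_tapes_power_prog: "6 + d \<le> k \<Longrightarrow> uses_tapes k (power_prog c d)"
  by (induction d) (auto simp: multiply_def intro!: uses_tapes_repeat)

section \<open>Writing the cell classes and the ruler\<close>

definition move_by :: "move \<Rightarrow> nat \<Rightarrow> int" where
  "move_by d n = (case d of Left \<Rightarrow> - int n | Stay \<Rightarrow> 0 | Right \<Rightarrow> int n)"

lemma runs_Move_3:
  "runs (Move 3 d) (\<sigma>(3 := (w, p))) 1 (\<sigma>(3 := (w, p + move_by d 1)))"
  by (rule runs_weaken[OF runs_Move]) (cases d; auto simp: move_by_def)+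

lemma runs_Write_3:
  "runs (Write 3 s) (\<sigma>(3 := (w, p))) 1 (\<sigma>(3 := (w(p := s), p)))"
  by (rule runs_weaken[OF runs_Write]) auto

lemma runs_foreach_Move_3:
  assumes "\<sigma> j = at_start xs" "0 \<notin> set xs" "j \<noteq> 3" "length xs = n"
  shows "runs (foreach j (Move 3 d)) (\<sigma>(3 := (w, p))) (n * 7 + 6) (\<sigma>(3 := (w, p + move_by d n)))"
proof -
  have "runs (foreach j (Move 3 d)) (\<sigma>(3 := (w, p + move_by d 0))) (n * (1 + 6) + 6)
      (\<sigma>(3 := (w, p + move_by d n)))"
  proof (rule runs_foreach[OF assms(2,4)])
    show "(\<sigma>(3 := (w, p + move_by d i))) j = at_start xs" for i using assms by simp
    show "runs (Move 3 d) ((\<sigma>(3 := (w, p + move_by d i)))(j := (list_tape xs, int i))) 1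
        ((\<sigma>(3 := (w, p + move_by d (Suc i))))(j := (list_tape xs, int i)))" for i
      by (rule runs_weaken[OF runs_Move])
        (use assms(3) in \<open>cases d; auto simp: move_by_def fun_eq_iff\<close>)+
  qed
  then show ?thesis by (cases d) (simp_all add: move_by_def)
qed

locale tape_layout =
  fixes U :: nat and N :: nat
  assumes U: "U \<ge> 5"
begin

definition append_class :: "nat \<Rightarrow> com" where
  "append_class s = append_sym 1 s ;; append_sym 2 1"

definition append_plain_row :: "nat \<Rightarrow> com" where
  "append_plain_row s = append_class 1 ;; append_class s ;;
    foreach U (append_class s) ;; foreach U (append_class s)"

text \<open>The loop over the rows runs on tape 4, a second copy of \<open>N\<close>, because its
  body already loops over tape \<open>U\<close>. Reading tape 0 beyond the input yields blanks,
  which pads the first row.\<close>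

definition classes_prog :: com where
  "classes_prog = append_class 1 ;; foreach U (append_class 4) ;;
    (switch 0 3 (\<lambda>a. append_class (7 + a)) ;; Move 0 Right) ;;
    foreach U (switch 0 3 (\<lambda>a. append_class (4 + a)) ;; Move 0 Right) ;;
    foreach 4 (append_plain_row 2) ;; append_plain_row 3 ;; rewind 1 ;; rewind 2"

definition classes_store :: "store \<Rightarrow> nat list \<Rightarrow> nat list \<Rightarrow> int \<Rightarrow> store" where
  "classes_store \<sigma> xs ys p = \<sigma>(1 := at_end ys, 2 := at_end (unary (length ys)), 0 := (list_tape xs, p))"

lemma runs_append_class:
  "runs (append_class s) (classes_store \<sigma> xs ys p) 4 (classes_store \<sigma> xs (ys @ [s]) p)"
proof -
  let ?\<sigma> = "classes_store \<sigma> xs ys p"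
  have "runs (append_sym 1 s) ?\<sigma> 2 (?\<sigma>(1 := at_end (ys @ [s])))"
    by (rule runs_append_sym) (simp add: classes_store_def)
  moreover have "runs (append_sym 2 1) (?\<sigma>(1 := at_end (ys @ [s]))) 2
      (?\<sigma>(1 := at_end (ys @ [s]), 2 := at_end (unary (length ys) @ [1])))"
    by (rule runs_append_sym) (simp add: classes_store_def)
  ultimately have "runs (append_class s) ?\<sigma> (2 + 2)
      (?\<sigma>(1 := at_end (ys @ [s]), 2 := at_end (unary (length ys) @ [1])))"
    unfolding append_class_def by (rule runs_Seq)
  then show ?thesis
    by (rule runs_weaken) (auto simp: classes_store_def fun_eq_iff replicate_append_same)
qed

lemma runs_append_class':
  "j \<notin> {0, 1, 2} \<Longrightarrow>
    runs (append_class s) ((classes_store \<sigma> xs ys p)(j := t)) 4 ((classes_store \<sigma> xs (ys @ [s]) p)(j := t))"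
  using runs_append_class[of s "\<sigma>(j := t)" xs ys p] by (simp add: classes_store_def fun_upd_twist)

lemma runs_append_classes:
  assumes "\<sigma> U = at_start (unary N)"
  shows "runs (foreach U (append_class s)) (classes_store \<sigma> xs ys p) (N * 10 + 6)
    (classes_store \<sigma> xs (ys @ replicate N s) p)"
proof -
  have "runs (foreach U (append_class s)) (classes_store \<sigma> xs (ys @ replicate 0 s) p) (N * (4 + 6) + 6)
      (classes_store \<sigma> xs (ys @ replicate N s) p)"
  proof (rule runs_foreach[where xs = "unary N"])
    show "classes_store \<sigma> xs (ys @ replicate i s) p U = at_start (unary N)" for i
      using U assms by (simp add: classes_store_def)
    show "runs (append_class s)
        ((classes_store \<sigma> xs (ys @ replicate i s) p)(U := (list_tape (unary N), int i))) 4
        ((classes_store \<sigma> xs (ys @ replicate (Suc i) s) p)(U := (list_tape (unary N), int i)))" for i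
    proof -
      have eq: "ys @ replicate (Suc i) s = (ys @ replicate i s) @ [s]"
        by (simp add: replicate_append_same)
      show ?thesis unfolding eq by (rule runs_append_class') (use U in auto)
    qed
  qed auto
  then show ?thesis by simp
qed

lemma runs_append_plain_row:
  assumes "\<sigma> U = at_start (unary N)"
  shows "runs (append_plain_row s) (classes_store \<sigma> xs ys p) (N * 20 + 20)
    (classes_store \<sigma> xs (ys @ plain_row N s) p)"
proof -
  have "runs (append_plain_row s) (classes_store \<sigma> xs ys p) (4 + (4 + ((N * 10 + 6) + (N * 10 + 6))))
      (classes_store \<sigma> xs ((((ys @ [1]) @ [s]) @ replicate N s) @ replicate N s) p)"
    unfolding append_plain_row_def
    by (rule runs_Seq[OF runs_append_class runs_Seq[OF runs_append_class
      runs_Seq[OF runs_append_classes[of \<sigma>, OF assms] runs_append_classes[of \<sigma>, OF assms]]]])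
  then show ?thesis
    by (rule runs_weaken) (simp_all add: plain_row_def mult_2 replicate_add)
qed

lemma runs_append_switch:
  assumes "list_tape xs (int p) = a" "a < 3" "j \<notin> {0, 1, 2}"
  shows "runs (switch 0 3 (\<lambda>a. append_class (b + a)) ;; Move 0 Right)
    ((classes_store \<sigma> xs ys (int p))(j := t)) 9
    ((classes_store \<sigma> xs (ys @ [b + a]) (int (Suc p)))(j := t))"
proof -
  have "runs (switch 0 3 (\<lambda>a. append_class (b + a))) ((classes_store \<sigma> xs ys (int p))(j := t))
      (4 + 3 + 1) ((classes_store \<sigma> xs (ys @ [b + a]) (int p))(j := t))"
  proof (rule runs_switch)
    have r: "read_tape (((classes_store \<sigma> xs ys (int p))(j := t)) 0) = a"
      using assms by (auto simp: classes_store_def)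
    show "read_tape (((classes_store \<sigma> xs ys (int p))(j := t)) 0) < 3" using r assms by simp
    show "runs (append_class (b + read_tape (((classes_store \<sigma> xs ys (int p))(j := t)) 0)))
        ((classes_store \<sigma> xs ys (int p))(j := t)) 4
        ((classes_store \<sigma> xs (ys @ [b + a]) (int p))(j := t))"
      unfolding r by (rule runs_append_class'[OF assms(3)])
  qed
  moreover have "runs (Move 0 Right) ((classes_store \<sigma> xs (ys @ [b + a]) (int p))(j := t)) 1
      ((classes_store \<sigma> xs (ys @ [b + a]) (int (Suc p)))(j := t))"
    by (rule runs_weaken[OF runs_Move]) (use assms(3) in \<open>auto simp: classes_store_def fun_eq_iff\<close>)
  ultimately show ?thesis using runs_Seq by fastforce
qed

lemma contents_less: "contents x i < 3"
  by (simp add: contents_def)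

lemma zero_notin_classes: "0 \<notin> set (cell_classes N x)"
  by (auto simp: cell_classes_def first_row_def plain_row_def)

lemma runs_classes_prog:
  assumes \<sigma>: "\<sigma> U = at_start (unary N)" "\<sigma> 4 = at_start (unary N)" "U \<noteq> 4"
    and x: "list_tape xs = contents x"
  shows "runs classes_prog (classes_store \<sigma> xs [] 0)
      (60 + N * 50 + N * (N * 20 + 26) + 6 * length (cell_classes N x))
      (\<sigma>(1 := at_start (cell_classes N x), 2 := at_start (unary (length (cell_classes N x))),
        0 := (list_tape xs, int (Suc N))))"
proof -
  define r0 where "r0 = [1] @ replicate N 4 @ [7 + contents x 0]"
  define r1 where "r1 i = map (\<lambda>i. 4 + contents x (int (Suc i))) [0..<i]" for i
  have first: "first_row N x = r0 @ r1 N" by (simp add: first_row_def r0_def r1_def)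
  have U': "U \<notin> {0, 1, 2}" using U by auto
  have 1: "runs (append_class 1) (classes_store \<sigma> xs [] 0) 4 (classes_store \<sigma> xs ([] @ [1]) 0)"
    by (rule runs_append_class)
  have 2: "runs (foreach U (append_class 4)) (classes_store \<sigma> xs ([] @ [1]) 0) (N * 10 + 6)
      (classes_store \<sigma> xs (([] @ [1]) @ replicate N 4) 0)"
    by (rule runs_append_classes[of \<sigma>, OF \<sigma>(1)])
  have 3: "runs (switch 0 3 (\<lambda>a. append_class (7 + a)) ;; Move 0 Right)
      (classes_store \<sigma> xs (([] @ [1]) @ replicate N 4) 0) 9 (classes_store \<sigma> xs r0 (int (Suc 0)))"
  proof -
    \<comment> \<open>Tape 4 stands in for the loop tape of \<open>runs_append_switch\<close> and is
      replaced by itself.\<close>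
    have "4 \<notin> {0, 1, 2 :: nat}" by simp
    from runs_append_switch[where xs = xs and p = 0, OF _ contents_less this, of x 0 7 \<sigma> "[1] @ replicate N 4" "at_start (unary N)"]
    show ?thesis using \<sigma>(2) by (simp add: x r0_def classes_store_def fun_upd_idem)
  qed
  have "runs (foreach U (switch 0 3 (\<lambda>a. append_class (4 + a)) ;; Move 0 Right))
      (classes_store \<sigma> xs (r0 @ r1 0) (int (Suc 0))) (N * (9 + 6) + 6)
      (classes_store \<sigma> xs (r0 @ r1 N) (int (Suc N)))"
  proof (rule runs_foreach[where xs = "unary N"])
    show "classes_store \<sigma> xs (r0 @ r1 i) (int (Suc i)) U = at_start (unary N)" for i
      using U \<sigma> by (simp add: classes_store_def)
    show "runs (switch 0 3 (\<lambda>a. append_class (4 + a)) ;; Move 0 Right)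
        ((classes_store \<sigma> xs (r0 @ r1 i) (int (Suc i)))(U := (list_tape (unary N), int i))) 9
        ((classes_store \<sigma> xs (r0 @ r1 (Suc i)) (int (Suc (Suc i))))(U := (list_tape (unary N), int i)))" for i
      using runs_append_switch[where xs = xs and p = "Suc i", OF _ contents_less U', of x "int (Suc i)" 4 \<sigma> "r0 @ r1 i"
          "(list_tape (unary N), int i)"]
      by (simp add: x r1_def)
  qed auto
  then have 4: "runs (foreach U (switch 0 3 (\<lambda>a. append_class (4 + a)) ;; Move 0 Right))
      (classes_store \<sigma> xs r0 (int (Suc 0))) (N * 15 + 6)
      (classes_store \<sigma> xs (first_row N x) (int (Suc N)))"
    by (simp add: first r1_def)
  define rows where "rows i = first_row N x @ concat (replicate i (plain_row N 2))" for i
  have rows_Suc: "rows (Suc i) = rows i @ plain_row N 2" for i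
    unfolding rows_def by (simp flip: replicate_append_same)
  have "runs (foreach 4 (append_plain_row 2)) (classes_store \<sigma> xs (rows 0) (int (Suc N)))
      (N * ((N * 20 + 20) + 6) + 6) (classes_store \<sigma> xs (rows N) (int (Suc N)))"
  proof (rule runs_foreach[where xs = "unary N"])
    show "classes_store \<sigma> xs (rows i) (int (Suc N)) 4 = at_start (unary N)" for i
      using \<sigma> by (simp add: classes_store_def)
    show "runs (append_plain_row 2)
        ((classes_store \<sigma> xs (rows i) (int (Suc N)))(4 := (list_tape (unary N), int i))) (N * 20 + 20)
        ((classes_store \<sigma> xs (rows (Suc i)) (int (Suc N)))(4 := (list_tape (unary N), int i)))" for i
      using runs_append_plain_row[of "\<sigma>(4 := (list_tape (unary N), int i))" 2 xs "rows i" "int (Suc N)"] \<sigma>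
      by (simp add: rows_Suc classes_store_def fun_upd_twist)
  qed auto
  then have 5: "runs (foreach 4 (append_plain_row 2)) (classes_store \<sigma> xs (first_row N x) (int (Suc N)))
      (N * (N * 20 + 26) + 6) (classes_store \<sigma> xs (rows N) (int (Suc N)))"
    by (simp add: rows_def add.assoc)
  have 6: "runs (append_plain_row 3) (classes_store \<sigma> xs (rows N) (int (Suc N))) (N * 20 + 20)
      (classes_store \<sigma> xs (cell_classes N x) (int (Suc N)))"
    using runs_append_plain_row[of \<sigma> 3 xs "rows N" "int (Suc N)", OF \<sigma>(1)]
    by (simp add: rows_def cell_classes_def)
  let ?L = "length (cell_classes N x)"
  let ?\<tau> = "classes_store \<sigma> xs (cell_classes N x) (int (Suc N))"
  have 7: "runs (rewind 1) ?\<tau> (3 * ?L + 4) (?\<tau>(1 := at_start (cell_classes N x)))"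
    by (rule runs_rewind_end[OF zero_notin_classes]) (simp add: classes_store_def)
  have 8: "runs (rewind 2) (?\<tau>(1 := at_start (cell_classes N x))) (3 * length (unary ?L) + 4)
      (?\<tau>(1 := at_start (cell_classes N x), 2 := at_start (unary ?L)))"
    by (rule runs_rewind_end) (auto simp: classes_store_def)
  have "runs classes_prog (classes_store \<sigma> xs [] 0)
      (4 + ((N * 10 + 6) + (9 + ((N * 15 + 6) + ((N * (N * 20 + 26) + 6) + ((N * 20 + 20) +
        ((3 * ?L + 4) + (3 * length (unary ?L) + 4))))))))
      (?\<tau>(1 := at_start (cell_classes N x), 2 := at_start (unary ?L)))"
    unfolding classes_prog_def by (rule runs_Seq[OF 1 runs_Seq[OF 2 runs_Seq[OF 3 runs_Seq[OF 4
      runs_Seq[OF 5 runs_Seq[OF 6 runs_Seq[OF 7 8]]]]]]])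
  then show ?thesis
    by (rule runs_weaken) (auto simp: classes_store_def fun_eq_iff)
qed

lemma uses_tapes_append_class [simp]: "uses_tapes k (append_class s) \<longleftrightarrow> 2 < k"
  by (auto simp: append_class_def)

lemma uses_tapes_classes_prog: "U < k \<Longrightarrow> uses_tapes k classes_prog"
  using U by (auto simp: classes_prog_def append_plain_row_def intro!: uses_tapes_switch)

text \<open>The shift is by \<open>2 * N + 1\<close>, the distance between the marks at 1 and at
  \<open>W = 2 * N + 2\<close>.\<close>

definition shift_prog :: "move \<Rightarrow> com" where
  "shift_prog d = Move 3 d ;; foreach U (Move 3 d) ;; foreach U (Move 3 d)"

definition ruler_prog :: com where
  "ruler_prog = Write 3 1 ;; Move 3 Right ;; Write 3 2 ;; shift_prog Right ;; Write 3 4 ;;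
    shift_prog Left ;; Move 3 Left ;; Move 3 Left ;; Write 3 3 ;; shift_prog Left ;; Write 3 5 ;;
    shift_prog Right ;; Move 3 Right"

lemma runs_shift_prog:
  assumes "\<sigma> U = at_start (unary N)"
  shows "runs (shift_prog d) (\<sigma>(3 := (w, p))) (N * 14 + 13) (\<sigma>(3 := (w, p + move_by d (2 * N + 1))))"
proof -
  have "U \<noteq> 3" using U by simp
  then have loop: "runs (foreach U (Move 3 d)) (\<sigma>(3 := (w, p))) (N * 7 + 6)
      (\<sigma>(3 := (w, p + move_by d N)))" for w p
    by (intro runs_foreach_Move_3[where xs = "unary N"]) (use assms in auto)
  have "runs (shift_prog d) (\<sigma>(3 := (w, p))) (1 + ((N * 7 + 6) + (N * 7 + 6)))
      (\<sigma>(3 := (w, p + move_by d 1 + move_by d N + move_by d N)))"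
    unfolding shift_prog_def
    by (rule runs_Seq[OF runs_Move_3 runs_Seq[OF loop loop]])
  then show ?thesis
    by (rule runs_weaken) (cases d; simp add: move_by_def algebra_simps)+
qed

lemma runs_ruler_prog:
  assumes "\<sigma> U = at_start (unary N)"
  shows "runs ruler_prog (\<sigma>(3 := at_start [])) (N * 56 + 61) (\<sigma>(3 := (ruler (2 * N + 2), 0)))"
proof -
  let ?n = "2 * N + 1"
  let ?p1 = "0 + move_by Right 1"
  let ?p2 = "?p1 + move_by Right ?n"
  let ?p3 = "?p2 + move_by Left ?n + move_by Left 1 + move_by Left 1"
  let ?p4 = "?p3 + move_by Left ?n"
  note shift = runs_shift_prog[of \<sigma>, OF assms]
  have "runs ruler_prog (\<sigma>(3 := at_start []))
     (1 + (1 + (1 + ((N * 14 + 13) + (1 + ((N * 14 + 13) + (1 + (1 + (1 + ((N * 14 + 13) +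
        (1 + ((N * 14 + 13) + 1))))))))))))
     (\<sigma>(3 := ((list_tape [])(0 := 1, ?p1 := 2, ?p2 := 4, ?p3 := 3, ?p4 := 5),
       ?p4 + move_by Right ?n + move_by Right 1)))"
    unfolding ruler_prog_def
    by (rule runs_Seq[OF runs_Write_3 runs_Seq[OF runs_Move_3 runs_Seq[OF runs_Write_3
      runs_Seq[OF shift runs_Seq[OF runs_Write_3 runs_Seq[OF shift runs_Seq[OF runs_Move_3
      runs_Seq[OF runs_Move_3 runs_Seq[OF runs_Write_3 runs_Seq[OF shift runs_Seq[OF runs_Write_3
      runs_Seq[OF shift runs_Move_3]]]]]]]]]]]])
  moreover have "(list_tape [])(0 := 1, ?p1 := 2, ?p2 := 4, ?p3 := 3, ?p4 := 5) = ruler (2 * N + 2)"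
    by (rule ext) (auto simp: ruler_def move_by_def list_tape_def)
  ultimately show ?thesis
    by (intro runs_weaken[where \<sigma>'' = "\<sigma>(3 := (ruler (2 * N + 2), 0))"])
      (auto simp: move_by_def algebra_simps)
qed

lemma uses_tapes_ruler_prog: "U < k \<Longrightarrow> uses_tapes k ruler_prog"
  using U by (simp add: ruler_prog_def shift_prog_def)

end

section \<open>Writing the adjacency matrix\<close>

definition arc_sym :: "nat \<Rightarrow> (nat \<Rightarrow> (nat \<Rightarrow> bool) \<Rightarrow> bool) \<Rightarrow> nat \<Rightarrow> nat \<Rightarrow> nat \<Rightarrow> nat \<Rightarrow> nat" where
  "arc_sym m ok c r k k' = (if cell_arc m ok c r k k' then 2 else 1)"

text \<open>An entry of the matrix depends on the class of its row cell, the ruler mark and the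
  offsets \<open>k\<close> and \<open>k'\<close>. The offsets are known at compile time; the 10
  classes and 6 marks are distinguished by \<open>switch\<close>.\<close>

definition emit_block :: "nat \<Rightarrow> nat \<Rightarrow> (nat \<Rightarrow> (nat \<Rightarrow> bool) \<Rightarrow> bool) \<Rightarrow> nat \<Rightarrow> com" where
  "emit_block out m ok k = repeat (cell_size m)
    (\<lambda>k'. switch 1 10 (\<lambda>c. switch 3 6 (\<lambda>r. append_sym out (arc_sym m ok c r k k'))))"

text \<open>While tape 1 is at cell \<open>s\<close> and tape 2 at cell \<open>s'\<close>, the ruler
  head is at \<open>s' - s\<close>: it moves right with \<open>s'\<close>, returns after each row of
  the matrix, and moves one place left when \<open>s\<close> advances.\<close>

definition matrix_prog :: "nat \<Rightarrow> nat \<Rightarrow> (nat \<Rightarrow> (nat \<Rightarrow> bool) \<Rightarrow> bool) \<Rightarrow> com" where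
  "matrix_prog out m ok = foreach 1 (repeat (cell_size m)
    (\<lambda>k. foreach 2 (emit_block out m ok k ;; Move 3 Right) ;; foreach 2 (Move 3 Left)) ;; Move 3 Left)"

lemma uses_tapes_matrix_prog: "out < k \<Longrightarrow> 3 < out \<Longrightarrow> uses_tapes k (matrix_prog out m ok)"
  by (auto simp: matrix_prog_def emit_block_def intro!: uses_tapes_repeat uses_tapes_switch)

lemma ruler_less: "ruler W i < 6"
  by (simp add: ruler_def)

lemma runs_emit_block:
  assumes "out \<notin> {1, 2, 3}" "\<sigma> 1 = (w, p)" "w p = c" "c < 10" "\<sigma> 3 = (ruler W, i)" "\<sigma> out = at_end zs"
  shows "runs (emit_block out m ok k) \<sigma> (cell_size m * 20)
    (\<sigma>(out := at_end (zs @ map (arc_sym m ok c (ruler W i) k) [0..<cell_size m])))"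
proof -
  define F where "F n = \<sigma>(out := at_end (zs @ map (arc_sym m ok c (ruler W i) k) [0..<n]))" for n
  have "runs (emit_block out m ok k) (F 0) (cell_size m * 20) (F (cell_size m))"
    unfolding emit_block_def
  proof (rule runs_repeat)
    fix n
    have r: "read_tape (F n 1) = c" "read_tape (F n 3) = ruler W i"
      using assms by (auto simp: F_def)
    have 1: "runs (append_sym out (arc_sym m ok c (ruler W i) k n)) (F n) 2 (F (Suc n))"
      by (rule runs_weaken[OF runs_append_sym]) (auto simp: F_def)
    have 2: "runs (switch 3 6 (\<lambda>r. append_sym out (arc_sym m ok c r k n))) (F n) (2 + 6 + 1) (F (Suc n))"
    proof (rule runs_switch)
      show "read_tape (F n 3) < 6" unfolding r by (rule ruler_less)
      show "runs (append_sym out (arc_sym m ok c (read_tape (F n 3)) k n)) (F n) 2 (F (Suc n))"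
        unfolding r by (rule 1)
    qed
    have "runs (switch 1 10 (\<lambda>c. switch 3 6 (\<lambda>r. append_sym out (arc_sym m ok c r k n)))) (F n)
        ((2 + 6 + 1) + 10 + 1) (F (Suc n))"
    proof (rule runs_switch)
      show "read_tape (F n 1) < 10" unfolding r by (rule assms(4))
      show "runs (switch 3 6 (\<lambda>r. append_sym out (arc_sym m ok (read_tape (F n 1)) r k n))) (F n)
          (2 + 6 + 1) (F (Suc n))"
        unfolding r by (rule 2)
    qed
    then show "runs (switch 1 10 (\<lambda>c. switch 3 6 (\<lambda>r. append_sym out (arc_sym m ok c r k n)))) (F n)
        20 (F (Suc n))" by (rule runs_weaken) simp_all
  qed
  moreover have "F 0 = \<sigma>" using assms by (auto simp: F_def)
  ultimately show ?thesis by (simp add: F_def)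
qed

text \<open>The last argument of this function and of the next two truncates the output after
  \<open>n\<close> rounds of the respective loop, which makes them loop invariants.\<close>

definition row_syms :: "nat \<Rightarrow> (nat \<Rightarrow> (nat \<Rightarrow> bool) \<Rightarrow> bool) \<Rightarrow> nat \<Rightarrow> nat list \<Rightarrow> nat \<Rightarrow> nat \<Rightarrow> nat \<Rightarrow> nat list" where
  "row_syms m ok W cs s k n = concat (map (\<lambda>s'. map (arc_sym m ok (cs ! s) (ruler W (int s' - int s)) k)
    [0..<cell_size m]) [0..<n])"

definition cell_syms :: "nat \<Rightarrow> (nat \<Rightarrow> (nat \<Rightarrow> bool) \<Rightarrow> bool) \<Rightarrow> nat \<Rightarrow> nat list \<Rightarrow> nat \<Rightarrow> nat \<Rightarrow> nat list" where
  "cell_syms m ok W cs s n = concat (map (\<lambda>k. row_syms m ok W cs s k (length cs)) [0..<n])"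

definition matrix_syms :: "nat \<Rightarrow> (nat \<Rightarrow> (nat \<Rightarrow> bool) \<Rightarrow> bool) \<Rightarrow> nat \<Rightarrow> nat list \<Rightarrow> nat \<Rightarrow> nat list" where
  "matrix_syms m ok W cs n = concat (map (\<lambda>s. cell_syms m ok W cs s (cell_size m)) [0..<n])"

lemma runs_matrix_prog:
  assumes out: "out \<notin> {1, 2, 3}" and cs: "0 \<notin> set cs" "set cs \<subseteq> {..<10}" "length cs = S"
    and \<sigma>: "\<sigma> 1 = at_start cs" "\<sigma> 2 = at_start (unary S)" "\<sigma> 3 = (ruler W, 0)" "\<sigma> out = at_end []"
  shows "\<exists>p. runs (matrix_prog out m ok) \<sigma>
    (S * (cell_size m * ((S * (cell_size m * 20 + 1 + 6) + 6) + (S * 7 + 6)) + 1 + 6) + 6)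
    (\<sigma>(3 := (ruler W, p), out := at_end (matrix_syms m ok W cs S)))"
proof -
  let ?K = "cell_size m"
  define F where "F s = \<sigma>(3 := (ruler W, - int s), out := at_end (matrix_syms m ok W cs s))" for s
  have body: "runs (repeat ?K (\<lambda>k. foreach 2 (emit_block out m ok k ;; Move 3 Right) ;; foreach 2 (Move 3 Left)) ;;
      Move 3 Left) ((F s)(1 := (list_tape cs, int s)))
      (?K * ((S * (?K * 20 + 1 + 6) + 6) + (S * 7 + 6)) + 1)
      ((F (Suc s))(1 := (list_tape cs, int s)))" if s: "s < S" for s
  proof -
    define \<tau> where "\<tau> = \<sigma>(1 := (list_tape cs, int s))"
    define H where "H k = \<tau>(3 := (ruler W, - int s),
      out := at_end (matrix_syms m ok W cs s @ cell_syms m ok W cs s k))" for k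
    have row: "runs (foreach 2 (emit_block out m ok k ;; Move 3 Right) ;; foreach 2 (Move 3 Left)) (H k)
        ((S * (?K * 20 + 1 + 6) + 6) + (S * 7 + 6)) (H (Suc k))" for k
    proof -
      define zs where "zs = matrix_syms m ok W cs s @ cell_syms m ok W cs s k"
      define I where "I n = \<tau>(3 := (ruler W, int n - int s), out := at_end (zs @ row_syms m ok W cs s k n))" for n
      have I_Suc: "zs @ row_syms m ok W cs s k (Suc n) = (zs @ row_syms m ok W cs s k n) @
          map (arc_sym m ok (cs ! s) (ruler W (int n - int s)) k) [0..<?K]" for n
        by (simp add: row_syms_def)
      have 1: "runs (foreach 2 (emit_block out m ok k ;; Move 3 Right)) (I 0) (S * (?K * 20 + 1 + 6) + 6) (I S)"
      proof (rule runs_foreach[where xs = "unary S"])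
        show "I n 2 = at_start (unary S)" for n using out \<sigma> by (auto simp: I_def \<tau>_def)
        fix n
        let ?I = "(I n)(2 := (list_tape (unary S), int n))"
        have "cs ! s < 10" using cs s nth_mem by blast
        then have "runs (emit_block out m ok k) ?I (?K * 20)
            (?I(out := at_end ((zs @ row_syms m ok W cs s k n) @
              map (arc_sym m ok (cs ! s) (ruler W (int n - int s)) k) [0..<?K])))"
          using out s cs(3)
          by (intro runs_emit_block[where w = "list_tape cs" and p = "int s"])
            (auto simp: I_def \<tau>_def list_tape_nth)
        moreover have "runs (Move 3 Right) (?I(out := at_end ((zs @ row_syms m ok W cs s k n) @
              map (arc_sym m ok (cs ! s) (ruler W (int n - int s)) k) [0..<?K]))) 1
            ((I (Suc n))(2 := (list_tape (unary S), int n)))"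
          unfolding I_Suc[symmetric]
          by (rule runs_weaken[OF runs_Move]) (use out in \<open>auto simp: I_def fun_eq_iff\<close>)
        ultimately show "runs (emit_block out m ok k ;; Move 3 Right) ?I (?K * 20 + 1)
            ((I (Suc n))(2 := (list_tape (unary S), int n)))"
          by (rule runs_Seq)
      qed auto
      define \<tau>' where "\<tau>' = \<tau>(out := at_end (zs @ row_syms m ok W cs s k S))"
      have 2: "runs (foreach 2 (Move 3 Left)) (\<tau>'(3 := (ruler W, int S - int s))) (S * 7 + 6)
          (\<tau>'(3 := (ruler W, int S - int s + move_by Left S)))"
        by (rule runs_foreach_Move_3[where xs = "unary S"]) (use out \<sigma> in \<open>auto simp: \<tau>'_def \<tau>_def\<close>)
      have I_0: "I 0 = H k" and I_S: "I S = \<tau>'(3 := (ruler W, int S - int s))"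
        and H_Suc: "\<tau>'(3 := (ruler W, int S - int s + move_by Left S)) = H (Suc k)"
        using out cs(3) by (auto simp: I_def H_def \<tau>'_def zs_def row_syms_def cell_syms_def fun_eq_iff
            move_by_def)
      show ?thesis using runs_Seq[OF 1[unfolded I_0 I_S] 2[unfolded H_Suc]] .
    qed
    have 1: "runs (repeat ?K (\<lambda>k. foreach 2 (emit_block out m ok k ;; Move 3 Right) ;; foreach 2 (Move 3 Left)))
        (H 0) (?K * ((S * (?K * 20 + 1 + 6) + 6) + (S * 7 + 6))) (H ?K)"
      by (rule runs_repeat) (rule row)
    have 2: "runs (Move 3 Left) (H ?K) 1 ((F (Suc s))(1 := (list_tape cs, int s)))"
      by (rule runs_weaken[OF runs_Move])
        (use out in \<open>auto simp: H_def F_def \<tau>_def matrix_syms_def fun_eq_iff\<close>)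
    have "H 0 = (F s)(1 := (list_tape cs, int s))"
      using out by (auto simp: H_def F_def \<tau>_def cell_syms_def fun_eq_iff)
    then show ?thesis using runs_Seq[OF 1 2] by simp
  qed
  have "runs (matrix_prog out m ok) (F 0)
      (S * ((?K * ((S * (?K * 20 + 1 + 6) + 6) + (S * 7 + 6)) + 1) + 6) + 6) (F S)"
    unfolding matrix_prog_def
    by (rule runs_foreach[OF cs(1,3) _ body]) (use out \<sigma> in \<open>auto simp: F_def\<close>)
  moreover have "F 0 = \<sigma>" using \<sigma> by (auto simp: F_def matrix_syms_def fun_eq_iff)
  ultimately show ?thesis by (auto simp: F_def)
qed

section \<open>The output as an adjacency string\<close>

lemma upt_Suc_mult: "[0..<Suc n * k] = [0..<n * k] @ map (\<lambda>i. n * k + i) [0..<k]"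
proof -
  have 1: "Suc n * k = n * k + k" by simp
  have 2: "[0..<n * k + k] = [0..<n * k] @ [n * k..<n * k + k]"
    by (rule upt_add_eq_append) simp
  have 3: "map (\<lambda>i. n * k + i) [0..<k] = [n * k..<n * k + k]"
    using map_add_upt[of "n * k" k] by (simp only: add.commute)
  show ?thesis unfolding 1 2 3 ..
qed

lemma map_upt_mult:
  "map g [0..<n * k] = concat (map (\<lambda>s. map (\<lambda>i. g (s * k + i)) [0..<k]) [0..<n])"
proof (induction n)
  case (Suc n)
  then show ?case unfolding upt_Suc_mult by simp
qed simp

lemma concat_map_upt_mult:
  "concat (map f [0..<n * k]) = concat (map (\<lambda>s. concat (map (\<lambda>i. f (s * k + i)) [0..<k])) [0..<n])"
proof (induction n)
  case (Suc n)
  then show ?case unfolding upt_Suc_mult by (simp add: comp_def)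
qed simp

text \<open>\<open>List.product\<close> lists the entries row by row. Splitting both vertices into
  cell and offset turns the two ranges into the four nested loops of the program.\<close>

lemma matrix_syms_eq_adjacency:
  assumes m: "m \<ge> 1"
  shows "matrix_syms m ok W cs (length cs) =
    map (\<lambda>b. if b then 2 else 1) (adjacency_string (grid_digraph m ok W cs))"
proof -
  let ?K = "cell_size m"
  let ?G = "grid_digraph m ok W cs"
  let ?n = "length cs * ?K"
  have K: "0 < ?K" using m by (simp add: cell_size_def path_len_def)
  have n: "card (pverts ?G) = ?n" by (simp add: grid_digraph_def Let_def)
  define e :: "nat \<Rightarrow> nat \<Rightarrow> nat" where "e = (\<lambda>v w. if (v, w) \<in> parcs ?G then 2 else 1)"
  have e: "e (s * ?K + k) (s' * ?K + k') = arc_sym m ok (cs ! s) (ruler W (int s' - int s)) k k'"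
    if "s < length cs" "s' < length cs" "k < ?K" "k' < ?K" for s s' k k'
  proof -
    have lt: "t * ?K + j < ?n" if "t < length cs" "j < ?K" for t j
    proof -
      have "t * ?K + j < Suc t * ?K" using that by simp
      also have "\<dots> \<le> ?n" using that by (intro mult_le_mono1) simp
      finally show ?thesis .
    qed
    show ?thesis
      using that lt K by (simp add: e_def arc_sym_def grid_digraph_def Let_def)
  qed
  have "map (\<lambda>b. if b then 2 else 1) (adjacency_string ?G) =
      concat (map (\<lambda>v. map (e v) [0..<?n]) [0..<?n])"
    by (simp add: adjacency_string_def Let_def n product_concat_map map_concat comp_def e_def)
  also have "\<dots> = concat (map (\<lambda>s. concat (map (\<lambda>k. concat (map (\<lambda>s'. map (\<lambda>k'. e (s * ?K + k) (s' * ?K + k'))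
      [0..<?K]) [0..<length cs])) [0..<?K])) [0..<length cs])"
    unfolding concat_map_upt_mult[of _ "length cs" ?K] by (simp only: map_upt_mult)
  also have "\<dots> = matrix_syms m ok W cs (length cs)"
    unfolding matrix_syms_def cell_syms_def row_syms_def
    by (intro arg_cong[where f = concat] map_cong refl) (auto simp: e)
  finally show ?thesis by simp
qed

section \<open>Tilings as consistent assignments\<close>

instance move :: countable
  by countable_datatype

text \<open>
  Bit 0 of every code \<open>2 * to_nat h\<close> is 0, so it serves as the reference colour; complementing
  all bits of a cell by \<open>e\<close> accounts for the symmetry between the two colours.
\<close>

definition tile_bits :: "tm \<Rightarrow> nat \<Rightarrow> nat \<Rightarrow> (nat \<Rightarrow> bool) \<Rightarrow> bool" where
  "tile_bits M m c y \<longleftrightarrow> (\<exists>e l r d u. tile M c l r d u \<and> (\<forall>i < m.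
    y i = (bit (2 * to_nat l) i \<noteq> e) \<and> y (m + i) = (bit (2 * to_nat r) i \<noteq> e) \<and>
    y (2 * m + i) = (bit (2 * to_nat d) i \<noteq> e) \<and> y (3 * m + i) = (bit (2 * to_nat u) i \<noteq> e)))"

definition code_bound :: "tm \<Rightarrow> nat \<Rightarrow> bool" where
  "code_bound M m \<longleftrightarrow> m \<ge> 1 \<and> (\<forall>h \<in> hmsgs M. 2 * to_nat h < 2 ^ m) \<and> (\<forall>v \<in> vmsgs M. 2 * to_nat v < 2 ^ m)"

lemma code_bound_exists: "\<exists>m. code_bound M m"
proof -
  have "finite ((\<lambda>h. 2 * to_nat h) ` hmsgs M \<union> (\<lambda>v. 2 * to_nat v) ` vmsgs M)"
    using finite_hmsgs finite_vmsgs by blast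
  then obtain b where b: "\<forall>a \<in> (\<lambda>h. 2 * to_nat h) ` hmsgs M \<union> (\<lambda>v. 2 * to_nat v) ` vmsgs M. a < b"
    using finite_nat_set_iff_bounded by blast
  have "b < 2 ^ Suc b" by (metis less_exp lessI order.strict_trans power_strict_increasing_iff one_less_numeral_iff semiring_norm(76))
  then have lt: "a < 2 ^ Suc b" if "a < b" for a using that by linarith
  have "2 * to_nat h < b" if "h \<in> hmsgs M" for h using b that by blast
  moreover have "2 * to_nat v < b" if "v \<in> vmsgs M" for v using b that by blast
  ultimately have "code_bound M (Suc b)"
    unfolding code_bound_def using lt by (metis One_nat_def Suc_le_mono zero_le)
  then show ?thesis by blast
qed

lemma nat_eq_if_bits_eq:
  fixes a b :: nat
  assumes "a < 2 ^ m" "b < 2 ^ m" "\<And>i. i < m \<Longrightarrow> bit a i = bit b i"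
  shows "a = b"
proof -
  have "take_bit m a = take_bit m b"
    by (rule bit_eqI) (auto simp: bit_take_bit_iff assms(3))
  then show ?thesis using assms(1,2) by (simp add: take_bit_nat_eq_self)
qed

lemma grid_tile_bits:
  assumes "code_bound M m"
  shows "grid m (tile_bits M m) (2 * N + 2) (cell_classes N x)"
proof
  show "m \<ge> 1" using assms by (simp add: code_bound_def)
  show "2 * N + 2 \<ge> 2" "cell_classes N x \<noteq> []" by (simp_all add: cell_classes_def first_row_def)
  show "tile_bits M m c z" if "\<And>b. b < 4 * m \<Longrightarrow> y b = z b" "tile_bits M m c y" for c y z
  proof -
    have eq: "y i = z i" "y (m + i) = z (m + i)" "y (2 * m + i) = z (2 * m + i)"
      "y (3 * m + i) = z (3 * m + i)" if "i < m" for i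
      using that \<open>\<And>b. b < 4 * m \<Longrightarrow> y b = z b\<close> by auto
    show ?thesis
      using that(2) unfolding tile_bits_def by (simp add: eq)
  qed
  show "tile_bits M m c (\<lambda>b. \<not> y b)" if "tile_bits M m c y" for c y
  proof -
    from that obtain e l r d u where "tile M c l r d u" "\<forall>i < m.
      y i = (bit (2 * to_nat l) i \<noteq> e) \<and> y (m + i) = (bit (2 * to_nat r) i \<noteq> e) \<and>
      y (2 * m + i) = (bit (2 * to_nat d) i \<noteq> e) \<and> y (3 * m + i) = (bit (2 * to_nat u) i \<noteq> e)"
      unfolding tile_bits_def by blast
    then show ?thesis
      unfolding tile_bits_def by (intro exI[of _ "\<not> e"] exI[of _ l] exI[of _ r] exI[of _ d] exI[of _ u]) simp
  qed
  show "\<not> tile_bits M m c (bit (1 :: nat))" for c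
  proof
    assume "tile_bits M m c (bit (1 :: nat))"
    then obtain e l r where *: "\<forall>i < m. bit (1 :: nat) i = (bit (2 * to_nat (l :: hmsg)) i \<noteq> e) \<and>
        bit (1 :: nat) (m + i) = (bit (2 * to_nat (r :: hmsg)) i \<noteq> e)"
      unfolding tile_bits_def by blast
    have m: "0 < m" using assms by (simp add: code_bound_def)
    \<comment> \<open>Bits 0 and \<open>m\<close> are the reference bits of the left and the right
      side. They must agree, but in the assignment 1 they differ.\<close>
    have "bit (1 :: nat) 0 = e" "bit (1 :: nat) m = e"
      using *[rule_format, OF m] by (simp_all add: bit_0)
    then show False using m by (simp add: bit_1_iff del: One_nat_def)
  qed
qed

lemma consistent_if_tiling:
  assumes "code_bound M m" "is_tiling M N x E V"
  shows "\<exists>y. grid.consistent m (tile_bits M m) (2 * N + 2) (cell_classes N x) y"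
proof -
  interpret grid m "tile_bits M m" "2 * N + 2" "cell_classes N x"
    by (rule grid_tile_bits[OF assms(1)])
  let ?W = "2 * N + 2"
  define y where "y s b = (if b < m then bit (2 * to_nat (E s)) b
    else if b < 2 * m then bit (2 * to_nat (E (s + 1))) (b - m)
    else if b < 3 * m then bit (2 * to_nat (V s)) (b - 2 * m)
    else bit (2 * to_nat (V (s + ?W))) (b - 3 * m))" for s b
  have "tile_bits M m (cell_classes N x ! s) (y s)" if "s < length (cell_classes N x)" for s
  proof -
    have "tile M (cell_classes N x ! s) (E s) (E (s + 1)) (V s) (V (s + ?W))"
      using assms(2) that unfolding is_tiling_def length_cell_classes by blast
    then show ?thesis
      unfolding tile_bits_def
      by (intro exI[of _ False] exI[of _ "E s"] exI[of _ "E (s + 1)"] exI[of _ "V s"] exI[of _ "V (s + ?W)"])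
        (auto simp: y_def)
  qed
  moreover have "y s (m + i) = y (s + 1) i" "y s (3 * m + i) = y (s + ?W) (2 * m + i)" if "i < m" for s i
    using that by (auto simp: y_def)
  ultimately show ?thesis unfolding consistent_def by blast
qed

lemma tiling_if_consistent:
  assumes bound: "code_bound M m"
    and y: "grid.consistent m (tile_bits M m) (2 * N + 2) (cell_classes N x) y"
  shows "\<exists>E V. is_tiling M N x E V"
proof -
  interpret grid m "tile_bits M m" "2 * N + 2" "cell_classes N x"
    by (rule grid_tile_bits[OF bound])
  let ?W = "2 * N + 2"
  have m0: "0 < m" using bound by (simp add: code_bound_def)
  have y_ok: "tile_bits M m (cell_classes N x ! s) (y s)" if "s < S" for s
    using y that unfolding consistent_def by blast
  have y_right: "y s (m + i) = y (s + 1) i" if "s + 1 < S" "i < m" for s i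
    using y that unfolding consistent_def by blast
  have y_up: "y s (3 * m + i) = y (s + ?W) (2 * m + i)" if "s + ?W < S" "i < m" for s i
    using y that unfolding consistent_def by blast
  have "\<forall>s. \<exists>e l r d u. s < S \<longrightarrow> tile M (cell_classes N x ! s) l r d u \<and> (\<forall>i < m.
      y s i = (bit (2 * to_nat l) i \<noteq> e) \<and> y s (m + i) = (bit (2 * to_nat r) i \<noteq> e) \<and>
      y s (2 * m + i) = (bit (2 * to_nat d) i \<noteq> e) \<and> y s (3 * m + i) = (bit (2 * to_nat u) i \<noteq> e))"
    using y_ok unfolding tile_bits_def by blast
  then obtain e l r d u where all: "\<forall>s < S. tile M (cell_classes N x ! s) (l s) (r s) (d s) (u s) \<and> (\<forall>i < m.
      y s i = (bit (2 * to_nat (l s)) i \<noteq> e s) \<and> y s (m + i) = (bit (2 * to_nat (r s)) i \<noteq> e s) \<and>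
      y s (2 * m + i) = (bit (2 * to_nat (d s)) i \<noteq> e s) \<and> y s (3 * m + i) = (bit (2 * to_nat (u s)) i \<noteq> e s))"
    unfolding choice_iff by blast
  have t: "tile M (cell_classes N x ! s) (l s) (r s) (d s) (u s)" if "s < S" for s
    using all that by blast
  have b: "y s i = (bit (2 * to_nat (l s)) i \<noteq> e s)" "y s (m + i) = (bit (2 * to_nat (r s)) i \<noteq> e s)"
    "y s (2 * m + i) = (bit (2 * to_nat (d s)) i \<noteq> e s)" "y s (3 * m + i) = (bit (2 * to_nat (u s)) i \<noteq> e s)"
    if "s < S" "i < m" for s i
    using all that by blast+
  \<comment> \<open>Bit 0 of a common side is the \<open>e\<close> of both adjacent cells, and
    consecutive cells are adjacent even across the end of a row. So all cells are complemented or
    none is.\<close>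
  have e: "e s = e 0" if "s < S" for s
    using that
  proof (induction s)
    case (Suc s)
    then have "y s (m + 0) = y (s + 1) 0" using y_right[of s 0] m0 by simp
    then have "e s = e (Suc s)" using b(2)[of s 0] b(1)[of "Suc s" 0] Suc.prems m0 by (simp add: bit_0)
    then show ?case using Suc by simp
  qed simp
  have codes: "2 * to_nat (l s) < 2 ^ m" "2 * to_nat (r s) < 2 ^ m" "2 * to_nat (d s) < 2 ^ m"
    "2 * to_nat (u s) < 2 ^ m" if "s < S" for s
    using t[OF that] bound by (auto simp: tile_def code_bound_def)
  have right: "r s = l (s + 1)" if s: "s + 1 < S" for s
  proof -
    have "bit (2 * to_nat (r s)) i = bit (2 * to_nat (l (s + 1))) i" if "i < m" for i
      using y_right[OF s that] b(2)[of s i] b(1)[of "s + 1" i] e[of s] e[of "s + 1"] s that by auto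
    then have "2 * to_nat (r s) = 2 * to_nat (l (s + 1))"
      using codes[of s] codes[of "s + 1"] s by (intro nat_eq_if_bits_eq[of _ m]) auto
    then show ?thesis by simp
  qed
  have up: "u s = d (s + ?W)" if s: "s + ?W < S" for s
  proof -
    have s': "s < S" using s by linarith
    have "bit (2 * to_nat (u s)) i = bit (2 * to_nat (d (s + ?W))) i" if "i < m" for i
      using y_up[OF s that] b(4)[OF s' that] b(3)[OF s that] e[OF s'] e[OF s] by argo
    then have "2 * to_nat (u s) = 2 * to_nat (d (s + ?W))"
      by (rule nat_eq_if_bits_eq[OF codes(4)[OF s'] codes(3)[OF s]])
    then show ?thesis by simp
  qed
  \<comment> \<open>A side is read from the cell before it wherever there is one. This also covers
    the sides behind the last cell and above the last row.\<close>
  define E where "E s = (if s = 0 then l 0 else r (s - 1))" for s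
  define V where "V s = (if s < ?W then d s else u (s - ?W))" for s
  have "is_tiling M N x E V"
    unfolding is_tiling_def
  proof (intro allI impI)
    fix s assume "s < (N + 2) * ?W"
    then have s: "s < S" by (simp add: length_cell_classes)
    have "E s = l s" using right[of "s - 1"] s by (cases s) (simp_all add: E_def)
    moreover have "E (s + 1) = r s" by (simp add: E_def)
    moreover have "V s = d s"
    proof (cases "s < ?W")
      case False
      then have "s - ?W + ?W = s" by simp
      then show ?thesis using up[of "s - ?W"] s False unfolding V_def by metis
    qed (simp add: V_def)
    moreover have "V (s + ?W) = u s" by (simp add: V_def)
    ultimately show "tile M (cell_classes N x ! s) (E s) (E (s + 1)) (V s) (V (s + ?W))"
      using t[OF s] by simp
  qed
  then show ?thesis by blast
qed

theorem grid_digraph_correct: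
  assumes wf: "tm_wf M" and bound: "\<And>c t. (tm_step M ^^ t) (tm_init M x) c \<Longrightarrow> t < N"
    and code: "code_bound M m"
  shows "colorable 2 (with_proj (grid_digraph m (tile_bits M m) (2 * N + 2) (cell_classes N x))) \<longleftrightarrow>
    (\<exists>c. (tm_step M)\<^sup>*\<^sup>* (tm_init M x) c \<and> tm_halted M c \<and> fst c = 1)"
proof -
  interpret grid m "tile_bits M m" "2 * N + 2" "cell_classes N x"
    by (rule grid_tile_bits[OF code])
  have "colorable 2 (with_proj G) \<longleftrightarrow> (\<exists>y. consistent y)"
    using colorable_if_consistent consistent_if_colorable by blast
  also have "\<dots> \<longleftrightarrow> (\<exists>E V. is_tiling M N x E V)"
    using consistent_if_tiling[OF code] tiling_if_consistent[OF code] by blast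
  also have "\<dots> \<longleftrightarrow> (\<exists>c. (tm_step M)\<^sup>*\<^sup>* (tm_init M x) c \<and> tm_halted M c \<and> fst c = 1)"
  proof
    assume "\<exists>E V. is_tiling M N x E V"
    then show "\<exists>c. (tm_step M)\<^sup>*\<^sup>* (tm_init M x) c \<and> tm_halted M c \<and> fst c = 1"
      using tiling_sound[OF wf] by blast
  next
    assume "\<exists>c. (tm_step M)\<^sup>*\<^sup>* (tm_init M x) c \<and> tm_halted M c \<and> fst c = 1"
    then obtain c where "(tm_step M)\<^sup>*\<^sup>* (tm_init M x) c" "tm_halted M c" "fst c = 1" by blast
    then show "\<exists>E V. is_tiling M N x E V"
      by (rule tiling_complete[OF wf, of x N c, rotated 1]) (rule bound)
  qed
  finally show ?thesis .
qed

section \<open>The reduction in polynomial time\<close>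

definition poly_fun :: "(nat \<Rightarrow> nat) \<Rightarrow> bool" where
  "poly_fun f \<longleftrightarrow> (\<exists>p. \<forall>n. f n = poly p n)"

lemma poly_fun_const: "poly_fun (\<lambda>_. c)"
  unfolding poly_fun_def by (rule exI[of _ "[:c:]"]) simp

lemma poly_fun_id: "poly_fun (\<lambda>n. n)"
  unfolding poly_fun_def by (rule exI[of _ "[:0, 1:]"]) simp

lemma poly_fun_add: "poly_fun f \<Longrightarrow> poly_fun g \<Longrightarrow> poly_fun (\<lambda>n. f n + g n)"
  unfolding poly_fun_def by (metis poly_add)

lemma poly_fun_mult: "poly_fun f \<Longrightarrow> poly_fun g \<Longrightarrow> poly_fun (\<lambda>n. f n * g n)"
  unfolding poly_fun_def by (metis poly_mult)

lemma poly_fun_power: "poly_fun f \<Longrightarrow> poly_fun (\<lambda>n. f n ^ d)"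
  unfolding poly_fun_def by (metis poly_power)

lemmas poly_fun_intros = poly_fun_const poly_fun_id poly_fun_add poly_fun_mult poly_fun_power

lemma poly_fun_power_time: "poly_fun (power_time c d)"
proof (induction d)
  case 0
  then show ?case using poly_fun_const[of 9] by (simp add: poly_fun_def)
next
  case (Suc d)
  have "poly_fun (\<lambda>n. power_time c d n +
      ((n + c) ^ d * (n * 8 + 6 + c * 2 + 6) + 6 + (3 * ((n + c) ^ d * (n + c)) + 4)))"
    by (intro poly_fun_intros Suc)
  then show ?case by (simp add: poly_fun_def)
qed

text \<open>For the polynomial \<open>a + n * q(n)\<close> put \<open>Y = (n + (a + c)) ^ d\<close>.
  The value is at most \<open>a * Y + n * Y\<close>, and the summand \<open>c * Y\<close> of the
  next power, positive because \<open>c \<ge> 1\<close>, makes the inequality strict.\<close>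

lemma poly_less_power: "\<exists>c d. c \<ge> 1 \<and> (\<forall>n. poly p n < (n + c) ^ d)" for p :: "nat poly"
proof (induction p)
  case 0
  show ?case by (rule exI[of _ 1]) (auto intro: exI[of _ 0])
next
  case (pCons a p)
  then obtain c d where c: "c \<ge> 1" "\<And>n. poly p n < (n + c) ^ d" by blast
  have "poly (pCons a p) n < (n + (a + c)) ^ Suc d" for n
  proof -
    let ?Y = "(n + (a + c)) ^ d"
    have "(n + c) ^ d \<le> ?Y" by (rule power_mono) auto
    then have le: "poly p n \<le> ?Y" using c(2)[of n] by linarith
    have Y: "?Y \<ge> 1" using c(1) by simp
    have "poly (pCons a p) n \<le> a * ?Y + n * ?Y"
      using le Y by (auto intro!: add_mono mult_le_mono2)
    also have "\<dots> < a * ?Y + n * ?Y + c * ?Y" using c(1) Y by simp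
    also have "\<dots> = (n + (a + c)) ^ Suc d" by (simp add: algebra_simps)
    finally show ?thesis .
  qed
  then show ?case using c(1) by (intro exI[of _ "a + c"] exI[of _ "Suc d"]) auto
qed

lemma set_cell_classes: "set (cell_classes N x) \<subseteq> {..<10}"
proof -
  have "contents x i < 3" for i by (simp add: contents_def)
  then have "7 + contents x i < 10" "4 + contents x i < 10" for i
    by (simp_all add: less_diff_conv add.commute numeral_eq_Suc less_Suc_eq)
  then show ?thesis by (auto simp: cell_classes_def first_row_def plain_row_def split: if_splits)
qed

section \<open>The complete program of the reduction\<close>

theorem poly_time_grid:
  assumes m: "m \<ge> 1"
  shows "poly_time_computable (\<lambda>x. adjacency_string
    (grid_digraph m ok (2 * (length x + c) ^ d + 2) (cell_classes ((length x + c) ^ d) x)))"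
proof -
  define size where "size N = (N + 2) * (2 * N + 2)" for N :: nat
  define time where "time n = (let N = (n + c) ^ d; S = size N; K = cell_size m in
    power_time c d n + (((N * 8 + 6) + (3 * N + 4)) +
    ((60 + N * 50 + N * (N * 20 + 26) + 6 * S) + ((N * 56 + 61) +
    (S * (K * ((S * (K * 20 + 1 + 6) + 6) + (S * 7 + 6)) + 1 + 6) + 6)))))" for n
  have "poly_fun time"
    unfolding time_def size_def Let_def by (intro poly_fun_intros poly_fun_power_time)
  then obtain p where p: "\<And>n. time n = poly p n" unfolding poly_fun_def by blast
  define U where "U = 5 + d"
  \<comment> \<open>\<open>U\<close> is fixed while \<open>N\<close> varies with the input: the
    programs mention only the tape on which \<open>N\<close> is found.\<close>
  interpret tape_layout U N for N by unfold_locales (simp add: U_def)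
  define prog where "prog = power_prog c d ;; (foreach U (append_sym 4 1) ;; rewind 4) ;;
    classes_prog ;; ruler_prog ;; matrix_prog (6 + d) m ok"
  show ?thesis
  proof (rule poly_time_computableI[where k = "7 + d" and c = prog and p = p])
    show "7 + d \<ge> 1" by simp
    show "uses_tapes (7 + d) prog"
      unfolding prog_def
      using uses_tapes_power_prog[of d "7 + d" c] uses_tapes_classes_prog[of "7 + d"]
        uses_tapes_ruler_prog[of "7 + d"] uses_tapes_matrix_prog[of "6 + d" "7 + d"]
      by (simp add: U_def)
    fix x :: "bool list"
    define xs :: "nat list" where "xs = map (\<lambda>b. if b then 2 else 1) x"
    define n where "n = length x"
    define N where "N = (n + c) ^ d"
    define cs where "cs = cell_classes N x"
    have xs: "0 \<notin> set xs" "length xs = n" by (auto simp: xs_def n_def)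
    have x: "list_tape xs = contents x" by (simp add: contents_eq xs_def)
    have "init_store x = (\<lambda>_. at_start [])(0 := at_start xs)"
      by (simp add: init_store_def contents_eq xs_def)
    then obtain \<sigma>1 where s1: "runs (power_prog c d) (init_store x) (power_time c d n) \<sigma>1"
      "\<sigma>1 U = at_start (unary N)" "\<sigma>1 0 = at_start xs"
      "\<And>j. 0 < j \<and> j < 5 \<or> U < j \<Longrightarrow> \<sigma>1 j = at_start []"
      using runs_power_prog[OF xs, of c d] unfolding U_def N_def by metis
    have U4: "U \<noteq> 4" "U \<noteq> 1" "U \<noteq> 2" "U \<noteq> 3" "U \<noteq> 0" by (auto simp: U_def)
    define \<sigma>2 where "\<sigma>2 = \<sigma>1(4 := at_start (unary N))"
    have s2: "runs (foreach U (append_sym 4 1) ;; rewind 4) \<sigma>1 ((N * 8 + 6) + (3 * N + 4)) \<sigma>2"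
    proof -
      define F where "F i = \<sigma>1(4 := at_end (unary i))" for i
      have "runs (foreach U (append_sym 4 1)) (F 0) (N * (2 + 6) + 6) (F N)"
      proof (rule runs_foreach[where xs = "unary N"])
        show "F i U = at_start (unary N)" for i using s1(2) U4 by (simp add: F_def)
        show "runs (append_sym 4 1) ((F i)(U := (list_tape (unary N), int i))) 2
            ((F (Suc i))(U := (list_tape (unary N), int i)))" for i
          by (rule runs_weaken[OF runs_append_sym[where xs = "unary i"]])
            (use U4 in \<open>auto simp: F_def fun_eq_iff replicate_append_same\<close>)
      qed auto
      moreover have "F 0 = \<sigma>1" using s1(4)[of 4] by (auto simp: F_def fun_eq_iff)
      ultimately have 1: "runs (foreach U (append_sym 4 1)) \<sigma>1 (N * 8 + 6) (F N)" by simp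
      have "runs (rewind 4) (F N) (3 * length (unary N) + 4) ((F N)(4 := at_start (unary N)))"
        by (rule runs_rewind_end) (auto simp: F_def)
      then have 2: "runs (rewind 4) (F N) (3 * N + 4) \<sigma>2"
        by (rule runs_weaken) (auto simp: F_def \<sigma>2_def)
      show ?thesis by (rule runs_Seq[OF 1 2])
    qed
    define \<sigma>3 where "\<sigma>3 = \<sigma>2(1 := at_start cs, 2 := at_start (unary (length cs)),
      0 := (list_tape xs, int (Suc N)))"
    have s3: "runs classes_prog \<sigma>2 (60 + N * 50 + N * (N * 20 + 26) + 6 * size N) \<sigma>3"
    proof -
      have "\<sigma>2 1 = at_start []" "\<sigma>2 2 = at_start []" "\<sigma>2 0 = at_start xs"
        using s1(3) s1(4)[of 1] s1(4)[of 2] by (auto simp: \<sigma>2_def)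
      then have "classes_store \<sigma>2 xs [] 0 = \<sigma>2"
        by (auto simp: classes_store_def fun_eq_iff)
      moreover have "size N = length (cell_classes N x)" by (simp add: size_def length_cell_classes)
      moreover have "\<sigma>2 U = at_start (unary N)" "\<sigma>2 4 = at_start (unary N)"
        using s1(2) U4 by (simp_all add: \<sigma>2_def)
      ultimately show ?thesis
        using runs_classes_prog[where \<sigma> = \<sigma>2 and N = N, OF _ _ U4(1) x] by (simp add: \<sigma>3_def cs_def)
    qed
    define \<sigma>4 where "\<sigma>4 = \<sigma>3(3 := (ruler (2 * N + 2), 0))"
    have s4: "runs ruler_prog \<sigma>3 (N * 56 + 61) \<sigma>4"
    proof -
      have "\<sigma>3 3 = at_start []" "\<sigma>3 U = at_start (unary N)"
        using s1(2) s1(4)[of 3] U4 by (simp_all add: \<sigma>3_def \<sigma>2_def)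
      moreover from this have "\<sigma>3(3 := at_start []) = \<sigma>3" by (simp add: fun_upd_idem)
      ultimately show ?thesis
        using runs_ruler_prog[where \<sigma> = \<sigma>3 and N = N] by (simp add: \<sigma>4_def)
    qed
    have cs: "0 \<notin> set cs" "set cs \<subseteq> {..<10}" "length cs = size N"
      using zero_notin_classes set_cell_classes by (auto simp: cs_def size_def length_cell_classes)
    have "\<exists>q. runs (matrix_prog (6 + d) m ok) \<sigma>4
        (size N * (cell_size m * ((size N * (cell_size m * 20 + 1 + 6) + 6) + (size N * 7 + 6)) + 1 + 6) + 6)
        (\<sigma>4(3 := (ruler (2 * N + 2), q), 6 + d := at_end (matrix_syms m ok (2 * N + 2) cs (size N))))"
    proof (rule runs_matrix_prog[OF _ cs])
      show "6 + d \<notin> {1, 2, 3}" by simp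
      show "\<sigma>4 1 = at_start cs" "\<sigma>4 2 = at_start (unary (size N))" "\<sigma>4 3 = (ruler (2 * N + 2), 0)"
        by (simp_all add: \<sigma>4_def \<sigma>3_def cs(3))
      show "\<sigma>4 (6 + d) = at_end []"
        using s1(4)[of "6 + d"] by (simp add: \<sigma>4_def \<sigma>3_def \<sigma>2_def U_def)
    qed
    then obtain q where s5: "runs (matrix_prog (6 + d) m ok) \<sigma>4
        (size N * (cell_size m * ((size N * (cell_size m * 20 + 1 + 6) + 6) + (size N * 7 + 6)) + 1 + 6) + 6)
        (\<sigma>4(3 := (ruler (2 * N + 2), q), 6 + d := at_end (matrix_syms m ok (2 * N + 2) cs (size N))))"
      by blast
    define \<sigma>5 where "\<sigma>5 = \<sigma>4(3 := (ruler (2 * N + 2), q),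
      6 + d := at_end (matrix_syms m ok (2 * N + 2) cs (size N)))"
    have "runs prog (init_store x) (time n) \<sigma>5"
      unfolding prog_def time_def Let_def N_def[symmetric]
      using runs_Seq[OF s1(1) runs_Seq[OF s2 runs_Seq[OF s3 runs_Seq[OF s4 s5[folded \<sigma>5_def]]]]] .
    moreover have "fst (\<sigma>5 (7 + d - 1)) =
        contents (adjacency_string (grid_digraph m ok (2 * N + 2) cs))"
      using matrix_syms_eq_adjacency[OF m, of ok "2 * N + 2" cs]
      by (simp add: \<sigma>5_def contents_eq cs(3))
    ultimately show "\<exists>\<sigma>. runs prog (init_store x) (poly p (length x)) \<sigma> \<and>
        fst (\<sigma> (7 + d - 1)) = contents (adjacency_string (grid_digraph m ok
          (2 * (length x + c) ^ d + 2) (cell_classes ((length x + c) ^ d) x)))"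
      unfolding p[symmetric] N_def cs_def n_def by blast
  qed
qed

theorem theorem11:
  shows "NP_hard adjacency_string
    {G \<in> input_digraphs. max_degree (with_proj G) = 6}
    (\<lambda>G. colorable 2 (with_proj G))"
  unfolding NP_hard_def
proof
  fix L assume "L \<in> NP"
  then obtain M and p :: "nat poly" where wf: "tm_wf M"
    and time: "\<And>x c t. (tm_step M ^^ t) (tm_init M x) c \<Longrightarrow> t \<le> poly p (length x)"
    and acc: "\<And>x. x \<in> L \<longleftrightarrow> (\<exists>c. (tm_step M)\<^sup>*\<^sup>* (tm_init M x) c \<and> tm_halted M c \<and> fst c = 1)"
    unfolding NP_def by blast
  \<comment> \<open>This power serves both as the radius of the tape window and as the number of
    ordinary rows, and it strictly exceeds the length of every computation path.\<close>
  obtain c d where cd: "\<And>n. poly p n < (n + c) ^ d" using poly_less_power by blast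
  \<comment> \<open>\<open>m\<close> is chosen from \<open>M\<close> before any input is seen, so
    the cells have constant size.\<close>
  obtain m where m: "code_bound M m" using code_bound_exists by blast
  define G where "G x = grid_digraph m (tile_bits M m) (2 * (length x + c) ^ d + 2)
    (cell_classes ((length x + c) ^ d) x)" for x
  have "poly_time_computable (\<lambda>x. adjacency_string (G x))"
    unfolding G_def by (rule poly_time_grid) (use m in \<open>simp add: code_bound_def\<close>)
  moreover have "G x \<in> {G \<in> input_digraphs. max_degree (with_proj G) = 6}" for x
    unfolding G_def
    using grid.input_digraph_G[OF grid_tile_bits[OF m]] grid.max_degree_G[OF grid_tile_bits[OF m]]
    by blast
  moreover have "x \<in> L \<longleftrightarrow> colorable 2 (with_proj (G x))" for x
  proof -
    have "t < (length x + c) ^ d" if "(tm_step M ^^ t) (tm_init M x) c'" for c' t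
      using time[OF that] cd[of "length x"] by linarith
    then show ?thesis
      unfolding G_def acc using grid_digraph_correct[OF wf _ m] by metis
  qed
  ultimately show "\<exists>f. poly_time_computable f \<and>
      (\<forall>x. \<exists>G \<in> {G \<in> input_digraphs. max_degree (with_proj G) = 6}.
        f x = adjacency_string G \<and> (x \<in> L \<longleftrightarrow> colorable 2 (with_proj G)))"
    by blast
qed

end
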